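(* Let $a,b\in\{0,\ldots,11\}$ and let $\rho:\mathrm{SL}_2(\mathbb{Z})\to\mathrm{GL}_2(\mathbb{C})$ be an indecomposable representation which is an extension $1\to\chi^a\to\rho\to\chi^b\to1$ (i.e. $\rho$ has a subrepresentation equivalent to $\chi^a$ with quotient $\chi^b$). (1) If $(a,b)\neq(10,0),(11,1)$, then the generating weights of $\rho$ are $(a,b)$. (2) If $(a,b)=(10,0)$, the generating weights of $\rho$ are $(4,6)$; if $(a,b)=(11,1)$, they are $(5,7)$.
   Context: For $a\in\{0,\ldots,11\}$, $\chi^a$ denotes the unique character of $\mathrm{SL}_2(\mathbb{Z})$ with $\chi^a(T)=e^{2\pi i a/12}$, $T=\begin{pmatrix}1&1\\0&1\end{pmatrix}$ (these are all the characters). For a finite-dimensional representation $\rho:\mathrm{SL}_2(\mathbb{Z})\to\mathrm{GL}(V)$, let $L$ be the unique endomorphism with $e^{2\pi iL}=\rho(T)$ whose eigenvalues have real parts in $[0,1)$. A holomorphic vector-valued modular form of weight $k$ for $\rho$ is a holomorphic $F:\mathbb{H}\to V$ with $F(\gamma\tau)=(c\tau+d)^k\rho(\gamma)F(\tau)$ for all $\gamma=\begin{pmatrix}a&b\\c&d\end{pmatrix}\in\mathrm{SL}_2(\mathbb{Z})$ such that $e^{-2\pi i\tau L}F(\tau)$, a function of $q=e^{2\pi i\tau}$ on the punctured disc, extends holomorphically to $q=0$. $M(\rho)=\bigoplus_k M_k(\rho)$ is a free graded module of rank $\dim\rho$ over $R=\mathbb{C}[E_4,E_6]$; the generating weights of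 $\rho$ are the weights of a homogeneous $R$-basis. *)

theory Defs
  imports "HOL-Complex_Analysis.Complex_Analysis" "HOL-Algebra.Group" "HOL-Library.Multiset"
begin

section \<open>Representations of the modular group\<close>

definition SL2Z :: "(int^2^2) monoid" where
  "SL2Z = \<lparr>carrier = {A. det A = 1}, mult = (**), one = mat 1\<rparr>"

definition GL :: "(complex^'n^'n) monoid" where
  "GL = \<lparr>carrier = {A. invertible A}, mult = (**), one = mat 1\<rparr>"

definition complex_units :: "complex monoid" where
  "complex_units = \<lparr>carrier = UNIV - {0}, mult = (*), one = 1\<rparr>"

definition T_mat :: "int^2^2" where
  "T_mat = vector [vector [1, 1], vector [0, 1]]"

text \<open>This determines the values of \<open>ch\<close> on the carrier of \<^const>\<open>SL2Z\<close> uniquely; the values at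
  integer matrices of determinant other than 1 are irrelevant.\<close>

definition is_chi :: "nat \<Rightarrow> (int^2^2 \<Rightarrow> complex) \<Rightarrow> bool" where
  "is_chi a ch \<longleftrightarrow>
     ch \<in> hom SL2Z complex_units \<and> ch T_mat = exp (2 * of_real pi * \<i> * of_nat a / 12)"

definition subrepresentation :: "(int^2^2 \<Rightarrow> complex^'n^'n) \<Rightarrow> (complex^'n) set \<Rightarrow> bool" where
  "subrepresentation \<rho> U \<longleftrightarrow>
     vec.subspace U \<and> (\<forall>\<gamma>\<in>carrier SL2Z. \<forall>u\<in>U. \<rho> \<gamma> *v u \<in> U)"

definition indecomposable :: "(int^2^2 \<Rightarrow> complex^'n^'n) \<Rightarrow> bool" where
  "indecomposable \<rho> \<longleftrightarrow>
     \<not> (\<exists>U W. subrepresentation \<rho> U \<and> subrepresentation \<rho> W \<and> U \<noteq> {0} \<and> W \<noteq> {0} \<and>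
              U \<inter> W = {0} \<and> {u + w | u w. u \<in> U \<and> w \<in> W} = UNIV)"

text \<open>There is a short exact sequence of representations
  \<open>\<alpha> \<rightarrow> \<rho> \<rightarrow> \<beta>\<close>, where the characters \<open>\<alpha>\<close> and \<open>\<beta>\<close> act on the complex numbers by multiplication.\<close>

definition is_extension ::
  "(int^2^2 \<Rightarrow> complex) \<Rightarrow> (int^2^2 \<Rightarrow> complex^'n^'n) \<Rightarrow> (int^2^2 \<Rightarrow> complex) \<Rightarrow> bool" where
  "is_extension \<alpha> \<rho> \<beta> \<longleftrightarrow>
     (\<exists>(\<iota> :: complex \<Rightarrow> complex^'n) (p :: complex^'n \<Rightarrow> complex).
        Vector_Spaces.linear (*) (*s) \<iota> \<and> Vector_Spaces.linear (*s) (*) p \<and>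
        inj \<iota> \<and> surj p \<and> range \<iota> = {v. p v = 0} \<and>
        (\<forall>\<gamma>\<in>carrier SL2Z. (\<forall>z. \<iota> (\<alpha> \<gamma> * z) = \<rho> \<gamma> *v \<iota> z) \<and>
                         (\<forall>v. p (\<rho> \<gamma> *v v) = \<beta> \<gamma> * p v)))"


section \<open>The exponent matrix\<close>

text \<open>The multiplication of the type class \<^class>\<open>times\<close> on \<open>complex^'n^'n\<close> is entrywise, so the
  library functions \<^const>\<open>power\<close> and \<^const>\<open>exp\<close> do not give matrix powers and exponentials.
  Multiplication of a matrix by a complex scalar \<open>c\<close> is written as \<open>mat c ** A\<close>.\<close>

definition matrix_exp :: "complex^'n^'n \<Rightarrow> complex^'n^'n" where
  "matrix_exp A = (\<Sum>m. (((**) A) ^^ m) (mat 1) /\<^sub>R fact m)"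

definition matrix_eigenvalue :: "complex^'n^'n \<Rightarrow> complex \<Rightarrow> bool" where
  "matrix_eigenvalue A l \<longleftrightarrow> (\<exists>v. v \<noteq> 0 \<and> A *v v = l *s v)"

definition exponent_matrix :: "(int^2^2 \<Rightarrow> complex^'n^'n) \<Rightarrow> complex^'n^'n" where
  "exponent_matrix \<rho> =
     (THE L. matrix_exp (mat (2 * of_real pi * \<i>) ** L) = \<rho> T_mat \<and>
             (\<forall>l. matrix_eigenvalue L l \<longrightarrow> 0 \<le> Re l \<and> Re l < 1))"


section \<open>Vector-valued modular forms\<close>

definition upper_half_plane :: "complex set" where
  "upper_half_plane = {\<tau>. 0 < Im \<tau>}"

definition aut_factor :: "int^2^2 \<Rightarrow> complex \<Rightarrow> complex" where
  "aut_factor \<gamma> \<tau> = of_int (\<gamma>$2$1) * \<tau> + of_int (\<gamma>$2$2)"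

definition moebius :: "int^2^2 \<Rightarrow> complex \<Rightarrow> complex" where
  "moebius \<gamma> \<tau> = (of_int (\<gamma>$1$1) * \<tau> + of_int (\<gamma>$1$2)) / aut_factor \<gamma> \<tau>"

text \<open>A function on the upper half-plane is represented by its extension by 0 to all complex
  numbers, so that equality of forms is equality of functions. The equation
  \<open>e\<^bsup>-2\<pi>i\<tau>L\<^esup> F(\<tau>) = G(q)\<close> on the upper half-plane says both that the left-hand side is a function of
  \<open>q = e\<^bsup>2\<pi>i\<tau>\<^esup>\<close> and that this function extends holomorphically to \<open>q = 0\<close>.\<close>

definition modular_forms ::
  "(int^2^2 \<Rightarrow> complex^'n^'n) \<Rightarrow> int \<Rightarrow> (complex \<Rightarrow> complex^'n) set" where
  "modular_forms \<rho> k =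
     {F. (\<forall>i. (\<lambda>\<tau>. F \<tau> $ i) holomorphic_on upper_half_plane) \<and>
         (\<forall>\<tau>. \<tau> \<notin> upper_half_plane \<longrightarrow> F \<tau> = 0) \<and>
         (\<forall>\<gamma>\<in>carrier SL2Z. \<forall>\<tau>\<in>upper_half_plane.
            F (moebius \<gamma> \<tau>) = (aut_factor \<gamma> \<tau> powi k) *s (\<rho> \<gamma> *v F \<tau>)) \<and>
         (\<exists>G :: complex \<Rightarrow> complex^'n.
            (\<forall>i. (\<lambda>q. G q $ i) holomorphic_on ball 0 1) \<and>
            (\<forall>\<tau>\<in>upper_half_plane.
               matrix_exp (mat (- 2 * of_real pi * \<i> * \<tau>) ** exponent_matrix \<rho>) *v F \<tau> =
               G (exp (2 * of_real pi * \<i> * \<tau>))))}"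

text \<open>The direct sum of all weight spaces, as a space of functions; \<open>modular_forms_direct\<close> below
  shows that the sum is direct.\<close>

definition all_modular_forms ::
  "(int^2^2 \<Rightarrow> complex^'n^'n) \<Rightarrow> (complex \<Rightarrow> complex^'n) set" where
  "all_modular_forms \<rho> =
     {\<lambda>\<tau>. \<Sum>k\<in>K. f k \<tau> | K f. finite K \<and> (\<forall>k\<in>K. f k \<in> modular_forms \<rho> k)}"

lemma modular_forms_direct:
  fixes \<rho> :: "int^2^2 \<Rightarrow> complex^'n^'n"
  assumes \<rho>: "\<rho> \<in> hom SL2Z GL" and K: "finite K"
    and f: "\<And>k. k \<in> K \<Longrightarrow> f k \<in> modular_forms \<rho> k"
    and sum0: "\<And>\<tau>. (\<Sum>k\<in>K. f k \<tau>) = 0" and k: "k \<in> K"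
  shows "f k \<tau> = 0"
proof (cases "\<tau> \<in> upper_half_plane")
  case False
  with f[OF k] show ?thesis by (simp add: modular_forms_def)
next
  case True
  then have im: "Im \<tau> > 0" by (simp add: upper_half_plane_def)
  define x :: "nat \<Rightarrow> complex" where "x m = of_nat m * \<tau> + 1" for m
  have x_nz: "x m \<noteq> 0" for m
  proof
    assume "x m = 0"
    then have "Im (x m) = 0" "Re (x m) = 0" by simp_all
    with im show False by (auto simp: x_def)
  qed
  have inj_x: "inj x"
    using im by (auto simp: inj_def x_def)
  have vanish: "(\<Sum>k\<in>K. (x m powi k) *s f k \<tau>) = 0" for m
  proof -
    define g :: "int^2^2" where "g = vector [vector [1, 0], vector [int m, 1]]"
    have g: "g \<in> carrier SL2Z" by (simp add: SL2Z_def g_def det_2)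
    have j: "aut_factor g \<tau> = x m" by (simp add: aut_factor_def g_def x_def)
    have inv: "invertible (\<rho> g)"
      using \<rho> g by (auto simp: hom_def GL_def Pi_iff)
    have "\<rho> g *v (\<Sum>k\<in>K. (x m powi k) *s f k \<tau>) = (\<Sum>k\<in>K. (x m powi k) *s (\<rho> g *v f k \<tau>))"
      by (simp add: vec.linear_sum[OF matrix_vector_mul_linear_gen]
            vec.linear_scale[OF matrix_vector_mul_linear_gen])
    also have "\<dots> = (\<Sum>k\<in>K. f k (moebius g \<tau>))"
      using f g True by (intro sum.cong refl) (auto simp: modular_forms_def j)
    also have "\<dots> = 0" by (rule sum0)
    finally show ?thesis
      by (metis inv invertible_def matrix_vector_mul_assoc matrix_vector_mul_lid matrix_vector_mult_0_right)
  qed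
  define N where "N = Min K"
  have N: "N \<le> l" if "l \<in> K" for l using K that by (simp add: N_def)
  show ?thesis
  proof (rule vec_eq_iff[THEN iffD2], rule allI)
    fix i
    define P :: "complex poly" where "P = (\<Sum>l\<in>K. monom (f l \<tau> $ i) (nat (l - N)))"
    have root: "poly P (x m) = 0" for m
    proof -
      have "poly P (x m) = (\<Sum>l\<in>K. x m powi (l - N) * f l \<tau> $ i)"
        unfolding P_def poly_sum
        by (intro sum.cong refl) (use N in \<open>simp add: poly_monom power_int_def mult.commute\<close>)
      also have "\<dots> = x m powi (- N) * (\<Sum>l\<in>K. x m powi l * f l \<tau> $ i)"
        unfolding sum_distrib_left
        by (intro sum.cong refl) (simp add: power_int_diff x_nz power_int_minus field_simps)
      also have "(\<Sum>l\<in>K. x m powi l * f l \<tau> $ i) = (\<Sum>l\<in>K. (x m powi l) *s f l \<tau>) $ i"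
        by simp
      also have "\<dots> = 0" by (simp only: vanish zero_index)
      finally show ?thesis by simp
    qed
    have "P = 0"
    proof (rule ccontr)
      assume "P \<noteq> 0"
      then have "finite {z. poly P z = 0}" by (rule poly_roots_finite)
      moreover have "range x \<subseteq> {z. poly P z = 0}" using root by auto
      ultimately show False
        using inj_x finite_imageD finite_subset infinite_UNIV_nat by blast
    qed
    then have "0 = coeff P (nat (k - N))" by simp
    also have "\<dots> = (\<Sum>l\<in>K. if l = k then f l \<tau> $ i else 0)"
      unfolding P_def coeff_sum by (intro sum.cong refl) (use N k in \<open>simp add: eq_nat_nat_iff\<close>)
    also have "\<dots> = f k \<tau> $ i" using K k by simp
    finally show "f k \<tau> $ i = 0 $ i" by simp
  qed
qed


section \<open>The ring generated by the Eisenstein series, and generating weights\<close>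

text \<open>The Eisenstein series of weight \<open>k\<close>, with constant term 1 in its \<open>q\<close>-expansion
  (for even \<open>k \<ge> 4\<close>, where the sum is absolutely convergent).\<close>

definition eisenstein :: "nat \<Rightarrow> complex \<Rightarrow> complex" where
  "eisenstein k \<tau> =
     (\<Sum>\<^sub>\<infinity>(c, d)\<in>{(c :: int, d :: int). coprime c d}. 1 / (of_int c * \<tau> + of_int d) ^ k) / 2"

definition ring_E4_E6 :: "(complex \<Rightarrow> complex) set" where
  "ring_E4_E6 =
     {\<lambda>\<tau>. \<Sum>(i, j)\<in>S. c i j * eisenstein 4 \<tau> ^ i * eisenstein 6 \<tau> ^ j
       | (S :: (nat \<times> nat) set) (c :: nat \<Rightarrow> nat \<Rightarrow> complex). finite S}"

text \<open>The list \<open>Fs\<close> is a basis of the module of all modular forms for \<open>\<rho>\<close> over the ring above,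
  and its \<open>i\<close>-th element is homogeneous of weight \<open>ws ! i\<close>. Coefficients only matter
  on the upper half-plane.\<close>

definition homogeneous_basis ::
  "(int^2^2 \<Rightarrow> complex^'n^'n) \<Rightarrow> (complex \<Rightarrow> complex^'n) list \<Rightarrow> int list \<Rightarrow> bool" where
  "homogeneous_basis \<rho> Fs ws \<longleftrightarrow>
     length Fs = length ws \<and>
     (\<forall>i<length Fs. Fs ! i \<in> modular_forms \<rho> (ws ! i)) \<and>
     (\<forall>F\<in>all_modular_forms \<rho>. \<exists>r. (\<forall>i<length Fs. r i \<in> ring_E4_E6) \<and>
        (\<forall>\<tau>. F \<tau> = (\<Sum>i<length Fs. r i \<tau> *s (Fs ! i) \<tau>))) \<and>
     (\<forall>r. (\<forall>i<length Fs. r i \<in> ring_E4_E6) \<longrightarrow>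
        (\<forall>\<tau>. (\<Sum>i<length Fs. r i \<tau> *s (Fs ! i) \<tau>) = 0) \<longrightarrow>
        (\<forall>i<length Fs. \<forall>\<tau>\<in>upper_half_plane. r i \<tau> = 0))"

definition generating_weights :: "(int^2^2 \<Rightarrow> complex^'n^'n) \<Rightarrow> int multiset" where
  "generating_weights \<rho> = (THE W. \<exists>Fs ws. homogeneous_basis \<rho> Fs ws \<and> W = mset ws)"

end

theory Submission
  imports Defs "HOL-Real_Asymp.Real_Asymp"
begin

text \<open>In a basis of eigenvectors of \<open>\<rho>(T)\<close> the relations \<open>S\<^sup>4 = 1\<close> and \<open>(ST)\<^sup>3 = S\<^sup>2\<close> show that an
  indecomposable extension exists only for \<open>a - b \<equiv> \<plusminus>2 (mod 12)\<close>, and that \<open>\<rho>(S)\<close> is then determined up to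
  scaling one off-diagonal entry. A solution of the resulting cocycle equation is the primitive \<open>h\<close> of the weight 2
  form \<open>\<eta>\<^sup>4\<close> or \<open>E\<^sub>4/\<eta>\<^sup>4\<close>; the second component of a form for \<open>\<rho>\<close> is \<open>r \<eta>\<^bsup>2b\<^esup>\<close> with a scalar form \<open>r\<close>, and
  the first one is \<open>h r \<eta>\<^bsup>2b\<^esup>\<close> plus a scalar form. If this is holomorphic at the cusp for \<open>r = 1\<close>, the
  generating weights are \<open>a, b\<close>. It fails only for \<open>a = b + 10\<close>, where a relation between
  constant terms leaves a module with generators of weights \<open>b + 4, b + 6\<close>.

  The scalar theory needs neither the valence formula nor the product expansion of \<open>\<eta>\<close>. A form of weight
  \<open>k\<close> vanishes if its order at the cusp exceeds \<open>k/10.2\<close>, by the maximum principle. This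
  bound, applied to Rankin--Cohen brackets of \<open>E\<^sub>4\<close> and \<open>E\<^sub>6\<close>, yields a differential equation which shows
  that \<open>\<Delta> = E\<^sub>4\<^sup>3 - E\<^sub>6\<^sup>2\<close> has no zeros in the upper half-plane and a simple zero at the cusp; \<open>\<eta>\<^sup>2\<close> is
  replaced by a 12th root of \<open>\<Delta>\<close>.\<close>

section \<open>Forms of level one as functions of \<open>q\<close>\<close>

text \<open>The sharp constant in the vanishing bound would be 12. The weaker 10.2 still excludes
  cusp forms of weight at most 10 and double zeros at the cusp in weight at most 20, which covers
  the brackets that occur: their weights are 8, 12 and 16.

  The forms of weight 2 arise as follows. For a vector (h f, f) with f = \<eta>^(2b), the law under
  S reads h(-1/\<tau>) + h(\<tau>) = K with K nonzero, because the diagonal entries of \<rho>(S) are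
  opposite; the law under T multiplies h by exp(2 pi i (a - b) / 12). So h' is a scalar form of
  weight 2 whose character is the square of \<chi> or its inverse. \<eta>^4 has the former; the
  factor E4 lifts \<eta>^(-4) to weight 2 and keeps the latter. The leading exponents 1/6 and -1/6
  of these forms are inherited by h. Holomorphy of h f at the cusp asks that 1/6 + b/12 or -1/6 +
  b/12 be at least a/12; the difference is the integer 0 or 1 except for a = b + 10, where it is
  -1.\<close>

definition nome :: "complex \<Rightarrow> complex" where
  "nome \<tau> = exp (2 * of_real pi * \<i> * \<tau>)"

lemma norm_nome: "norm (nome \<tau>) = exp (- 2 * pi * Im \<tau>)"
  by (simp add: nome_def norm_exp_eq_Re)

lemma nome_nonzero [simp]: "nome \<tau> \<noteq> 0"
  by (simp add: nome_def)

lemma nome_in_ball [simp]: "nome \<tau> \<in> ball 0 1 \<longleftrightarrow> Im \<tau> > 0"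
  by (simp add: norm_nome zero_less_mult_iff)

lemma norm_nome_less_1 [simp]: "norm (nome \<tau>) < 1 \<longleftrightarrow> Im \<tau> > 0"
  using nome_in_ball[of \<tau>] by simp

lemma nome_add_1 [simp]: "nome (\<tau> + 1) = nome \<tau>"
  by (simp add: nome_def ring_distribs exp_add)

lemma nome_surj:
  assumes "q \<noteq> 0" "norm q < 1"
  obtains \<tau> where "Im \<tau> > 0" "nome \<tau> = q"
proof
  define \<tau> where "\<tau> = Ln q / (2 * of_real pi * \<i>)"
  show q: "nome \<tau> = q"
    using assms by (simp add: nome_def \<tau>_def)
  show "Im \<tau> > 0"
    using assms(2) q nome_in_ball[of \<tau>] by simp
qed

lemma has_field_derivative_nome [derivative_intros]:
  assumes "(f has_field_derivative f') (at \<tau> within A)"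
  shows "((\<lambda>\<tau>. nome (f \<tau>)) has_field_derivative 2 * of_real pi * \<i> * nome (f \<tau>) * f') (at \<tau> within A)"
  unfolding nome_def by (rule derivative_eq_intros refl assms)+ simp

lemma holomorphic_on_nome [holomorphic_intros]:
  assumes "f holomorphic_on A" shows "(\<lambda>\<tau>. nome (f \<tau>)) holomorphic_on A"
  unfolding nome_def by (intro holomorphic_intros assms)

lemma continuous_on_nome [continuous_intros]:
  assumes "continuous_on A f" shows "continuous_on A (\<lambda>\<tau>. nome (f \<tau>))"
  unfolding nome_def by (intro continuous_intros assms)

lemma Im_minus_inverse: "Im (-1 / \<tau>) = Im \<tau> / (norm \<tau>)\<^sup>2"
  by (simp add: Im_divide cmod_power2)

lemma minus_inverse_upper_half_plane:
  "Im \<tau> > 0 \<Longrightarrow> Im (-1 / \<tau>) > 0"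
  unfolding Im_minus_inverse by (auto intro!: divide_pos_pos)

lemma periodic_int:
  fixes f :: "complex \<Rightarrow> 'a"
  assumes T: "\<And>\<tau>. Im \<tau> > 0 \<Longrightarrow> f (\<tau> + 1) = f \<tau>" and "Im \<tau> > 0"
  shows "f (\<tau> + of_int n) = f \<tau>"
proof -
  have *: "f (\<tau> + of_nat n) = f \<tau>" if "Im \<tau> > 0" for \<tau> n
  proof (induction n)
    case (Suc n)
    then show ?case using T[of "\<tau> + of_nat n"] that by (simp add: algebra_simps)
  qed simp
  show ?thesis
  proof (cases "n \<ge> 0")
    case True
    then show ?thesis using *[OF assms(2), of "nat n"] by simp
  next
    case False
    then show ?thesis using *[of "\<tau> + of_int n" "nat (-n)"] assms(2) by simp
  qed
qed

text \<open>Identities obtained by cancelling a power of z - a hold only off a. Continuity carries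
  them to a, where they reveal a leading coefficient.\<close>

lemma holomorphic_eq_0_at:
  fixes f :: "complex \<Rightarrow> complex"
  assumes "f holomorphic_on S" "open S" "a \<in> S" "\<And>z. z \<in> S - {a} \<Longrightarrow> f z = 0"
  shows "f a = 0"
proof -
  have "isCont f a"
    using assms(1-3) holomorphic_on_imp_continuous_on by (metis continuous_on_eq_continuous_at)
  then have "(f \<longlongrightarrow> f a) (at a)" by (simp add: isCont_def)
  moreover have "eventually (\<lambda>z. f z = 0) (at a)"
    using eventually_at_in_open[OF assms(2,3)] by eventually_elim (use assms(4) in auto)
  ultimately have "((\<lambda>_. 0) \<longlongrightarrow> f a) (at a)"
    by (rule Lim_transform_eventually)
  then show ?thesis by (simp add: tendsto_const_iff)
qed

text \<open>If the real part is at most 1/2 in absolute value and the height is below 0.85, then the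
  squared norm is at most 0.25 + 0.7225 < 0.973, so the inversion raises the height at least by the
  factor 1/0.973 and the process stops. At the sharp height sqrt 3 / 2 there would be no such
  uniform gain.\<close>

lemma height_reduction:
  fixes A :: "complex \<Rightarrow> 'a"
  assumes \<tau>: "Im \<tau> > 0"
    and T: "\<And>\<tau>. Im \<tau> > 0 \<Longrightarrow> A (\<tau> + 1) = A \<tau>"
    and S: "\<And>\<tau>. Im \<tau> > 0 \<Longrightarrow> A (-1 / \<tau>) = A \<tau>"
  obtains \<tau>' where "\<bar>Re \<tau>'\<bar> \<le> 1/2" "Im \<tau>' \<ge> 85/100" "A \<tau>' = A \<tau>"
proof -
  have shift: "\<exists>\<tau>'. \<bar>Re \<tau>'\<bar> \<le> 1/2 \<and> Im \<tau>' = Im \<tau> \<and> A \<tau>' = A \<tau>" if "Im \<tau> > 0" for \<tau>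
  proof (intro exI[of _ "\<tau> + of_int (- round (Re \<tau>))"] conjI)
    show "\<bar>Re (\<tau> + of_int (- round (Re \<tau>)))\<bar> \<le> 1/2"
      using of_int_round_abs_le[of "Re \<tau>"] by (simp add: abs_minus_commute)
    show "A (\<tau> + of_int (- round (Re \<tau>))) = A \<tau>"
      by (rule periodic_int[of A, OF T that])
  qed simp
  have main: "\<exists>\<tau>'. \<bar>Re \<tau>'\<bar> \<le> 1/2 \<and> Im \<tau>' \<ge> 85/100 \<and> A \<tau>' = A \<tau>"
    if "Im \<tau> > 0" "Im \<tau> \<ge> 85/100 * (973/1000) ^ n" for \<tau> n
    using that
  proof (induction n arbitrary: \<tau>)
    case 0
    then show ?case using shift[of \<tau>] by auto
  next
    case (Suc n)
    obtain \<sigma> where \<sigma>: "\<bar>Re \<sigma>\<bar> \<le> 1/2" "Im \<sigma> = Im \<tau>" "A \<sigma> = A \<tau>"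
      using shift[OF Suc.prems(1)] by blast
    show ?case
    proof (cases "Im \<sigma> \<ge> 85/100")
      case True
      with \<sigma> show ?thesis by blast
    next
      case False
      have "(Re \<sigma>)\<^sup>2 \<le> (1/2)\<^sup>2" using \<sigma>(1) abs_le_square_iff[of "Re \<sigma>" "1/2"] by simp
      moreover have "(Im \<sigma>)\<^sup>2 \<le> (85/100)\<^sup>2"
        using False Suc.prems(1) \<sigma> by (intro power_mono) auto
      ultimately have n: "(norm \<sigma>)\<^sup>2 \<le> 973/1000"
        unfolding cmod_power2 by (simp add: power2_eq_square)
      have pos: "(norm \<sigma>)\<^sup>2 > 0" using Suc.prems \<sigma> by auto
      have "85/100 * (973/1000) ^ n \<le> Im \<sigma> / (973/1000)"
        using Suc.prems(2) \<sigma> by simp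
      also have "\<dots> \<le> Im \<sigma> / (norm \<sigma>)\<^sup>2"
        using n pos Suc.prems(1) \<sigma> by (intro divide_left_mono) auto
      finally have h: "85/100 * (973/1000) ^ n \<le> Im \<sigma> / (norm \<sigma>)\<^sup>2" .
      have "\<exists>\<tau>'. \<bar>Re \<tau>'\<bar> \<le> 1/2 \<and> Im \<tau>' \<ge> 85/100 \<and> A \<tau>' = A (-1/\<sigma>)"
      proof (intro Suc.IH)
        show "Im (-1/\<sigma>) > 0" using Suc.prems(1) \<sigma>(2) by (intro minus_inverse_upper_half_plane) simp
      qed (use h in \<open>simp only: Im_minus_inverse\<close>)
      then show ?thesis using S[of \<sigma>] Suc.prems(1) \<sigma> by auto
    qed
  qed
  obtain n where "(973/1000 :: real) ^ n < Im \<tau>"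
    using real_arch_pow_inv[OF \<tau>, of "973/1000"] by auto
  moreover have "(0::real) \<le> (973/1000) ^ n" by simp
  ultimately have "Im \<tau> \<ge> 85/100 * (973/1000) ^ n" by linarith
  then show ?thesis using main[OF \<tau>] that by blast
qed

section \<open>Modular forms of level one and the vanishing bound\<close>

text \<open>A modular form is represented by its \<open>q\<close>-expansion \<open>\<phi>\<close>, a function on the unit disc: then it is automatically
  invariant under \<open>\<tau> \<mapsto> \<tau> + 1\<close> and holomorphic at the cusp, where its value is \<open>\<phi> 0\<close>.\<close>

definition modular_q :: "int \<Rightarrow> (complex \<Rightarrow> complex) \<Rightarrow> bool" where
  "modular_q k \<phi> \<longleftrightarrow> \<phi> holomorphic_on ball 0 1 \<and>
     (\<forall>\<tau>. Im \<tau> > 0 \<longrightarrow> \<phi> (nome (-1 / \<tau>)) = \<tau> powi k * \<phi> (nome \<tau>))"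

lemma modular_q_holomorphic: "modular_q k \<phi> \<Longrightarrow> \<phi> holomorphic_on ball 0 1"
  and modular_q_S: "modular_q k \<phi> \<Longrightarrow> Im \<tau> > 0 \<Longrightarrow> \<phi> (nome (-1 / \<tau>)) = \<tau> powi k * \<phi> (nome \<tau>)"
  by (simp_all add: modular_q_def)

text \<open>The alternative d = 0 serves the vanishing order m = 0, that is, forms of negative
  weight.\<close>

lemma powr_exp_tendsto_0:
  fixes c d :: real
  assumes "d > 0 \<or> d = 0 \<and> c < 0"
  shows "((\<lambda>y. y powr c * exp (- d * y)) \<longlongrightarrow> 0) at_top"
  using assms
proof
  assume "d > 0"
  then show ?thesis by real_asymp
next
  assume "d = 0 \<and> c < 0"
  then show ?thesis by (auto intro!: tendsto_neg_powr filterlim_ident)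
qed

text \<open>The function \<open>y\<^bsup>k/2\<^esup> |\<phi>(q)|\<close> with \<open>y = Im \<tau>\<close> is invariant and attains its maximum at some \<open>\<tau>\<^sub>0\<close> with
  \<open>y\<^sub>0 \<ge> 0.85\<close>. Comparing \<open>\<psi>(q\<^sub>0)\<close> with the values of \<open>\<psi>\<close> on slightly larger circles yields \<open>m \<le> k / (4\<pi>y\<^sub>0)\<close>.\<close>

lemma modular_q_vanishing:
  assumes \<phi>: "modular_q k \<phi>" and \<psi>: "\<psi> holomorphic_on ball 0 1"
    and fac: "\<And>q. q \<in> ball 0 1 \<Longrightarrow> \<phi> q = q ^ m * \<psi> q"
    and k: "real_of_int k < 10.2 * real m"
    and q: "q \<in> ball 0 1"
  shows "\<phi> q = 0"
proof (rule ccontr)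
  assume "\<phi> q \<noteq> 0"
  have hol\<phi>: "\<phi> holomorphic_on ball 0 1" using \<phi> by (rule modular_q_holomorphic)
  \<comment> \<open>The value q = 0 is not a nome, so a nonzero value of \<phi> is needed in the
    punctured disc.\<close>
  have "\<exists>q\<in>ball 0 1. q \<noteq> 0 \<and> \<phi> q \<noteq> 0"
  proof (rule ccontr)
    assume *: "\<not> ?thesis"
    have "q = 0" using * q \<open>\<phi> q \<noteq> 0\<close> by blast
    have "\<phi> 0 = 0"
      by (rule holomorphic_eq_0_at[OF hol\<phi> open_ball]) (use * in auto)
    then show False using \<open>\<phi> q \<noteq> 0\<close> \<open>q = 0\<close> by simp
  qed
  then obtain \<tau>1 where \<tau>1: "Im \<tau>1 > 0" "\<phi> (nome \<tau>1) \<noteq> 0"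
    by (metis nome_surj mem_ball_0)
  define A where "A \<tau> = Im \<tau> powr (k / 2) * norm (\<phi> (nome \<tau>))" for \<tau>
  have AT: "A (\<tau> + 1) = A \<tau>" for \<tau> by (simp add: A_def)
  have AS: "A (-1 / \<tau>) = A \<tau>" if \<tau>: "Im \<tau> > 0" for \<tau>
  proof -
    have n: "norm \<tau> > 0" using \<tau> by auto
    have "((norm \<tau>)\<^sup>2) powr (k / 2) = norm \<tau> powr real_of_int k"
      using n by (simp add: powr_powr flip: powr_numeral)
    also have "\<dots> = norm \<tau> powi k" using n by (simp add: powr_real_of_int')
    finally have e: "((norm \<tau>)\<^sup>2) powr (k / 2) = norm \<tau> powi k" .
    have "A (-1/\<tau>) = (Im \<tau> / (norm \<tau>)\<^sup>2) powr (k / 2) * (norm \<tau> powi k * norm (\<phi> (nome \<tau>)))"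
      unfolding A_def Im_minus_inverse modular_q_S[OF \<phi> \<tau>] by (simp add: norm_mult norm_power_int)
    also have "\<dots> = A \<tau>"
      using n \<tau> by (simp add: A_def powr_divide e)
    finally show ?thesis .
  qed
  have A1: "A \<tau>1 > 0" using \<tau>1 by (simp add: A_def)
  define r where "r = exp (- 2 * pi * (85/100))"
  have r: "r > 0" "r < 1" by (auto simp: r_def)
  have "continuous_on (cball 0 r) \<psi>"
    using \<psi> r by (intro holomorphic_on_imp_continuous_on holomorphic_on_subset[OF \<psi>]) auto
  then have "compact (\<psi> ` cball 0 r)" by (intro compact_continuous_image) auto
  then obtain B where B: "\<And>z. z \<in> cball 0 r \<Longrightarrow> norm (\<psi> z) \<le> B"
    using compact_imp_bounded[of "\<psi> ` cball 0 r"] unfolding bounded_iff by (metis imageI)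
  define B' where "B' = max B 1"
  have B': "B' > 0" "\<And>z. z \<in> cball 0 r \<Longrightarrow> norm (\<psi> z) \<le> B'" using B by (fastforce simp: B'_def)+
  have Abound: "A \<tau> \<le> B' * (Im \<tau> powr (k / 2) * exp (- (2 * pi * m) * Im \<tau>))" if \<tau>: "Im \<tau> \<ge> 85/100" for \<tau>
  proof -
    have "nome \<tau> \<in> cball 0 r" using \<tau> by (simp add: norm_nome r_def)
    from B'(2)[OF this] have "norm (\<psi> (nome \<tau>)) \<le> B'" .
    moreover have "A \<tau> = norm (\<psi> (nome \<tau>)) * (Im \<tau> powr (k / 2) * exp (- (2 * pi * m) * Im \<tau>))"
      using \<tau> fac[of "nome \<tau>"] nome_in_ball[of \<tau>]
      by (simp add: A_def norm_mult norm_power norm_nome mult_ac flip: exp_of_nat_mult)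
    ultimately show ?thesis by (simp add: mult_right_mono)
  qed
  have "((\<lambda>y. B' * (y powr (k/2) * exp (- (2*pi*m) * y))) \<longlongrightarrow> B' * 0) at_top"
    using k by (intro tendsto_mult tendsto_const powr_exp_tendsto_0) (cases "m = 0", auto)
  then have "eventually (\<lambda>y. B' * (y powr (k/2) * exp (- (2*pi*m) * y)) < A \<tau>1) at_top"
    using A1 by (auto intro!: order_tendstoD)
  then obtain Y0 where Y0: "\<And>y. y \<ge> Y0 \<Longrightarrow> B' * (y powr (k/2) * exp (- (2*pi*m) * y)) < A \<tau>1"
    by (auto simp: eventually_at_top_linorder)
  \<comment> \<open>Above height Y the majorant of \<open>A\<close> stays below the value at
    \<tau>1, so the supremum of \<open>A\<close> is attained in the compact rectangle
    \<open>K\<close>.\<close>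
  define Y where "Y = max Y0 1"
  define K where "K = cbox (Complex (-1/2) (85/100)) (Complex (1/2) Y)"
  have K: "\<tau> \<in> K \<longleftrightarrow> \<bar>Re \<tau>\<bar> \<le> 1/2 \<and> Im \<tau> \<ge> 85/100 \<and> Im \<tau> \<le> Y" for \<tau>
    by (auto simp: K_def in_cbox_complex_iff abs_le_iff)
  have contK: "continuous_on K A"
  proof -
    have "continuous_on K (\<lambda>\<tau>. \<phi> (nome \<tau>))"
      by (rule continuous_on_compose2[OF holomorphic_on_imp_continuous_on[OF hol\<phi>]])
         (auto intro!: continuous_intros simp: K norm_nome)
    then show ?thesis unfolding A_def by (intro continuous_intros) (auto simp: K)
  qed
  have red: "\<exists>\<tau>'\<in>K. A \<tau>' = A \<tau>" if \<tau>: "Im \<tau> > 0" "A \<tau> \<ge> A \<tau>1" for \<tau>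
  proof -
    obtain \<tau>' where \<tau>': "\<bar>Re \<tau>'\<bar> \<le> 1/2" "Im \<tau>' \<ge> 85/100" "A \<tau>' = A \<tau>"
      using height_reduction[of \<tau> A] AS AT \<tau> by metis
    have "Im \<tau>' \<le> Y"
    proof (rule ccontr)
      assume "\<not> Im \<tau>' \<le> Y"
      then have "Im \<tau>' \<ge> Y0" by (simp add: Y_def)
      from Y0[OF this] Abound[OF \<tau>'(2)] \<tau>'(3) \<tau>(2) show False by simp
    qed
    with \<tau>' show ?thesis by (auto simp: K)
  qed
  have "K \<noteq> {}" using red[OF \<tau>1(1)] by auto
  then obtain \<tau>0 where \<tau>0: "\<tau>0 \<in> K" "\<And>\<tau>. \<tau> \<in> K \<Longrightarrow> A \<tau> \<le> A \<tau>0"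
    using continuous_attains_sup[OF _ _ contK] by (auto simp: K_def)
  have max: "A \<tau> \<le> A \<tau>0" if "Im \<tau> > 0" for \<tau>
    using red[OF that] red[OF \<tau>1(1)] \<tau>0(2) by (metis linorder_le_cases order_trans)
  define y0 where "y0 = Im \<tau>0"
  have y0: "y0 \<ge> 85/100" using \<tau>0(1) by (simp add: K y0_def)
  have M: "A \<tau>0 > 0" using max[OF \<tau>1(1)] A1 by linarith
  \<comment> \<open>The factor relating \<open>A\<close> to the norm of \<psi>. It depends on the
    height only, so the maximum of \<open>A\<close> at \<tau>0 and the maximum principle for \<psi>
    on circles around 0 combine to a statement about \<open>u\<close> alone.\<close>
  define u where "u y = y powr (- (k / 2)) * exp (2 * pi * m * y)" for y :: real
  have \<psi>A: "norm (\<psi> (nome \<tau>)) = A \<tau> * u (Im \<tau>)" if \<tau>: "Im \<tau> > 0" for \<tau>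
  proof -
    have "Im \<tau> powr (k/2) * Im \<tau> powr (- (k / 2)) = 1"
      using \<tau> by (simp flip: powr_add)
    then have "A \<tau> * u (Im \<tau>) = norm (\<phi> (nome \<tau>)) * exp (2 * pi * m * Im \<tau>)"
      by (simp add: A_def u_def mult_ac)
    also have "\<dots> = norm (\<psi> (nome \<tau>)) * (exp (- 2 * pi * Im \<tau>) ^ m * exp (2 * pi * m * Im \<tau>))"
      using fac[of "nome \<tau>"] \<tau> by (simp add: norm_mult norm_power norm_nome del: nome_in_ball)
    also have "exp (- 2 * pi * Im \<tau>) ^ m * exp (2 * pi * m * Im \<tau>) = 1"
      by (simp flip: exp_of_nat_mult exp_add add: mult_ac)
    finally show ?thesis by simp
  qed
  \<comment> \<open>A smaller height y means a larger circle, which encloses the nome of \<tau>0.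
    Some point of it has at least the same norm of \<psi>, but \<open>A\<close> is not larger there,
    so \<open>u\<close> must not be smaller.\<close>
  have umin: "u y0 \<le> u y" if y: "0 < y" "y < y0" for y
  proof -
    define R where "R = exp (- 2 * pi * y)"
    have R: "0 < R" "R < 1" using y by (auto simp: R_def)
    have q0: "nome \<tau>0 \<in> cball 0 R"
      using y by (simp add: R_def norm_nome y0_def)
    have "\<exists>w. norm w = R \<and> norm (\<psi> (nome \<tau>0)) \<le> norm (\<psi> w)"
    proof -
      have "compact (sphere (0::complex) R)" "sphere (0::complex) R \<noteq> {}" using R by auto
      moreover have "continuous_on (sphere 0 R) (\<lambda>w. norm (\<psi> w))"
        using \<psi> R by (intro continuous_intros holomorphic_on_imp_continuous_on holomorphic_on_subset[OF \<psi>]) auto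
      ultimately obtain w where w: "w \<in> sphere 0 R" "\<And>z. z \<in> sphere 0 R \<Longrightarrow> norm (\<psi> z) \<le> norm (\<psi> w)"
        using continuous_attains_sup by metis
      have "norm (\<psi> (nome \<tau>0)) \<le> norm (\<psi> w)"
      proof (rule maximum_modulus_frontier[of \<psi> "cball 0 R"])
        show "\<psi> holomorphic_on interior (cball 0 R)"
          using R by (intro holomorphic_on_subset[OF \<psi>]) auto
        show "continuous_on (closure (cball 0 R)) \<psi>"
          using R by (intro holomorphic_on_imp_continuous_on holomorphic_on_subset[OF \<psi>]) auto
        show "\<And>z. z \<in> frontier (cball 0 R) \<Longrightarrow> norm (\<psi> z) \<le> norm (\<psi> w)"
          using w R by (simp add: frontier_cball)
      qed (use q0 in auto)
      then show ?thesis using w by (auto simp: dist_norm)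
    qed
    then obtain w where w: "norm w = R" "norm (\<psi> (nome \<tau>0)) \<le> norm (\<psi> w)" by blast
    then obtain \<tau> where \<tau>: "Im \<tau> > 0" "nome \<tau> = w" using nome_surj[of w] R by (metis norm_zero less_irrefl)
    have "Im \<tau> = y" using \<tau> w by (auto simp: norm_nome R_def)
    have "A \<tau>0 * u y0 \<le> A \<tau> * u y"
      using w(2) \<psi>A[OF \<tau>(1)] \<psi>A[of \<tau>0] \<tau> \<open>Im \<tau> = y\<close> y0 by (simp add: y0_def)
    also have "\<dots> \<le> A \<tau>0 * u y"
      by (intro mult_right_mono max \<tau>) (simp add: u_def)
    finally show ?thesis using M by simp
  qed
  have deriv: "(u has_real_derivative u y0 * (2 * pi * m - k / (2 * y0))) (at y0)"
  proof -
    have e: "y0 powr (- (k / 2) - 1) = y0 powr (- (k / 2)) / y0"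
      using y0 powr_diff[of y0 "- (k / 2)" 1] by simp
    have "(u has_real_derivative (- (k / 2)) * y0 powr (- (k / 2) - 1) * exp (2 * pi * m * y0)
        + exp (2 * pi * m * y0) * (2 * pi * m) * y0 powr (- (k / 2))) (at y0)"
      unfolding u_def using y0 by (intro derivative_eq_intros refl | simp)+
    then show ?thesis unfolding e u_def using y0 by (simp add: field_simps)
  qed
  have "k < 4 * pi * m * y0"
  proof -
    \<comment> \<open>Here 10.2 = 4 * 3 * 0.85, from pi > 3 and y0 at least 0.85. It makes the
      derivative of \<open>u\<close> at y0 positive, against the minimality from the left.\<close>
    have "10.2 * real m \<le> 4 * pi * m * y0"
    proof -
      have "3 * (85/100) \<le> pi * y0" using y0 pi_gt3 by (intro mult_mono) auto
      then have "4 * real m * (3 * (85/100)) \<le> 4 * real m * (pi * y0)" by (intro mult_left_mono) auto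
      then show ?thesis by (simp add: mult_ac)
    qed
    with k show ?thesis by linarith
  qed
  then have "u y0 * (2 * pi * m - k / (2 * y0)) > 0"
    using y0 by (auto simp: u_def field_simps)
  from DERIV_pos_inc_left[OF deriv this] obtain d where
    d: "d > 0" "\<And>h. h > 0 \<Longrightarrow> h < d \<Longrightarrow> u (y0 - h) < u y0" by blast
  define h where "h = min (d / 2) (y0 / 2)"
  have "h > 0" "h < d" "0 < y0 - h" using d y0 by (auto simp: h_def min_def)
  with d(2)[of h] umin[of "y0 - h"] show False by simp
qed

section \<open>Rankin--Cohen brackets\<close>

lemma holomorphic_factor_root:
  fixes f :: "complex \<Rightarrow> complex"
  assumes "f holomorphic_on S" "open S" "f a = 0"
  obtains g where "g holomorphic_on S" "\<And>z. z \<in> S \<Longrightarrow> f z = (z - a) * g z" "g a = deriv f a"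
proof
  let ?g = "\<lambda>z. if z = a then deriv f a else f z / (z - a)"
  show "?g holomorphic_on S"
    by (rule pole_theorem_open_0[OF assms(1,2), of a]) (use assms(3) in auto)
qed (use assms(3) in auto)

section \<open>Operations on forms, and vanishing in low weight\<close>

lemma modular_q_mult:
  assumes "modular_q k \<phi>" "modular_q l \<psi>" "m = k + l"
  shows "modular_q m (\<lambda>q. \<phi> q * \<psi> q)"
  unfolding modular_q_def
proof (intro conjI allI impI)
  show "(\<lambda>q. \<phi> q * \<psi> q) holomorphic_on ball 0 1"
    using assms by (intro holomorphic_intros) (auto simp: modular_q_def)
  fix \<tau> :: complex assume \<tau>: "Im \<tau> > 0"
  then have "\<tau> powi m = \<tau> powi k * \<tau> powi l"
    unfolding assms(3) by (intro power_int_add) auto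
  then show "\<phi> (nome (-1 / \<tau>)) * \<psi> (nome (-1 / \<tau>)) = \<tau> powi m * (\<phi> (nome \<tau>) * \<psi> (nome \<tau>))"
    by (simp only: modular_q_S[OF assms(1) \<tau>] modular_q_S[OF assms(2) \<tau>] mult_ac)
qed

lemma modular_q_add:
  assumes "modular_q k \<phi>" "modular_q k \<psi>"
  shows "modular_q k (\<lambda>q. \<phi> q + \<psi> q)"
  using assms unfolding modular_q_def by (auto intro!: holomorphic_intros simp: ring_distribs)

lemma modular_q_diff:
  assumes "modular_q k \<phi>" "modular_q k \<psi>"
  shows "modular_q k (\<lambda>q. \<phi> q - \<psi> q)"
  using assms unfolding modular_q_def by (auto intro!: holomorphic_intros simp: ring_distribs)

lemma modular_q_const: "modular_q 0 (\<lambda>q. c)"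
  by (simp add: modular_q_def)

lemma modular_q_zero: "modular_q k (\<lambda>q. 0)"
  by (simp add: modular_q_def)

lemma modular_q_cmult: "modular_q k \<phi> \<Longrightarrow> modular_q k (\<lambda>q. c * \<phi> q)"
  using modular_q_mult[OF modular_q_const, of k \<phi> k] by simp

lemma modular_q_power:
  assumes "modular_q k \<phi>" "l = int n * k"
  shows "modular_q l (\<lambda>q. \<phi> q ^ n)"
  unfolding assms(2)
proof (induction n)
  case (Suc n)
  show ?case using modular_q_mult[OF assms(1) Suc, of "int (Suc n) * k"] by (simp add: ring_distribs)
qed (simp add: modular_q_const)

lemma modular_q_negative:
  assumes "modular_q k \<phi>" "k < 0" "q \<in> ball 0 1"
  shows "\<phi> q = 0"
  using assms by (intro modular_q_vanishing[of k \<phi> \<phi> 0]) (auto simp: modular_q_def)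

lemma modular_q_cusp_form:
  assumes "modular_q k \<phi>" "\<phi> 0 = 0" "k \<le> 10" "q \<in> ball 0 1"
  shows "\<phi> q = 0"
proof -
  obtain \<psi> where "\<psi> holomorphic_on ball 0 1" "\<And>z. z \<in> ball 0 1 \<Longrightarrow> \<phi> z = (z - 0) * \<psi> z"
    using holomorphic_factor_root[OF modular_q_holomorphic[OF assms(1)] open_ball assms(2)] by blast
  then show ?thesis
    using assms by (intro modular_q_vanishing[of k \<phi> \<psi> 1]) auto
qed

text \<open>The case m = 2 of the bound, since 20 < 20.4. It takes over the role of the dimension
  formula in the weights 12 and 16.\<close>

lemma modular_q_double_cusp_form:
  assumes "modular_q k \<phi>" "\<phi> 0 = 0" "deriv \<phi> 0 = 0" "k \<le> 20" "q \<in> ball 0 1"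
  shows "\<phi> q = 0"
proof -
  obtain \<psi> where \<psi>: "\<psi> holomorphic_on ball 0 1" "\<And>z. z \<in> ball 0 1 \<Longrightarrow> \<phi> z = (z - 0) * \<psi> z"
      "\<psi> 0 = 0"
    using holomorphic_factor_root[OF modular_q_holomorphic[OF assms(1)] open_ball assms(2)] unfolding assms(3) by blast
  obtain \<xi> where \<xi>: "\<xi> holomorphic_on ball 0 1" "\<And>z. z \<in> ball 0 1 \<Longrightarrow> \<psi> z = (z - 0) * \<xi> z"
    using holomorphic_factor_root[OF \<psi>(1) open_ball \<psi>(3)] by blast
  show ?thesis
  proof (rule modular_q_vanishing[OF assms(1) \<xi>(1) _ _ assms(5)])
    show "\<phi> q = q\<^sup>2 * \<xi> q" if "q \<in> ball 0 1" for q
      using \<psi>(2)[OF that] \<xi>(2)[OF that] by (simp add: power2_eq_square)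
  qed (use assms(4) in simp)
qed

lemma modular_q_weight_0:
  assumes "modular_q 0 \<phi>" "q \<in> ball 0 1"
  shows "\<phi> q = \<phi> 0"
  using modular_q_cusp_form[OF modular_q_diff[OF assms(1) modular_q_const[of "\<phi> 0"]], of q] assms(2) by simp

section \<open>The derivation q d/dq = (2 pi i)^(-1) d/d\<tau> and its behaviour under S\<close>

definition theta :: "(complex \<Rightarrow> complex) \<Rightarrow> complex \<Rightarrow> complex" where
  "theta \<phi> q = q * deriv \<phi> q"

lemma theta_holomorphic [holomorphic_intros]:
  "\<phi> holomorphic_on A \<Longrightarrow> open A \<Longrightarrow> theta \<phi> holomorphic_on A"
  unfolding theta_def[abs_def] by (intro holomorphic_intros)

lemma theta_0 [simp]: "theta \<phi> 0 = 0"
  by (simp add: theta_def)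

lemma has_field_derivative_compose_nome:
  assumes "\<phi> holomorphic_on ball 0 1" "Im (f \<tau>) > 0" "(f has_field_derivative f') (at \<tau>)"
  shows "((\<lambda>\<tau>. \<phi> (nome (f \<tau>))) has_field_derivative 2 * of_real pi * \<i> * theta \<phi> (nome (f \<tau>)) * f') (at \<tau>)"
proof -
  have "(\<phi> has_field_derivative deriv \<phi> (nome (f \<tau>))) (at (nome (f \<tau>)))"
    using assms by (intro holomorphic_derivI[OF assms(1)]) auto
  from DERIV_chain2[OF this has_field_derivative_nome[OF assms(3)]]
  show ?thesis by (simp add: theta_def mult_ac)
qed

lemma has_field_derivative_minus_inverse:
  "\<tau> \<noteq> 0 \<Longrightarrow> ((\<lambda>\<tau>. -1 / \<tau>) has_field_derivative 1 / \<tau>\<^sup>2) (at (\<tau>::complex))"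
  by (auto intro!: derivative_eq_intros simp: power2_eq_square)

text \<open>Both sides of the transformation law are differentiated in \<tau>; the inner derivative
  of -1/\<tau> is \<open>1 / \<tau>\<^sup>2\<close>. The right-hand side is an arbitrary
  \<open>R\<close> because the law of \<open>theta\<close> \<phi> itself, which is not modular, is
  differentiated once more later.\<close>

lemma theta_S:
  assumes hol: "\<phi> holomorphic_on ball 0 1"
    and S: "\<And>\<tau>. Im \<tau> > 0 \<Longrightarrow> \<phi> (nome (-1 / \<tau>)) = R \<tau>"
    and R: "(R has_field_derivative R') (at \<tau>)" and \<tau>: "Im \<tau> > 0"
  shows "theta \<phi> (nome (-1 / \<tau>)) = \<tau>\<^sup>2 * R' / (2 * of_real pi * \<i>)"
proof -
  have nz: "\<tau> \<noteq> 0" using \<tau> by auto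
  have "((\<lambda>\<tau>. \<phi> (nome (-1 / \<tau>))) has_field_derivative
      2 * of_real pi * \<i> * theta \<phi> (nome (-1 / \<tau>)) * (1 / \<tau>\<^sup>2)) (at \<tau>)"
    by (rule has_field_derivative_compose_nome[OF hol minus_inverse_upper_half_plane[OF \<tau>]
          has_field_derivative_minus_inverse[OF nz]])
  moreover have "((\<lambda>\<tau>. \<phi> (nome (-1 / \<tau>))) has_field_derivative R') (at \<tau>)"
    by (rule has_field_derivative_transform_within_open[OF R, of upper_half_plane])
       (use S \<tau> in \<open>auto simp: upper_half_plane_def open_halfspace_Im_gt\<close>)
  ultimately have "R' = 2 * of_real pi * \<i> * theta \<phi> (nome (-1 / \<tau>)) * (1 / \<tau>\<^sup>2)"
    by (rule DERIV_unique[rotated])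
  then show ?thesis using nz by simp
qed

lemma theta_modular:
  assumes \<phi>: "modular_q k \<phi>" and \<tau>: "Im \<tau> > 0"
  shows "theta \<phi> (nome (-1 / \<tau>)) = \<tau> powi k *
    (\<tau>\<^sup>2 * theta \<phi> (nome \<tau>) + of_int k / (2 * of_real pi * \<i>) * \<tau> * \<phi> (nome \<tau>))"
proof -
  have nz: "\<tau> \<noteq> 0" using \<tau> by auto
  have R: "((\<lambda>\<tau>. \<tau> powi k * \<phi> (nome \<tau>)) has_field_derivative
     (of_int k * \<tau> powi (k - 1) * \<phi> (nome \<tau>) + \<tau> powi k * (2 * of_real pi * \<i> * theta \<phi> (nome \<tau>)))) (at \<tau>)"
    using has_field_derivative_compose_nome[OF modular_q_holomorphic[OF \<phi>], of "\<lambda>x. x" \<tau> 1] \<tau> nz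
    by (auto intro!: derivative_eq_intros simp: mult_ac)
  have "theta \<phi> (nome (-1 / \<tau>)) = \<tau>\<^sup>2 * (of_int k * \<tau> powi (k - 1) * \<phi> (nome \<tau>) +
      \<tau> powi k * (2 * of_real pi * \<i> * theta \<phi> (nome \<tau>))) / (2 * of_real pi * \<i>)"
    by (rule theta_S[OF modular_q_holomorphic[OF \<phi>] modular_q_S[OF \<phi>] R \<tau>])
  moreover have "\<tau> powi (k - 1) = \<tau> powi k / \<tau>" using nz by (simp add: power_int_diff)
  ultimately show ?thesis
    using nz by (simp only:) (simp add: field_simps power2_eq_square)
qed

lemma theta_theta_modular:
  assumes \<phi>: "modular_q k \<phi>" and \<tau>: "Im \<tau> > 0"
  defines "c \<equiv> 1 / (2 * of_real pi * \<i>)"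
  shows "theta (theta \<phi>) (nome (-1 / \<tau>)) = \<tau> powi k *
    (\<tau> ^ 4 * theta (theta \<phi>) (nome \<tau>) + 2 * (of_int k + 1) * c * \<tau> ^ 3 * theta \<phi> (nome \<tau>)
      + of_int k * (of_int k + 1) * c\<^sup>2 * \<tau>\<^sup>2 * \<phi> (nome \<tau>))"
proof -
  have nz: "\<tau> \<noteq> 0" using \<tau> by auto
  have hol: "\<phi> holomorphic_on ball 0 1" "theta \<phi> holomorphic_on ball 0 1"
    by (intro holomorphic_intros open_ball modular_q_holomorphic[OF \<phi>])+
  have c: "2 * of_real pi * \<i> = 1 / c" "c \<noteq> 0" by (simp_all add: c_def)
  define f d a t where "f = \<phi> (nome \<tau>)" and "d = theta \<phi> (nome \<tau>)"
    and "a = theta (theta \<phi>) (nome \<tau>)" and "t = \<tau> powi k"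
  have df: "((\<lambda>\<tau>. \<phi> (nome \<tau>)) has_field_derivative d / c) (at \<tau>)"
    using has_field_derivative_compose_nome[OF hol(1), of "\<lambda>x. x" \<tau> 1] \<tau> by (simp add: c d_def)
  have dd: "((\<lambda>\<tau>. theta \<phi> (nome \<tau>)) has_field_derivative a / c) (at \<tau>)"
    using has_field_derivative_compose_nome[OF hol(2), of "\<lambda>x. x" \<tau> 1] \<tau> by (simp add: c a_def)
  have dt: "((\<lambda>\<tau>. \<tau> powi k) has_field_derivative of_int k * t / \<tau>) (at \<tau>)"
    using nz by (auto intro!: derivative_eq_intros simp: t_def power_int_diff)
  define X' where "X' = 2 * \<tau> * d + \<tau>\<^sup>2 * (a / c) + of_int k * c * f + of_int k * c * \<tau> * (d / c)"
  have R: "((\<lambda>\<tau>. \<tau> powi k * (\<tau>\<^sup>2 * theta \<phi> (nome \<tau>) + of_int k / (2 * of_real pi * \<i>) * \<tau> * \<phi> (nome \<tau>)))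
      has_field_derivative of_int k * t / \<tau> * (\<tau>\<^sup>2 * d + of_int k * c * \<tau> * f) + X' * t) (at \<tau>)"
  proof -
    have "((\<lambda>\<tau>. \<tau>\<^sup>2 * theta \<phi> (nome \<tau>) + of_int k * c * \<tau> * \<phi> (nome \<tau>)) has_field_derivative X') (at \<tau>)"
      unfolding X'_def by (rule derivative_eq_intros df dd refl)+ (simp add: d_def f_def)
    from DERIV_mult[OF dt this] show ?thesis
      by (simp add: t_def d_def f_def c_def)
  qed
  have "theta (theta \<phi>) (nome (-1 / \<tau>)) =
      \<tau>\<^sup>2 * (of_int k * t / \<tau> * (\<tau>\<^sup>2 * d + of_int k * c * \<tau> * f) + X' * t) / (1 / c)"
    unfolding c(1)[symmetric] by (rule theta_S[OF hol(2) theta_modular[OF \<phi>] R \<tau>])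
  also have "\<dots> = t * (\<tau> ^ 4 * a + 2 * (of_int k + 1) * c * \<tau> ^ 3 * d + of_int k * (of_int k + 1) * c\<^sup>2 * \<tau>\<^sup>2 * f)"
    unfolding X'_def using nz c(2) by (simp add: field_simps eval_nat_numeral)
  finally show ?thesis by (simp only: t_def d_def f_def a_def)
qed

definition rc_bracket1 :: "int \<Rightarrow> (complex \<Rightarrow> complex) \<Rightarrow> int \<Rightarrow> (complex \<Rightarrow> complex) \<Rightarrow> complex \<Rightarrow> complex" where
  "rc_bracket1 k \<phi> l \<psi> q = of_int k * \<phi> q * theta \<psi> q - of_int l * \<psi> q * theta \<phi> q"

text \<open>This is the second bracket of \<phi> with itself, divided by k + 1. The coefficients are
  those for which the lower powers of \<tau> in the laws of the derivatives cancel.\<close>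

definition rc_bracket2 :: "int \<Rightarrow> (complex \<Rightarrow> complex) \<Rightarrow> complex \<Rightarrow> complex" where
  "rc_bracket2 k \<phi> q = of_int k * \<phi> q * theta (theta \<phi>) q - (of_int k + 1) * (theta \<phi> q)\<^sup>2"

lemma rc_bracket_0 [simp]: "rc_bracket1 k \<phi> l \<psi> 0 = 0" "rc_bracket2 k \<phi> 0 = 0"
  by (simp_all add: rc_bracket1_def rc_bracket2_def)

lemma modular_q_rc_bracket1:
  assumes \<phi>: "modular_q k \<phi>" and \<psi>: "modular_q l \<psi>" and m: "m = k + l + 2"
  shows "modular_q m (rc_bracket1 k \<phi> l \<psi>)"
  unfolding modular_q_def
proof (intro conjI allI impI)
  show "rc_bracket1 k \<phi> l \<psi> holomorphic_on ball 0 1"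
    unfolding rc_bracket1_def[abs_def]
    by (intro holomorphic_intros open_ball modular_q_holomorphic[OF \<phi>] modular_q_holomorphic[OF \<psi>])
  fix \<tau> :: complex assume \<tau>: "Im \<tau> > 0"
  then have nz: "\<tau> \<noteq> 0" by auto
  show "rc_bracket1 k \<phi> l \<psi> (nome (-1 / \<tau>)) = \<tau> powi m * rc_bracket1 k \<phi> l \<psi> (nome \<tau>)"
    unfolding rc_bracket1_def theta_modular[OF \<phi> \<tau>] theta_modular[OF \<psi> \<tau>]
      modular_q_S[OF \<phi> \<tau>] modular_q_S[OF \<psi> \<tau>] m
    using nz by (simp add: power_int_add algebra_simps)
qed

lemma modular_q_rc_bracket2:
  assumes \<phi>: "modular_q k \<phi>" and m: "m = 2 * k + 4"
  shows "modular_q m (rc_bracket2 k \<phi>)"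
  unfolding modular_q_def
proof (intro conjI allI impI)
  show "rc_bracket2 k \<phi> holomorphic_on ball 0 1"
    unfolding rc_bracket2_def[abs_def]
    by (intro holomorphic_intros open_ball modular_q_holomorphic[OF \<phi>])
  fix \<tau> :: complex assume \<tau>: "Im \<tau> > 0"
  then have nz: "\<tau> \<noteq> 0" by auto
  have m': "m = k + k + 4" using m by simp
  define t where "t = \<tau> powi k"
  have tm: "\<tau> powi m = t * t * \<tau> ^ 4" using power_int_add[of \<tau> "k + k" 4] power_int_add[of \<tau> k k] nz by (simp only: m' t_def) simp
  define c where "c = 1 / (2 * of_real pi * \<i>)"
  have c: "of_int k / (2 * of_real pi * \<i>) = of_int k * c" by (simp add: c_def)
  show "rc_bracket2 k \<phi> (nome (-1 / \<tau>)) = \<tau> powi m * rc_bracket2 k \<phi> (nome \<tau>)"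
    unfolding rc_bracket2_def theta_theta_modular[OF \<phi> \<tau>] theta_modular[OF \<phi> \<tau>]
      modular_q_S[OF \<phi> \<tau>] tm c c_def[symmetric] t_def[symmetric]
    by (simp add: algebra_simps eval_nat_numeral)
qed

text \<open>In other words, a zero of order \<open>p + 1\<close> of the form is a zero of order exactly \<open>2p\<close> of the bracket.\<close>

lemma rc_bracket2_order:
  assumes S: "open S" "q0 \<in> S" and A: "A holomorphic_on S" and h: "h holomorphic_on S"
    and \<phi>: "\<And>z. z \<in> S \<Longrightarrow> \<phi> z = (z - q0) ^ Suc p * A z"
    and b: "\<And>z. z \<in> S \<Longrightarrow> rc_bracket2 k \<phi> z = (z - q0) ^ (2 * p + 1) * h z"
    and k: "k > 0" and q0: "q0 \<noteq> 0"
  shows "A q0 = 0"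
proof -
  define B where "B z = of_nat (Suc p) * A z + (z - q0) * deriv A z" for z
  define C where "C z = of_nat p * z * B z + (z - q0) * (B z + z * deriv B z)" for z
  have B: "B holomorphic_on S"
    unfolding B_def[abs_def] by (intro holomorphic_intros A S)
  have C: "C holomorphic_on S"
    unfolding C_def[abs_def] by (intro holomorphic_intros B S)
  have th1: "theta \<phi> z = z * (z - q0) ^ p * B z" if z: "z \<in> S" for z
  proof -
    have "((\<lambda>z. (z - q0) ^ Suc p * A z) has_field_derivative (z - q0) ^ p * B z) (at z)"
      unfolding B_def
      by (rule derivative_eq_intros refl holomorphic_derivI[OF A S(1) z])+ (simp add: algebra_simps)
    then have "(\<phi> has_field_derivative (z - q0) ^ p * B z) (at z)"
      by (rule has_field_derivative_transform_within_open[OF _ S(1) z]) (use \<phi> in auto)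
    then show ?thesis by (simp add: theta_def DERIV_imp_deriv)
  qed
  \<comment> \<open>The extra factor z - q0 avoids the exponent p - 1, which truncated subtraction
    would spoil for p = 0.\<close>
  have th2: "(z - q0) * theta (theta \<phi>) z = z * (z - q0) ^ p * C z" if z: "z \<in> S" for z
  proof -
    have "((\<lambda>z. z * (z - q0) ^ p * B z) has_field_derivative
        (z - q0) ^ p * (B z + z * deriv B z) + of_nat p * (z - q0) ^ (p - 1) * z * B z) (at z)"
      by (rule derivative_eq_intros refl holomorphic_derivI[OF B S(1) z])+ (simp add: algebra_simps)
    then have "(theta \<phi> has_field_derivative
        (z - q0) ^ p * (B z + z * deriv B z) + of_nat p * (z - q0) ^ (p - 1) * z * B z) (at z)"
      by (rule has_field_derivative_transform_within_open[OF _ S(1) z]) (use th1 in auto)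
    then have "theta (theta \<phi>) z =
        z * ((z - q0) ^ p * (B z + z * deriv B z) + of_nat p * (z - q0) ^ (p - 1) * z * B z)"
      by (simp add: theta_def DERIV_imp_deriv)
    moreover define w t r where "w = z - q0" and "t = w ^ p" and "r = of_nat p * w ^ (p - 1)"
    moreover have r: "w * r = of_nat p * t"
      unfolding r_def t_def by (cases p) (simp_all add: mult_ac)
    ultimately have th: "theta (theta \<phi>) z = z * (t * (B z + z * deriv B z) + r * z * B z)"
      by simp
    have "w * theta (theta \<phi>) z = z * (w * t * (B z + z * deriv B z) + (w * r) * z * B z)"
      unfolding th by algebra
    also have "\<dots> = z * t * C z"
      unfolding C_def w_def[symmetric] r by algebra
    finally show ?thesis by (simp only: w_def t_def)
  qed
  \<comment> \<open>The bracket with the common power of z - q0 cancelled, minus its assumed form.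
    At q0 only the leading coefficient of the bracket remains: k p (p + 1) - (k + 1) (p + 1)^2 = -
    (p + 1) (k + p + 1), up to the square of q0 A(q0). It is nonzero for positive k.\<close>
  define E where "E z = z * (of_int k * A z * C z - (of_int k + 1) * z * (B z)\<^sup>2) - (z - q0) * h z" for z
  have E0: "E z = 0" if z: "z \<in> S - {q0}" for z
  proof -
    have zS: "z \<in> S" using z by simp
    define w t where "w = z - q0" and "t = w ^ p"
    have w: "w ^ Suc p = w * t" "w ^ (2 * p + 1) = w * t * t" "w \<noteq> 0" "t \<noteq> 0"
      using z by (simp_all add: w_def t_def mult_2 power_add)
    have "w * t * t * (w * h z) = w * rc_bracket2 k \<phi> z"
      unfolding b[OF zS] w_def[symmetric] w(2) by (simp add: mult_ac)
    also have "\<dots> = of_int k * \<phi> z * (w * theta (theta \<phi>) z) - (of_int k + 1) * w * (theta \<phi> z)\<^sup>2"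
      unfolding rc_bracket2_def by algebra
    also have "\<dots> = w * t * t * (z * (of_int k * A z * C z - (of_int k + 1) * z * (B z)\<^sup>2))"
      unfolding th1[OF zS] th2[OF zS, folded w_def] \<phi>[OF zS] w_def[symmetric] t_def[symmetric] w(1)
      by (simp add: power2_eq_square algebra_simps)
    finally show ?thesis using w by (simp add: E_def flip: w_def)
  qed
  have "E holomorphic_on S" unfolding E_def by (intro holomorphic_intros A B C h)
  then have "E q0 = 0" by (rule holomorphic_eq_0_at[OF _ S E0])
  moreover have "E q0 = - (of_nat (Suc p) * (of_int k + of_nat (Suc p))) * q0\<^sup>2 * (A q0)\<^sup>2"
    by (simp add: E_def B_def C_def algebra_simps power2_eq_square)
  moreover have "(of_int k + of_nat (Suc p) :: complex) \<noteq> 0"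
  proof -
    have "(of_int k + of_nat (Suc p) :: complex) = of_int (k + int (Suc p))" by simp
    moreover have "k + int (Suc p) \<noteq> 0" using k by simp
    ultimately show ?thesis by (simp only: of_int_eq_0_iff not_False_eq_True)
  qed
  ultimately show ?thesis using q0 by (auto simp del: of_nat_Suc simp: of_nat_neq_0)
qed

section \<open>Eisenstein series\<close>

lemma nome_eq_imp:
  assumes "nome \<tau> = nome \<sigma>"
  obtains n :: int where "\<tau> = \<sigma> + of_int n"
proof -
  obtain n :: int where n: "2 * of_real pi * \<i> * \<tau> = 2 * of_real pi * \<i> * \<sigma> + of_real (2 * of_int n * pi) * \<i>"
    using assms unfolding nome_def exp_eq by auto
  have "2 * of_real pi * \<i> * \<tau> = 2 * of_real pi * \<i> * (\<sigma> + of_int n)"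
    unfolding n by (simp add: algebra_simps)
  then have "\<tau> = \<sigma> + of_int n" by simp
  then show ?thesis by (rule that)
qed

lemma nome_Ln: "q \<noteq> 0 \<Longrightarrow> nome (Ln q / (2 * of_real pi * \<i>)) = q"
  by (simp add: nome_def)

lemma periodic_Ln_nome:
  fixes f :: "complex \<Rightarrow> 'a"
  assumes T: "\<And>\<tau>. Im \<tau> > 0 \<Longrightarrow> f (\<tau> + 1) = f \<tau>" and "Im \<tau> > 0"
  shows "f (Ln (nome \<tau>) / (2 * of_real pi * \<i>)) = f \<tau>"
proof -
  have "nome (Ln (nome \<tau>) / (2 * of_real pi * \<i>)) = nome \<tau>" by (rule nome_Ln) simp
  then obtain n where "Ln (nome \<tau>) / (2 * of_real pi * \<i>) = \<tau> + of_int n"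
    by (rule nome_eq_imp)
  then show ?thesis using periodic_int[of f, OF T assms(2)] by simp
qed

text \<open>\<open>Ln\<close> jumps at the negative axis, but periodicity makes the composite
  independent of the branch, so near each point a continuous local branch may be used
  instead.\<close>

lemma periodic_holomorphic:
  assumes hol: "f holomorphic_on {\<tau>. Im \<tau> > 0}"
    and T: "\<And>\<tau>. Im \<tau> > 0 \<Longrightarrow> f (\<tau> + 1) = f \<tau>"
  shows "(\<lambda>q. f (Ln q / (2 * of_real pi * \<i>))) holomorphic_on ball 0 1 - {0}"
proof -
  have "\<exists>f'. ((\<lambda>q. f (Ln q / (2 * of_real pi * \<i>))) has_field_derivative f') (at q0)"
    if q0: "q0 \<in> ball 0 1 - {0}" for q0
  proof -
    \<comment> \<open>For q near q0 the quotient q / q0 lies in the right half-plane, where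
      \<open>Ln\<close> is holomorphic.\<close>
    define L where "L q = (Ln (q / q0) + Ln q0) / (2 * of_real pi * \<i>)" for q
    define S where "S = ball q0 (norm q0) \<inter> ball 0 1"
    have Re: "Re (q / q0) > 0" if "q \<in> S" for q
    proof -
      have "norm (q / q0 - 1) = norm (q - q0) / norm q0"
        using q0 by (simp add: field_simps flip: norm_divide)
      also have "\<dots> < 1" using that q0 by (simp add: S_def dist_norm norm_minus_commute)
      finally have "norm (q / q0 - 1) < 1" .
      then have "\<bar>Re (q / q0 - 1)\<bar> < 1" using abs_Re_le_cmod[of "q / q0 - 1"] by linarith
      then show ?thesis by simp
    qed
    have nz: "q \<noteq> 0" if "q \<in> S" for q using Re[OF that] by auto
    have nL: "nome (L q) = q" if "q \<in> S" for q
      using nz[OF that] q0 by (simp add: nome_def L_def exp_add)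
    have ImL: "Im (L q) > 0" if "q \<in> S" for q
      using nL[OF that] that nome_in_ball[of "L q"] by (simp add: S_def)
    have "L holomorphic_on S" unfolding L_def
      using Re q0 by (intro holomorphic_intros) (auto simp: complex_nonpos_Reals_iff dest!: Re)
    then have "(f \<circ> L) holomorphic_on S"
      by (rule holomorphic_on_compose_gen[OF _ hol]) (use ImL in auto)
    moreover have "open S" "q0 \<in> S" using q0 by (auto simp: S_def)
    ultimately have "((f \<circ> L) has_field_derivative deriv (f \<circ> L) q0) (at q0)"
      by (rule holomorphic_derivI)
    then have "((\<lambda>q. f (Ln q / (2 * of_real pi * \<i>))) has_field_derivative deriv (f \<circ> L) q0) (at q0)"
    proof (rule has_field_derivative_transform_within_open[OF _ \<open>open S\<close> \<open>q0 \<in> S\<close>])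
      fix q assume q: "q \<in> S"
      show "(f \<circ> L) q = f (Ln q / (2 * of_real pi * \<i>))"
        using periodic_Ln_nome[of f, OF T ImL[OF q]] nL[OF q] by simp
    qed
    then show ?thesis by blast
  qed
  then show ?thesis
    by (simp add: holomorphic_on_open open_delete)
qed

section \<open>Convergence of the Eisenstein series\<close>

abbreviation "coprime_pairs \<equiv> {(c :: int, d :: int). coprime c d}"

lemma inverse_square_summable_int: "(\<lambda>c::int. 1 / (1 + (of_int c)\<^sup>2) :: real) summable_on UNIV"
proof -
  have "summable (\<lambda>n. 1 / (1 + (real n)\<^sup>2))"
  proof (rule summable_comparison_test)
    show "\<exists>N. \<forall>n\<ge>N. norm (1 / (1 + (real n)\<^sup>2)) \<le> inverse ((real n)\<^sup>2)"
      by (intro exI[of _ 1]) (auto simp: inverse_eq_divide intro!: divide_left_mono mult_pos_pos add_pos_nonneg)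
    show "summable (\<lambda>n. inverse ((real n)\<^sup>2))" by (rule inverse_power_summable) simp
  qed
  then have n: "(\<lambda>n. 1 / (1 + (real n)\<^sup>2)) summable_on UNIV"
    by (subst summable_on_UNIV_nonneg_real_iff) auto
  have "(\<lambda>c::int. 1 / (1 + (of_int c)\<^sup>2) :: real) summable_on range int"
    by (subst summable_on_reindex) (use n in \<open>auto simp: o_def\<close>)
  moreover have "(\<lambda>c::int. 1 / (1 + (of_int c)\<^sup>2) :: real) summable_on range (\<lambda>n. - int n)"
    by (subst summable_on_reindex) (use n in \<open>auto simp: o_def inj_on_def\<close>)
  ultimately have "(\<lambda>c::int. 1 / (1 + (of_int c)\<^sup>2) :: real) summable_on (range int \<union> range (\<lambda>n. - int n))"
    by (rule summable_on_union)
  moreover have "range int \<union> range (\<lambda>n. - int n) = UNIV"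
    by (auto simp: image_iff) (metis int_cases2)
  ultimately show ?thesis by simp
qed

lemma eisenstein_majorant_summable:
  "(\<lambda>(c::int, d::int). M / ((1 + (of_int c)\<^sup>2) * (1 + (of_int d)\<^sup>2)) :: real) summable_on coprime_pairs"
proof -
  let ?g = "\<lambda>c::int. 1 / (1 + (of_int c)\<^sup>2) :: real"
  have "(\<lambda>x. ?g (fst x) * ?g (snd x)) summable_on (SIGMA c:UNIV. UNIV)"
  proof (rule summable_on_SigmaI[where g = "\<lambda>c. ?g c * infsum ?g UNIV"])
    show "((\<lambda>y. ?g (fst (c, y)) * ?g (snd (c, y))) has_sum ?g c * infsum ?g UNIV) UNIV" for c
      using has_sum_cmult_right[OF has_sum_infsum[OF inverse_square_summable_int], of "?g c"] by simp
    show "(\<lambda>c. ?g c * infsum ?g UNIV) summable_on UNIV"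
      by (rule summable_on_cmult_left[OF inverse_square_summable_int])
  qed auto
  then have "(\<lambda>x. M * (?g (fst x) * ?g (snd x))) summable_on coprime_pairs"
    by (intro summable_on_cmult_right) (rule summable_on_subset_banach, auto)
  then show ?thesis by (simp add: case_prod_unfold)
qed

text \<open>Two inequalities give a majorant that is a product over c and d: the squared norm of c
  \<tau> + d dominates c^2 + d^2 up to a constant, and 3 (c^2 + d^2)^2 dominates (1 + c^2) (1 +
  d^2). Coprimality is used through (c, d) being nonzero.\<close>

lemma eisenstein_term_bound:
  assumes h: "h > 0" and k: "k = 2 * m" "m \<ge> 2"
  obtains M where "\<And>c d \<tau>. coprime (c::int) d \<Longrightarrow> \<bar>Re \<tau>\<bar> \<le> A \<Longrightarrow> Im \<tau> \<ge> h \<Longrightarrow>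
    norm (1 / (of_int c * \<tau> + of_int d) ^ k) \<le> M / ((1 + (of_int c)\<^sup>2) * (1 + (of_int d)\<^sup>2))"
proof
  \<comment> \<open>The 2 and the term with A come from D^2 \<le> 2 (C x + D)^2 + 2 C^2 x^2;
    division by h^2 replaces C^2 by a multiple of C^2 y^2.\<close>
  define K where "K = 2 + (1 + 2 * A\<^sup>2) / h\<^sup>2"
  have K: "K \<ge> 2" by (simp add: K_def)
  fix c d :: int and \<tau> :: complex
  assume cd: "coprime c d" and \<tau>: "\<bar>Re \<tau>\<bar> \<le> A" "Im \<tau> \<ge> h"
  define x y where "x = Re \<tau>" and "y = Im \<tau>"
  define C D where "C = real_of_int c" and "D = real_of_int d"
  define N where "N = (C * x + D)\<^sup>2 + C\<^sup>2 * y\<^sup>2"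
  have N: "(norm (of_int c * \<tau> + of_int d))\<^sup>2 = N"
    by (simp add: cmod_power2 N_def x_def y_def C_def D_def power_mult_distrib)
  have x2: "x\<^sup>2 \<le> A\<^sup>2" using \<tau> abs_le_square_iff[of x A] by (simp add: x_def)
  have y2: "h\<^sup>2 \<le> y\<^sup>2" using \<tau> h by (intro power_mono) (auto simp: y_def)
  have s: "C\<^sup>2 + D\<^sup>2 \<le> K * N"
  proof -
    have "0 \<le> (D + 2 * C * x)\<^sup>2" by simp
    then have "D\<^sup>2 \<le> 2 * (C * x + D)\<^sup>2 + 2 * (C\<^sup>2 * x\<^sup>2)" by (simp add: power2_eq_square algebra_simps)
    also have "C\<^sup>2 * x\<^sup>2 \<le> C\<^sup>2 * A\<^sup>2" using x2 by (intro mult_left_mono) auto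
    finally have "C\<^sup>2 + D\<^sup>2 \<le> 2 * (C * x + D)\<^sup>2 + (1 + 2 * A\<^sup>2) * C\<^sup>2" by (simp add: algebra_simps)
    also have "(1 + 2 * A\<^sup>2) * C\<^sup>2 = (1 + 2 * A\<^sup>2) / h\<^sup>2 * (C\<^sup>2 * h\<^sup>2)" using h by simp
    also have "\<dots> \<le> (1 + 2 * A\<^sup>2) / h\<^sup>2 * (C\<^sup>2 * y\<^sup>2)"
      using y2 by (intro mult_left_mono) auto
    also have "2 * (C * x + D)\<^sup>2 + (1 + 2 * A\<^sup>2) / h\<^sup>2 * (C\<^sup>2 * y\<^sup>2) \<le> K * N"
    proof -
      have "K * N = 2 * (C * x + D)\<^sup>2 + (1 + 2 * A\<^sup>2) / h\<^sup>2 * (C\<^sup>2 * y\<^sup>2)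
          + (1 + 2 * A\<^sup>2) / h\<^sup>2 * (C * x + D)\<^sup>2 + 2 * (C\<^sup>2 * y\<^sup>2)"
        by (simp add: K_def N_def algebra_simps)
      moreover have "0 \<le> (1 + 2 * A\<^sup>2) / h\<^sup>2 * (C * x + D)\<^sup>2" "0 \<le> 2 * (C\<^sup>2 * y\<^sup>2)" by simp_all
      ultimately show ?thesis by linarith
    qed
    finally show ?thesis by simp
  qed
  have "c\<^sup>2 + d\<^sup>2 \<noteq> 0" using cd by (auto simp: sum_power2_eq_zero_iff)
  then have "c\<^sup>2 + d\<^sup>2 \<ge> 1" by (smt (verit) zero_le_power2)
  then have "real_of_int (c\<^sup>2 + d\<^sup>2) \<ge> 1" by linarith
  then have s1: "C\<^sup>2 + D\<^sup>2 \<ge> 1" by (simp add: C_def D_def)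
  have Npos: "N > 0" using s s1 K by (smt (verit) mult_nonneg_nonpos)
  have p: "(1 + C\<^sup>2) * (1 + D\<^sup>2) \<le> 3 * (C\<^sup>2 + D\<^sup>2)\<^sup>2"
  proof -
    define s where "s = C\<^sup>2 + D\<^sup>2"
    have "s\<^sup>2 = C\<^sup>2 * D\<^sup>2 + ((C\<^sup>2)\<^sup>2 + C\<^sup>2 * D\<^sup>2 + (D\<^sup>2)\<^sup>2)" unfolding s_def by algebra
    moreover have "0 \<le> (C\<^sup>2)\<^sup>2 + C\<^sup>2 * D\<^sup>2 + (D\<^sup>2)\<^sup>2" by simp
    ultimately have "C\<^sup>2 * D\<^sup>2 \<le> s\<^sup>2" by linarith
    moreover have "s \<le> s\<^sup>2" "1 \<le> s\<^sup>2" using s1 by (simp_all add: s_def self_le_power)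
    moreover have "(1 + C\<^sup>2) * (1 + D\<^sup>2) = 1 + s + C\<^sup>2 * D\<^sup>2" by (simp add: s_def algebra_simps)
    ultimately show ?thesis unfolding s_def by linarith
  qed
  have "(C\<^sup>2 + D\<^sup>2)\<^sup>2 \<le> (C\<^sup>2 + D\<^sup>2) ^ m" using s1 k by (intro power_increasing) auto
  also have "\<dots> \<le> (K * N) ^ m" using s s1 by (intro power_mono) auto
  finally have "(1 + C\<^sup>2) * (1 + D\<^sup>2) \<le> 3 * K ^ m * N ^ m" using p by (simp add: power_mult_distrib)
  moreover have "(1 + C\<^sup>2) * (1 + D\<^sup>2) > 0" by (intro mult_pos_pos add_pos_nonneg) auto
  ultimately have "1 / N ^ m \<le> (3 * K ^ m) / ((1 + C\<^sup>2) * (1 + D\<^sup>2))"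
    using Npos by (simp add: field_simps)
  moreover have "norm (1 / (of_int c * \<tau> + of_int d) ^ k) = 1 / N ^ m"
    by (simp add: norm_divide norm_power k power_mult N)
  ultimately show "norm (1 / (of_int c * \<tau> + of_int d) ^ k)
      \<le> (3 * K ^ m) / ((1 + (of_int c)\<^sup>2) * (1 + (of_int d)\<^sup>2))"
    by (simp add: C_def D_def)
qed

text \<open>The parametrization \<open>g\<close> allows two uses: the identity on discs for
  holomorphy, and the logarithm near q = 0 for the limit at the cusp.\<close>

lemma eisenstein_uniform_limit:
  assumes "h > 0" "k = 2 * m" "m \<ge> 2"
    and Y: "\<And>y. y \<in> Y \<Longrightarrow> \<bar>Re (g y)\<bar> \<le> A \<and> Im (g y) \<ge> h"
  shows "uniform_limit Y (\<lambda>X y. \<Sum>(c, d)\<in>X. 1 / (of_int c * g y + of_int d) ^ k)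
    (\<lambda>y. 2 * eisenstein k (g y)) (finite_subsets_at_top coprime_pairs)"
proof -
  obtain M where M: "\<And>c d \<tau>. coprime (c::int) d \<Longrightarrow> \<bar>Re \<tau>\<bar> \<le> A \<Longrightarrow> Im \<tau> \<ge> h \<Longrightarrow>
    norm (1 / (of_int c * \<tau> + of_int d) ^ k) \<le> M / ((1 + (of_int c)\<^sup>2) * (1 + (of_int d)\<^sup>2))"
    using eisenstein_term_bound[OF assms(1-3)] by metis
  have "uniform_limit Y (\<lambda>X y. \<Sum>x\<in>X. (\<lambda>x y. case x of (c, d) \<Rightarrow> 1 / (of_int c * g y + of_int d) ^ k) x y)
    (\<lambda>y. \<Sum>\<^sub>\<infinity>x\<in>coprime_pairs. (\<lambda>x y. case x of (c, d) \<Rightarrow> 1 / (of_int c * g y + of_int d) ^ k) x y)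
    (finite_subsets_at_top coprime_pairs)"
    by (rule Weierstrass_m_test_general[OF _ eisenstein_majorant_summable[of M]]) (use M Y in auto)
  then show ?thesis by (simp add: eisenstein_def)
qed

lemma eisenstein_holomorphic:
  assumes "k = 2 * m" "m \<ge> 2"
  shows "eisenstein k holomorphic_on {\<tau>. Im \<tau> > 0}"
proof -
  have "\<exists>f'. (eisenstein k has_field_derivative f') (at \<tau>)" if \<tau>: "Im \<tau> > 0" for \<tau>
  proof -
    define r where "r = Im \<tau> / 2"
    have r: "r > 0" using \<tau> by (simp add: r_def)
    have Y: "\<bar>Re \<sigma>\<bar> \<le> \<bar>Re \<tau>\<bar> + r \<and> Im \<sigma> \<ge> r" if "\<sigma> \<in> cball \<tau> r" for \<sigma>
    proof -
      have "norm (\<sigma> - \<tau>) \<le> r" using that by (simp add: dist_norm norm_minus_commute)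
      then show ?thesis using abs_Re_le_cmod[of "\<sigma> - \<tau>"] abs_Im_le_cmod[of "\<sigma> - \<tau>"] by (auto simp: r_def)
    qed
    have nz: "of_int c * \<sigma> + of_int d \<noteq> 0" if "\<sigma> \<in> cball \<tau> r" "coprime c d" for c d \<sigma>
    proof
      assume *: "of_int c * \<sigma> + of_int d = 0"
      then have "Im (of_int c * \<sigma> + of_int d) = 0" by simp
      then have "c = 0" using Y[OF that(1)] r by simp
      with * that(2) show False by simp
    qed
    have ul: "uniform_limit (cball \<tau> r) (\<lambda>X y. \<Sum>(c, d)\<in>X. 1 / (of_int c * y + of_int d) ^ k)
       (\<lambda>y. 2 * eisenstein k y) (finite_subsets_at_top coprime_pairs)"
      by (rule eisenstein_uniform_limit[OF r assms, of _ _ "\<bar>Re \<tau>\<bar> + r"]) (use Y in auto)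
    have hol: "(\<lambda>y. \<Sum>(c, d)\<in>X. 1 / (of_int c * y + of_int d) ^ k) holomorphic_on cball \<tau> r"
      if "X \<subseteq> coprime_pairs" for X
      unfolding case_prod_unfold using nz that by (intro holomorphic_intros) fastforce
    have "(\<lambda>y. 2 * eisenstein k y) holomorphic_on ball \<tau> r"
    proof (rule holomorphic_uniform_limit[OF _ ul])
      have "\<forall>\<^sub>F X in finite_subsets_at_top coprime_pairs. finite X \<and> X \<subseteq> coprime_pairs"
        by (rule eventually_finite_subsets_at_top_weakI) auto
      then show "\<forall>\<^sub>F X in finite_subsets_at_top coprime_pairs.
        continuous_on (cball \<tau> r) (\<lambda>y. \<Sum>(c, d)\<in>X. 1 / (of_int c * y + of_int d) ^ k) \<and>
        (\<lambda>y. \<Sum>(c, d)\<in>X. 1 / (of_int c * y + of_int d) ^ k) holomorphic_on ball \<tau> r"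
        by eventually_elim (use hol in \<open>auto intro!: holomorphic_on_imp_continuous_on intro: holomorphic_on_subset[OF hol]\<close>)
    qed auto
    then have "(\<lambda>y. 2 * eisenstein k y / 2) holomorphic_on ball \<tau> r"
      by (rule holomorphic_on_divide[OF _ holomorphic_on_const]) simp
    moreover have "(\<lambda>y. 2 * eisenstein k y / 2) = eisenstein k" by (rule ext) simp
    ultimately have "eisenstein k holomorphic_on ball \<tau> r" by (simp only:)
    then show ?thesis using r by (auto simp: holomorphic_on_open)
  qed
  then show ?thesis by (auto simp: holomorphic_on_open open_halfspace_Im_gt)
qed

section \<open>Transformation laws and the value at the cusp\<close>

lemma eisenstein_T: "eisenstein k (\<tau> + 1) = eisenstein k \<tau>"
proof -
  have bij: "bij_betw (\<lambda>(c, d). (c, c + d)) coprime_pairs coprime_pairs"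
  proof (rule bij_betwI[where g = "\<lambda>(c, d). (c, d - c)"])
    have "coprime c (c + d) \<longleftrightarrow> coprime c d" for c d :: int
      using gcd_add1[of d c] by (simp only: coprime_iff_gcd_eq_1 gcd.commute[of c] add.commute[of c])
    moreover have "coprime c (d - c) \<longleftrightarrow> coprime c d" for c d :: int
      using gcd_diff1[of d c] by (simp only: coprime_iff_gcd_eq_1 gcd.commute[of c])
    ultimately show "(\<lambda>(c, d). (c, c + d)) \<in> coprime_pairs \<rightarrow> coprime_pairs"
      "(\<lambda>(c, d). (c, d - c)) \<in> coprime_pairs \<rightarrow> coprime_pairs" by auto
  qed auto
  show ?thesis
    using infsum_reindex_bij_betw[OF bij, of "\<lambda>(c, d). 1 / (of_int c * \<tau> + of_int d) ^ k"]
    unfolding eisenstein_def by (simp add: case_prod_unfold algebra_simps)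
qed

lemma eisenstein_S:
  assumes "\<tau> \<noteq> 0"
  shows "eisenstein k (-1 / \<tau>) = \<tau> ^ k * eisenstein k \<tau>"
proof -
  have bij: "bij_betw (\<lambda>(c, d). (d, - c)) coprime_pairs coprime_pairs"
    by (rule bij_betwI[where g = "\<lambda>(c, d). (- d, c)"]) (auto simp: coprime_commute)
  have "(\<Sum>\<^sub>\<infinity>(c, d)\<in>coprime_pairs. 1 / (of_int c * (-1 / \<tau>) + of_int d) ^ k) =
      (\<Sum>\<^sub>\<infinity>x\<in>coprime_pairs. \<tau> ^ k * (case x of (c, d) \<Rightarrow> 1 / (of_int d * \<tau> + of_int (- c)) ^ k))"
  proof (rule infsum_cong)
    fix x :: "int \<times> int"
    obtain c d where x: "x = (c, d)" by force
    have "of_int c * (-1 / \<tau>) + of_int d = (of_int d * \<tau> + of_int (- c)) / \<tau>"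
      using assms by (simp add: field_simps)
    then show "(case x of (c, d) \<Rightarrow> 1 / (of_int c * (-1 / \<tau>) + of_int d) ^ k) =
         \<tau> ^ k * (case x of (c, d) \<Rightarrow> 1 / (of_int d * \<tau> + of_int (- c)) ^ k)"
      by (simp only: x prod.case) (simp add: power_divide)
  qed
  also have "\<dots> = \<tau> ^ k * (\<Sum>\<^sub>\<infinity>(c, d)\<in>coprime_pairs. 1 / (of_int d * \<tau> + of_int (- c)) ^ k)"
    by (rule infsum_cmult_right')
  also have "(\<Sum>\<^sub>\<infinity>(c, d)\<in>coprime_pairs. 1 / (of_int d * \<tau> + of_int (- c)) ^ k) =
      (\<Sum>\<^sub>\<infinity>(c, d)\<in>coprime_pairs. 1 / (of_int c * \<tau> + of_int d) ^ k)"
    using infsum_reindex_bij_betw[OF bij, of "\<lambda>(c, d). 1 / (of_int c * \<tau> + of_int d) ^ k"]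
    by (simp add: case_prod_unfold)
  finally show ?thesis unfolding eisenstein_def by simp
qed

definition eisenstein_q :: "nat \<Rightarrow> complex \<Rightarrow> complex" where
  "eisenstein_q k q = (if q = 0 then 1 else eisenstein k (Ln q / (2 * of_real pi * \<i>)))"

lemma eisenstein_q_0 [simp]: "eisenstein_q k 0 = 1"
  by (simp add: eisenstein_q_def)

lemma eisenstein_q_nome: "Im \<tau> > 0 \<Longrightarrow> eisenstein_q k (nome \<tau>) = eisenstein k \<tau>"
  using periodic_Ln_nome[of "eisenstein k", OF eisenstein_T] by (simp add: eisenstein_q_def)

lemma Ln_over_2pi_i:
  assumes "q \<noteq> 0"
  shows "\<bar>Re (Ln q / (2 * of_real pi * \<i>))\<bar> \<le> 1/2" "Im (Ln q / (2 * of_real pi * \<i>)) = - ln (norm q) / (2 * pi)"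
proof -
  have e: "Ln q / (2 * of_real pi * \<i>) = Complex (Im (Ln q) / (2 * pi)) (- Re (Ln q) / (2 * pi))"
    by (simp add: complex_eq_iff Re_divide Im_divide power2_eq_square)
  show "Im (Ln q / (2 * of_real pi * \<i>)) = - ln (norm q) / (2 * pi)" unfolding e using assms by simp
  show "\<bar>Re (Ln q / (2 * of_real pi * \<i>))\<bar> \<le> 1/2"
    using mpi_less_Im_Ln[OF assms] Im_Ln_le_pi[OF assms] unfolding e by (simp add: abs_le_iff field_simps)
qed

text \<open>As q tends to 0 the height tends to infinity and every term with c nonzero disappears.
  Uniform convergence permits the termwise limit; what remains are the two terms with c = 0 and d =
  1 or -1, both equal to 1 as k is even.\<close>

lemma eisenstein_q_tendsto:
  assumes "k = 2 * m" "m \<ge> 2"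
  shows "(eisenstein_q k \<longlongrightarrow> 1) (at 0)"
proof -
  define g where "g q = Ln q / (2 * of_real pi * \<i>)" for q
  define l :: "int \<times> int \<Rightarrow> complex" where "l = (\<lambda>(c, d). if c = 0 then 1 else 0)"
  define Y where "Y = ball 0 (exp (- 2 * pi)) - {0 :: complex}"
  have gY: "\<bar>Re (g q)\<bar> \<le> 1/2 \<and> Im (g q) \<ge> 1" if "q \<in> Y" for q
  proof -
    have q: "q \<noteq> 0" "norm q < exp (- 2 * pi)" using that by (auto simp: Y_def)
    then have "ln (norm q) < - 2 * pi" by (metis exp_less_cancel_iff exp_ln zero_less_norm_iff)
    then have "Im (g q) \<ge> 1" unfolding g_def Ln_over_2pi_i(2)[OF q(1)] by (simp add: field_simps)
    with Ln_over_2pi_i(1)[OF q(1)] show ?thesis by (simp add: g_def)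
  qed
  have evY: "eventually (\<lambda>q. q \<in> Y) (at 0)"
    unfolding Y_def by (rule eventually_at_in_open) auto
  have Im_g: "((\<lambda>q. 1 / Im (g q)) \<longlongrightarrow> 0) (at 0)"
  proof -
    have "filterlim (\<lambda>q::complex. norm q) (at_right 0) (at 0)"
      by (auto simp: filterlim_at eventually_at_filter intro!: tendsto_norm_zero)
    moreover have "((\<lambda>x. 1 / (- ln x / (2 * pi))) \<longlongrightarrow> 0) (at_right 0)" by real_asymp
    ultimately have "((\<lambda>q::complex. 1 / (- ln (norm q) / (2 * pi))) \<longlongrightarrow> 0) (at 0)"
      by (rule filterlim_compose[rotated])
    then show ?thesis
      by (rule Lim_transform_eventually)
         (use evY in \<open>eventually_elim, auto simp: Y_def g_def Ln_over_2pi_i\<close>)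
  qed
  have lim1: "((\<lambda>q. 1 / (of_int c * g q + of_int d) ^ k) \<longlongrightarrow> l (c, d)) (at 0)"
    if "coprime c d" for c d
  proof (cases "c = 0")
    case True
    then have "d = 1 \<or> d = -1" using that by auto
    then show ?thesis using True assms by (auto simp: l_def)
  next
    case False
    have "eventually (\<lambda>q. norm (1 / (of_int c * g q + of_int d) ^ k) \<le> 1 / Im (g q)) (at 0)"
      using evY
    proof eventually_elim
      case (elim q)
      then have y: "Im (g q) \<ge> 1" using gY by blast
      have c: "1 \<le> \<bar>real_of_int c\<bar>" using False by linarith
      have "1 * Im (g q) \<le> \<bar>real_of_int c\<bar> * Im (g q)"
        using y c by (intro mult_right_mono) auto
      also have "\<dots> = \<bar>Im (of_int c * g q + of_int d)\<bar>" using y by (simp add: abs_mult)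
      also have "\<dots> \<le> norm (of_int c * g q + of_int d)" by (rule abs_Im_le_cmod)
      finally have n: "Im (g q) \<le> norm (of_int c * g q + of_int d)" by simp
      also have "\<dots> \<le> norm (of_int c * g q + of_int d) ^ k"
        using n y assms by (intro self_le_power) auto
      finally show ?case using y by (simp add: norm_divide norm_power field_simps)
    qed
    then show ?thesis using False Im_g by (auto simp: l_def intro: Lim_null_comparison)
  qed
  have ul: "uniform_limit Y (\<lambda>X y. \<Sum>(c, d)\<in>X. 1 / (of_int c * g y + of_int d) ^ k)
    (\<lambda>y. 2 * eisenstein k (g y)) (finite_subsets_at_top coprime_pairs)"
    by (rule eisenstein_uniform_limit[OF _ assms, of 1 _ _ "1/2"]) (use gY in auto)
  have lsum: "(l has_sum 2) coprime_pairs"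
  proof -
    have "(l has_sum (\<Sum>x\<in>{(0, 1), (0, -1)}. l x)) {(0, 1), (0, -1)}"
      by (rule has_sum_finite) auto
    moreover have "(\<Sum>x\<in>{(0, 1), (0, -1)}. l x) = 2" by (simp add: l_def)
    ultimately have "(l has_sum 2) {(0, 1), (0, -1)}" by simp
    then show ?thesis
      by (rule has_sum_cong_neutral[THEN iffD1, rotated -1]) (auto simp: l_def split: if_splits)
  qed
  have "((\<lambda>q. 2 * eisenstein k (g q)) \<longlongrightarrow> 2) (at 0)"
  proof (rule swap_uniform_limit'[OF _ _ ul evY])
    have "\<forall>\<^sub>F X in finite_subsets_at_top coprime_pairs. finite X \<and> X \<subseteq> coprime_pairs"
      by (rule eventually_finite_subsets_at_top_weakI) auto
    then show "\<forall>\<^sub>F X in finite_subsets_at_top coprime_pairs.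
        ((\<lambda>y. \<Sum>(c, d)\<in>X. 1 / (of_int c * g y + of_int d) ^ k) \<longlongrightarrow> (\<Sum>x\<in>X. l x)) (at 0)"
    proof eventually_elim
      case (elim X)
      show ?case by (rule tendsto_sum) (use elim lim1 in auto)
    qed
    show "(sum l \<longlongrightarrow> 2) (finite_subsets_at_top coprime_pairs)"
      using lsum by (simp add: has_sum_def)
  qed auto
  from tendsto_mult[OF tendsto_const[of "1/2"] this]
  have "((\<lambda>q. eisenstein k (g q)) \<longlongrightarrow> 1) (at 0)" by simp
  then show ?thesis
    by (rule Lim_transform_eventually)
       (use evY in \<open>eventually_elim, auto simp: Y_def g_def eisenstein_q_def\<close>)
qed

lemma modular_q_eisenstein:
  assumes "k = 2 * m" "m \<ge> 2"
  shows "modular_q (int k) (eisenstein_q k)"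
  unfolding modular_q_def
proof (intro conjI allI impI)
  have hol: "eisenstein_q k holomorphic_on ball 0 1 - {0}"
    by (rule holomorphic_transform[OF periodic_holomorphic[OF eisenstein_holomorphic[OF assms] eisenstein_T]])
       (auto simp: eisenstein_q_def)
  have "isCont (eisenstein_q k) q" if "q \<in> ball 0 1" for q
  proof (cases "q = 0")
    case True
    then show ?thesis using eisenstein_q_tendsto[OF assms] by (simp add: isCont_def)
  next
    case False
    then have "q \<in> ball 0 1 - {0}" using that by blast
    moreover have "open (ball 0 1 - {0 :: complex})" by (intro open_delete open_ball)
    ultimately show ?thesis
      using holomorphic_on_imp_continuous_on[OF hol] by (simp only: continuous_on_eq_continuous_at)
  qed
  then have "continuous_on (ball 0 1) (eisenstein_q k)"
    by (intro continuous_at_imp_continuous_on) blast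
  then show "eisenstein_q k holomorphic_on ball 0 1"
    by (rule no_isolated_singularity[OF _ hol]) auto
  fix \<tau> :: complex assume \<tau>: "Im \<tau> > 0"
  then have "\<tau> \<noteq> 0" by auto
  show "eisenstein_q k (nome (-1 / \<tau>)) = \<tau> powi int k * eisenstein_q k (nome \<tau>)"
    unfolding eisenstein_q_nome[OF \<tau>] eisenstein_q_nome[OF minus_inverse_upper_half_plane[OF \<tau>]]
      eisenstein_S[OF \<open>\<tau> \<noteq> 0\<close>] by simp
qed

section \<open>The discriminant and the ring of modular forms\<close>

abbreviation E4 :: "complex \<Rightarrow> complex" where "E4 \<equiv> eisenstein_q 4"
abbreviation E6 :: "complex \<Rightarrow> complex" where "E6 \<equiv> eisenstein_q 6"

lemma modular_q_E4: "modular_q 4 E4"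
  using modular_q_eisenstein[of 4 2] by simp

lemma modular_q_E6: "modular_q 6 E6"
  using modular_q_eisenstein[of 6 3] by simp

lemmas holomorphic_E4 [holomorphic_intros] = modular_q_holomorphic[OF modular_q_E4]
lemmas holomorphic_E6 [holomorphic_intros] = modular_q_holomorphic[OF modular_q_E6]

text \<open>With the leading coefficient of its q-expansion divided out this is the usual
  discriminant; the classical factor is 1728.\<close>

definition delta_q :: "complex \<Rightarrow> complex" where
  "delta_q q = E4 q ^ 3 - E6 q ^ 2"

lemma delta_q_0 [simp]: "delta_q 0 = 0"
  by (simp add: delta_q_def)

lemma modular_q_delta: "modular_q 12 delta_q"
  unfolding delta_q_def[abs_def]
  by (intro modular_q_diff modular_q_power[OF modular_q_E4] modular_q_power[OF modular_q_E6]) auto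

lemmas holomorphic_delta [holomorphic_intros] = modular_q_holomorphic[OF modular_q_delta]

section \<open>Zeros of the discriminant\<close>

lemma zero_factorization:
  assumes hol: "f holomorphic_on ball 0 1" and q0: "q0 \<in> ball 0 1" "f q0 = 0"
    and nz: "q1 \<in> ball 0 1" "f q1 \<noteq> 0"
  obtains r p A where "r > 0" "ball q0 r \<subseteq> ball 0 1" "A holomorphic_on ball q0 r"
    "\<And>z. z \<in> ball q0 r \<Longrightarrow> f z = (z - q0) ^ Suc p * A z" "\<And>z. z \<in> ball q0 r \<Longrightarrow> A z \<noteq> 0"
proof -
  have "\<not> f constant_on ball 0 1"
    using q0 nz unfolding constant_on_def by metis
  from holomorphic_factor_zero_nonconstant[OF hol open_ball connected_ball q0(1) q0(2) this]
  obtain A r n where *: "0 < n" "0 < r" "ball q0 r \<subseteq> ball 0 1" "A holomorphic_on ball q0 r"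
      "\<And>w. w \<in> ball q0 r \<Longrightarrow> f w = (w - q0) ^ n * A w" "\<And>w. w \<in> ball q0 r \<Longrightarrow> A w \<noteq> 0"
    by metis
  from \<open>0 < n\<close> obtain p where "n = Suc p" by (cases n) auto
  with * show ?thesis using that by blast
qed

text \<open>At a zero of order p + 1 of f away from the cusp, the left-hand side of the equation has
  order exactly p and the right-hand side order at least p + 1.\<close>

lemma theta_eq_0_ode:
  assumes f: "f holomorphic_on ball 0 1" and u: "u holomorphic_on ball 0 1" and v: "v holomorphic_on ball 0 1"
    and ode: "\<And>q. q \<in> ball 0 1 \<Longrightarrow> u q * theta f q = v q * f q"
    and q0: "q0 \<in> ball 0 1" "q0 \<noteq> 0" "u q0 \<noteq> 0" "f q0 = 0" and q1: "q1 \<in> ball 0 1"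
  shows "f q1 = 0"
proof (rule ccontr)
  assume nz: "f q1 \<noteq> 0"
  obtain r p A where r: "r > 0" "ball q0 r \<subseteq> ball 0 1" and A: "A holomorphic_on ball q0 r"
    "\<And>z. z \<in> ball q0 r \<Longrightarrow> f z = (z - q0) ^ Suc p * A z" "\<And>z. z \<in> ball q0 r \<Longrightarrow> A z \<noteq> 0"
    using zero_factorization[OF f q0(1) q0(4) q1 nz] by metis
  define B where "B z = of_nat (Suc p) * A z + (z - q0) * deriv A z" for z
  define E where "E z = u z * z * B z - v z * (z - q0) * A z" for z
  have "E q0 = 0"
  proof (rule holomorphic_eq_0_at[where f = E and a = q0 and S = "ball q0 r"])
    show "E holomorphic_on ball q0 r" unfolding E_def B_def
      by (intro holomorphic_intros A open_ball holomorphic_on_subset[OF u r(2)] holomorphic_on_subset[OF v r(2)])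
    show "E z = 0" if z: "z \<in> ball q0 r - {q0}" for z
    proof -
      have zb: "z \<in> ball q0 r" using z by blast
      have "((\<lambda>z. (z - q0) ^ Suc p * A z) has_field_derivative (z - q0) ^ p * B z) (at z)"
        unfolding B_def
        by (rule derivative_eq_intros refl holomorphic_derivI[OF A(1) open_ball zb])+ (simp add: algebra_simps)
      then have "(f has_field_derivative (z - q0) ^ p * B z) (at z)"
        by (rule has_field_derivative_transform_within_open[OF _ open_ball zb]) (use A(2) in auto)
      then have th: "theta f z = z * ((z - q0) ^ p * B z)" by (simp add: theta_def DERIV_imp_deriv)
      have "u z * theta f z = v z * f z" using ode zb r(2) by blast
      then have "(z - q0) ^ p * E z = 0"
        unfolding th A(2)[OF zb] E_def by (simp add: algebra_simps)
      then show ?thesis using z by simp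
    qed
  qed (use r in simp_all)
  then have "u q0 * q0 * (of_nat (Suc p) * A q0) = 0" by (simp add: E_def B_def)
  then show False using q0 A(3)[of q0] r(1) of_nat_neq_0[of p] by (simp del: of_nat_Suc)
qed

text \<open>The point \<i> is fixed by the inversion, so the law reads \<phi> = -\<phi>
  there.\<close>

lemma modular_q_at_i:
  assumes "modular_q k \<phi>" "\<i> powi k = -1"
  shows "\<phi> (nome \<i>) = 0"
  using modular_q_S[OF assms(1), of \<i>] assms(2) by simp

text \<open>If \<open>E\<^sub>4\<^sup>3 = E\<^sub>6\<^sup>2\<close>, then \<open>E\<^sub>6 / E\<^sub>4\<close> would be a square root of \<open>E\<^sub>4\<close> and a modular form of weight 2.
  Its second Rankin--Cohen bracket is a cusp form of weight 8, hence 0, which contradicts the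
  vanishing of the form at \<open>\<i>\<close>.\<close>

lemma delta_q_not_identically_0: "\<exists>q\<in>ball 0 1. delta_q q \<noteq> 0"
proof (rule ccontr)
  assume "\<not> ?thesis"
  then have D: "E4 q ^ 3 = E6 q ^ 2" if "q \<in> ball 0 1" for q using that by (auto simp: delta_q_def)
  \<comment> \<open>At zeros of \<open>E4\<close> division by zero returns 0, which is the right
    value: the square of \<open>f\<close> is \<open>E4\<close> everywhere, hence \<open>f\<close> is
    continuous there and the singularity is removable.\<close>
  define f where "f q = E6 q / E4 q" for q
  have f2: "f q ^ 2 = E4 q" if "q \<in> ball 0 1" for q
  proof (cases "E4 q = 0")
    case False
    have "f q ^ 2 = (E4 q * E4 q ^ 2) / E4 q ^ 2"
      unfolding f_def power_divide D[OF that, symmetric] by (simp add: power3_eq_cube power2_eq_square)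
    then show ?thesis using False by simp
  qed (simp add: f_def)
  have f0: "f 0 = 1" by (simp add: f_def)
  have "\<exists>f'. (f has_field_derivative f') (at q0)" if q0: "q0 \<in> ball 0 1" for q0
  proof (cases "E4 q0 = 0")
    case False
    have "(E4 has_field_derivative deriv E4 q0) (at q0)" "(E6 has_field_derivative deriv E6 q0) (at q0)"
      by (rule holomorphic_derivI[OF holomorphic_E4 open_ball q0] holomorphic_derivI[OF holomorphic_E6 open_ball q0])+
    from DERIV_divide[OF this(2,1) False] show ?thesis unfolding f_def by blast
  next
    case True
    have *: "0 \<in> ball 0 (1::real)" "E4 0 \<noteq> 0" by simp_all
    obtain r p A where r: "r > 0" "ball q0 r \<subseteq> ball 0 1"
      "\<And>z. z \<in> ball q0 r \<Longrightarrow> E4 z = (z - q0) ^ Suc p * A z" "\<And>z. z \<in> ball q0 r \<Longrightarrow> A z \<noteq> 0"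
      using zero_factorization[OF holomorphic_E4 q0 True _ *(2)] by (metis centre_in_ball zero_less_one)
    have hol: "f holomorphic_on ball q0 r - {q0}" unfolding f_def
      by (intro holomorphic_intros holomorphic_on_subset[OF holomorphic_E4] holomorphic_on_subset[OF holomorphic_E6])
         (use r in auto)
    have "isCont f q" if q: "q \<in> ball q0 r" for q
    proof (cases "q = q0")
      case False
      then have "q \<in> ball q0 r - {q0}" using q by blast
      moreover have "open (ball q0 r - {q0})" by (intro open_delete open_ball)
      ultimately show ?thesis
        using holomorphic_on_imp_continuous_on[OF hol] by (simp only: continuous_on_eq_continuous_at)
    next
      case True': True
      have "isCont E4 q0"
        using holomorphic_on_imp_continuous_on[OF holomorphic_E4] q0 by (simp add: continuous_on_eq_continuous_at)
      then have "(E4 \<longlongrightarrow> 0) (at q0)" using True by (simp add: isCont_def)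
      then have "((\<lambda>z. sqrt (norm (E4 z))) \<longlongrightarrow> sqrt (norm (0::complex))) (at q0)"
        by (intro tendsto_intros)
      moreover have "eventually (\<lambda>z. sqrt (norm (E4 z)) = norm (f z)) (at q0)"
        using eventually_at_in_open[OF open_ball q0]
      proof eventually_elim
        case (elim z)
        then have "norm (E4 z) = (norm (f z))\<^sup>2" using f2[of z] by (metis DiffD1 norm_power)
        then show ?case by simp
      qed
      ultimately have "((\<lambda>z. norm (f z)) \<longlongrightarrow> 0) (at q0)"
        by (auto intro: Lim_transform_eventually)
      moreover have "f q0 = 0" using True by (simp add: f_def)
      ultimately show ?thesis unfolding True' isCont_def by (simp only: tendsto_norm_zero_iff)
    qed
    then have "continuous_on (ball q0 r) f" by (intro continuous_at_imp_continuous_on) blast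
    then have "f holomorphic_on ball q0 r" by (rule no_isolated_singularity[OF _ hol]) auto
    then show ?thesis using r(1) by (auto simp: holomorphic_on_open)
  qed
  then have holf: "f holomorphic_on ball 0 1" by (simp add: holomorphic_on_open)
  have f: "modular_q 2 f"
    unfolding modular_q_def
  proof (intro conjI holf allI impI)
    fix \<tau> :: complex assume \<tau>: "Im \<tau> > 0"
    then have "\<tau> \<noteq> 0" by auto
    then have "\<tau> ^ 6 / \<tau> ^ 4 = \<tau> ^ 2" by (simp add: eval_nat_numeral)
    then show "f (nome (-1 / \<tau>)) = \<tau> powi 2 * f (nome \<tau>)"
      unfolding f_def modular_q_S[OF modular_q_E4 \<tau>] modular_q_S[OF modular_q_E6 \<tau>]
      by (simp flip: times_divide_times_eq)
  qed
  have b: "rc_bracket2 2 f q = 0" if "q \<in> ball 0 1" for q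
    by (rule modular_q_cusp_form[OF modular_q_rc_bracket2[OF f refl] _ _ that]) auto
  have fi: "f (nome \<i>) = 0" by (rule modular_q_at_i[OF f]) simp
  have *: "nome \<i> \<in> ball 0 1" by simp
  obtain r p A where r: "r > 0" "ball (nome \<i>) r \<subseteq> ball 0 1" "A holomorphic_on ball (nome \<i>) r"
      "\<And>z. z \<in> ball (nome \<i>) r \<Longrightarrow> f z = (z - nome \<i>) ^ Suc p * A z" "\<And>z. z \<in> ball (nome \<i>) r \<Longrightarrow> A z \<noteq> 0"
    using zero_factorization[OF holf * fi, of 0] f0 by (metis centre_in_ball zero_less_one zero_neq_one)
  have "A (nome \<i>) = 0"
    by (rule rc_bracket2_order[OF open_ball _ r(3) holomorphic_on_const[of 0] r(4), where k = 2])
       (use r b in auto)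
  then show False using r by simp
qed

text \<open>The weight 12 is at most 20, so a double zero at the cusp would force the discriminant
  to vanish identically.\<close>

lemma deriv_delta_q_0: "deriv delta_q 0 \<noteq> 0"
  using modular_q_double_cusp_form[OF modular_q_delta delta_q_0] delta_q_not_identically_0 by force

text \<open>The difference of the two sides has a double zero at the cusp. This identifies brackets
  as multiples of the discriminant, or of its product with \<open>E4\<close>.\<close>

lemma cusp_form_proportional:
  assumes f: "modular_q k f" "f 0 = 0" and g: "modular_q k g" "g 0 = 0" "deriv g 0 \<noteq> 0"
    and k: "k \<le> 20" and q: "q \<in> ball 0 1"
  shows "f q = deriv f 0 / deriv g 0 * g q"
proof -
  let ?h = "\<lambda>q. f q - deriv f 0 / deriv g 0 * g q"
  have df: "(f has_field_derivative deriv f 0) (at 0)"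
    and dg: "(g has_field_derivative deriv g 0) (at 0)"
    using f g by (auto intro!: holomorphic_derivI[OF modular_q_holomorphic open_ball])
  have "?h q = 0"
  proof (rule modular_q_double_cusp_form[OF modular_q_diff[OF f(1) modular_q_cmult[OF g(1)]] _ _ k q])
    show "deriv ?h 0 = 0"
      by (rule DERIV_imp_deriv) (rule derivative_eq_intros df dg refl | use g in simp)+
  qed (use f g in simp)
  then show ?thesis by simp
qed

text \<open>Away from common zeros of \<open>E\<^sub>4\<close> and \<open>E\<^sub>6\<close>, the first bracket \<open>[E\<^sub>4, E\<^sub>6] = c \<Delta>\<close> turns the equation
  \<open>\<Delta> = E\<^sub>4\<^sup>3 - E\<^sub>6\<^sup>2\<close> into a linear differential equation for \<open>\<Delta>\<close>, whose nonzero solutions have no zeros.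
  Common zeros are excluded by comparing vanishing orders in \<open>[E\<^sub>4, E\<^sub>4]\<^sub>2 = c\<^sub>1 \<Delta>\<close> and
  \<open>[E\<^sub>6, E\<^sub>6]\<^sub>2 = c\<^sub>2 \<Delta> E\<^sub>4\<close>.\<close>

lemma delta_q_nonzero:
  assumes q0: "q0 \<in> ball 0 1" "q0 \<noteq> 0"
  shows "delta_q q0 \<noteq> 0"
proof
  assume D0: "delta_q q0 = 0"
  obtain q1 where q1: "q1 \<in> ball 0 1" "delta_q q1 \<noteq> 0" using delta_q_not_identically_0 by blast
  define W where "W = rc_bracket1 4 E4 6 E6"
  define c where "c = deriv W 0 / deriv delta_q 0"
  have W: "4 * E4 q * theta E6 q - 6 * E6 q * theta E4 q = c * delta_q q" if "q \<in> ball 0 1" for q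
  proof -
    have "modular_q 12 W" unfolding W_def
      by (rule modular_q_rc_bracket1[OF modular_q_E4 modular_q_E6]) simp
    from cusp_form_proportional[OF this _ modular_q_delta delta_q_0 deriv_delta_q_0 _ that]
    show ?thesis by (simp add: W_def c_def rc_bracket1_def)
  qed
  have thD: "theta delta_q q = 3 * (E4 q)\<^sup>2 * theta E4 q - 2 * E6 q * theta E6 q" if "q \<in> ball 0 1" for q
  proof -
    have "(delta_q has_field_derivative 3 * (E4 q)\<^sup>2 * deriv E4 q - 2 * E6 q * deriv E6 q) (at q)"
      unfolding delta_q_def[abs_def]
      by (rule derivative_eq_intros refl holomorphic_derivI[OF holomorphic_E4 open_ball that]
          holomorphic_derivI[OF holomorphic_E6 open_ball that])+ simp
    then show ?thesis by (simp add: theta_def DERIV_imp_deriv algebra_simps)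
  qed
  have E4: "E4 q0 = 0"
  proof (rule ccontr)
    assume "E4 q0 \<noteq> 0"
    have "delta_q q1 = 0"
    proof (rule theta_eq_0_ode[OF holomorphic_delta _ _ _ q0 _ D0 q1(1)])
      \<comment> \<open>In 2 \<open>E4\<close> times the derivative of the discriminant, the bracket
        identity replaces 4 \<open>E4\<close> \<open>theta E6\<close> by 6 \<open>E6\<close>
        \<open>theta E4\<close> plus c times the discriminant; the remaining terms combine to 6
        \<open>theta E4\<close> times the discriminant.\<close>
      show "(2 * E4 q) * theta delta_q q = (6 * theta E4 q - c * E6 q) * delta_q q" if q: "q \<in> ball 0 1" for q
        using thD[OF q] W[OF q] delta_q_def[of q] by algebra
    qed (use \<open>E4 q0 \<noteq> 0\<close> in \<open>auto intro!: holomorphic_intros\<close>)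
    with q1 show False by simp
  qed
  then have E6: "E6 q0 = 0" using D0 by (simp add: delta_q_def)
  define V where "V = rc_bracket2 4 E4"
  define U where "U = rc_bracket2 6 E6"
  define c1 where "c1 = deriv V 0 / deriv delta_q 0"
  define c2 where "c2 = deriv U 0 / deriv (\<lambda>q. delta_q q * E4 q) 0"
  have V: "V q = c1 * delta_q q" if "q \<in> ball 0 1" for q
  proof -
    have "modular_q 12 V" unfolding V_def
      by (rule modular_q_rc_bracket2[OF modular_q_E4]) simp
    from cusp_form_proportional[OF this _ modular_q_delta delta_q_0 deriv_delta_q_0 _ that]
    show ?thesis by (simp add: V_def c1_def)
  qed
  have U: "U q = c2 * (delta_q q * E4 q)" if "q \<in> ball 0 1" for q
  proof -
    have U: "modular_q 16 U" unfolding U_def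
      by (rule modular_q_rc_bracket2[OF modular_q_E6]) simp
    have DE: "modular_q 16 (\<lambda>q. delta_q q * E4 q)"
      by (rule modular_q_mult[OF modular_q_delta modular_q_E4]) simp
    have z: "(0::complex) \<in> ball 0 1" by simp
    have "((\<lambda>q. delta_q q * E4 q) has_field_derivative deriv delta_q 0 * E4 0 + deriv E4 0 * delta_q 0) (at 0)"
      by (rule DERIV_mult holomorphic_derivI[OF holomorphic_E4 open_ball z]
            holomorphic_derivI[OF holomorphic_delta open_ball z])+
    then have "deriv (\<lambda>q. delta_q q * E4 q) 0 = deriv delta_q 0"
      by (simp add: DERIV_imp_deriv)
    then have "deriv (\<lambda>q. delta_q q * E4 q) 0 \<noteq> 0" using deriv_delta_q_0 by simp
    from cusp_form_proportional[OF U _ DE _ this _ that]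
    show ?thesis by (simp add: U_def c2_def)
  qed
  have z: "(0::complex) \<in> ball 0 1" "E4 0 \<noteq> 0" "E6 0 \<noteq> 0" by simp_all
  obtain r1 p A where A: "r1 > 0" "ball q0 r1 \<subseteq> ball 0 1" "A holomorphic_on ball q0 r1"
      "\<And>z. z \<in> ball q0 r1 \<Longrightarrow> E4 z = (z - q0) ^ Suc p * A z" "\<And>z. z \<in> ball q0 r1 \<Longrightarrow> A z \<noteq> 0"
    using zero_factorization[OF holomorphic_E4 q0(1) E4 z(1,2)] by metis
  obtain r2 r B where B: "r2 > 0" "ball q0 r2 \<subseteq> ball 0 1" "B holomorphic_on ball q0 r2"
      "\<And>z. z \<in> ball q0 r2 \<Longrightarrow> E6 z = (z - q0) ^ Suc r * B z" "\<And>z. z \<in> ball q0 r2 \<Longrightarrow> B z \<noteq> 0"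
    using zero_factorization[OF holomorphic_E6 q0(1) E6 z(1,3)] by metis
  define S where "S = ball q0 r1 \<inter> ball q0 r2"
  have S: "open S" "q0 \<in> S" using A(1) B(1) by (auto simp: S_def)
  have AS: "A holomorphic_on S" "\<And>z. z \<in> S \<Longrightarrow> E4 z = (z - q0) ^ Suc p * A z"
    and BS: "B holomorphic_on S" "\<And>z. z \<in> S \<Longrightarrow> E6 z = (z - q0) ^ Suc r * B z"
    using A B by (auto simp: S_def intro: holomorphic_on_subset)
  have Sb: "z \<in> ball 0 1" if "z \<in> S" for z using that A(2) by (auto simp: S_def)
  show False
  \<comment> \<open>The discriminant vanishes at least to the smaller of the orders 3 (p + 1) and 2
    (r + 1) of its two terms. If this is 2 (r + 1), then \<open>U\<close> has order at least 2 (r +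
    1) + (p + 1) = (2 r + 1) + (p + 2); otherwise \<open>V\<close> has order at least 3 (p + 1) = (2
    p + 1) + (p + 2). Either exceeds what \<open>rc_bracket2_order\<close> allows, and
    \<open>?h\<close> collects the surplus.\<close>
  proof (cases "2 * Suc r \<le> 3 * Suc p")
    case True
    then obtain n where n: "3 * Suc p = 2 * Suc r + n" by (metis le_Suc_ex)
    have "B q0 = 0"
    proof (rule rc_bracket2_order[OF S BS(1) _ BS(2), where k = 6])
      let ?h = "\<lambda>z. c2 * (z - q0) ^ (p + 2) * ((A z) ^ 3 * (z - q0) ^ n - (B z)\<^sup>2) * A z"
      show "?h holomorphic_on S" by (intro holomorphic_intros AS BS)
      show "rc_bracket2 6 E6 z = (z - q0) ^ (2 * r + 1) * ?h z" if z: "z \<in> S" for z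
      proof -
        define w where "w = z - q0"
        have "(w ^ Suc p) ^ 3 = (w ^ Suc r)\<^sup>2 * w ^ n"
          by (simp only: n flip: power_mult power_add) (simp only: mult.commute[of _ 3] mult.commute[of _ 2] n)
        then have "delta_q z = (w ^ Suc r)\<^sup>2 * ((A z) ^ 3 * w ^ n - (B z)\<^sup>2)"
          unfolding delta_q_def AS(2)[OF z] BS(2)[OF z] w_def[symmetric]
          by (simp add: power_mult_distrib algebra_simps)
        then have "U z = c2 * (((w ^ Suc r)\<^sup>2 * w ^ Suc p) * ((A z) ^ 3 * w ^ n - (B z)\<^sup>2) * A z)"
          unfolding U[OF Sb[OF z]] AS(2)[OF z] w_def[symmetric] by (simp add: mult_ac)
        also have "(w ^ Suc r)\<^sup>2 * w ^ Suc p = w ^ (2 * r + 1) * w ^ (p + 2)"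
          by (simp only: flip: power_mult power_add) (rule arg_cong[where f = "\<lambda>n. w ^ n"], simp)
        finally show ?thesis by (simp add: U_def w_def mult_ac)
      qed
    qed (use q0 in auto)
    then show False using B by simp
  next
    case False
    then obtain n where n: "2 * Suc r = 3 * Suc p + n" by (metis le_Suc_ex nat_le_linear)
    have "A q0 = 0"
    proof (rule rc_bracket2_order[OF S AS(1) _ AS(2), where k = 4])
      let ?h = "\<lambda>z. c1 * (z - q0) ^ (p + 2) * ((A z) ^ 3 - (z - q0) ^ n * (B z)\<^sup>2)"
      show "?h holomorphic_on S" by (intro holomorphic_intros AS BS)
      show "rc_bracket2 4 E4 z = (z - q0) ^ (2 * p + 1) * ?h z" if z: "z \<in> S" for z
      proof -
        define w where "w = z - q0"
        have "(w ^ Suc r) ^ 2 = (w ^ Suc p)^3 * w ^ n"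
          by (simp only: n flip: power_mult power_add) (simp only: mult.commute[of _ 3] mult.commute[of _ 2] n)
        then have "delta_q z = (w ^ Suc p)^3 * ((A z) ^ 3 - w ^ n * (B z)\<^sup>2)"
          unfolding delta_q_def AS(2)[OF z] BS(2)[OF z] w_def[symmetric]
          by (simp add: power_mult_distrib algebra_simps)
        then have "V z = c1 * ((w ^ Suc p)^3 * ((A z) ^ 3 - w ^ n * (B z)\<^sup>2))"
          unfolding V[OF Sb[OF z]] by simp
        also have "(w ^ Suc p)^3 = w ^ (2 * p + 1) * w ^ (p + 2)"
          by (simp only: flip: power_mult power_add) (rule arg_cong[where f = "\<lambda>n. w ^ n"], simp)
        finally show ?thesis by (simp add: V_def w_def mult_ac)
      qed
    qed (use q0 in auto)
    then show False using A by simp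
  qed
qed

section \<open>Division by the discriminant, weight 2 and odd weights\<close>

lemma delta_q_factor:
  obtains P where "P holomorphic_on ball 0 1" "\<And>q. q \<in> ball 0 1 \<Longrightarrow> delta_q q = q * P q"
    "\<And>q. q \<in> ball 0 1 \<Longrightarrow> P q \<noteq> 0"
proof -
  obtain P where P: "P holomorphic_on ball 0 1" "\<And>q. q \<in> ball 0 1 \<Longrightarrow> delta_q q = (q - 0) * P q"
      "P 0 = deriv delta_q 0"
    using holomorphic_factor_root[OF holomorphic_delta open_ball delta_q_0] by blast
  moreover have "P q \<noteq> 0" if "q \<in> ball 0 1" for q
    using delta_q_nonzero[OF that] P(2)[OF that] P(3) deriv_delta_q_0 by (cases "q = 0") auto
  ultimately show ?thesis using that by simp
qed

text \<open>The zero of the discriminant at the cusp is simple and matched by that of f, and there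
  is no other zero in the disc.\<close>

lemma modular_q_divide_delta:
  assumes f: "modular_q k f" "f 0 = 0"
  obtains g where "modular_q (k - 12) g" "\<And>q. q \<in> ball 0 1 \<Longrightarrow> f q = delta_q q * g q"
proof -
  obtain P where P: "P holomorphic_on ball 0 1" "\<And>q. q \<in> ball 0 1 \<Longrightarrow> delta_q q = q * P q"
    "\<And>q. q \<in> ball 0 1 \<Longrightarrow> P q \<noteq> 0" using delta_q_factor by blast
  obtain h where h: "h holomorphic_on ball 0 1" "\<And>q. q \<in> ball 0 1 \<Longrightarrow> f q = (q - 0) * h q"
    using holomorphic_factor_root[OF modular_q_holomorphic[OF f(1)] open_ball f(2)] by blast
  define g where "g q = h q / P q" for q
  have fg: "f q = delta_q q * g q" if "q \<in> ball 0 1" for q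
    using P(2,3)[OF that] h(2)[OF that] by (simp add: g_def)
  have "modular_q (k - 12) g"
    unfolding modular_q_def
  proof (intro conjI allI impI)
    show "g holomorphic_on ball 0 1" unfolding g_def by (intro holomorphic_intros P h)
    fix \<tau> :: complex assume \<tau>: "Im \<tau> > 0"
    then have nz: "\<tau> \<noteq> 0" by auto
    note \<tau>' = minus_inverse_upper_half_plane[OF \<tau>]
    have D: "delta_q (nome \<tau>) \<noteq> 0" by (rule delta_q_nonzero) (use \<tau> in auto)
    have "\<tau> powi k * (delta_q (nome \<tau>) * g (nome \<tau>)) = \<tau> powi 12 * delta_q (nome \<tau>) * g (nome (-1 / \<tau>))"
      using modular_q_S[OF f(1) \<tau>] modular_q_S[OF modular_q_delta \<tau>] \<tau> \<tau>'
      by (simp only: fg nome_in_ball)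
    then show "g (nome (-1 / \<tau>)) = \<tau> powi (k - 12) * g (nome \<tau>)"
      using nz D by (simp add: power_int_diff field_simps)
  qed
  then show ?thesis using fg that by blast
qed

text \<open>With c = f(0), the forms f^2 and c^2 E4 agree at the cusp, hence everywhere, and
  likewise f^3 and c^3 E6. Comparing sixth powers shows that c^6 annihilates the
  discriminant.\<close>

lemma modular_q_weight_2:
  assumes f: "modular_q 2 f" and q: "q \<in> ball 0 1"
  shows "f q = 0"
proof -
  define c where "c = f 0"
  have f2: "f q ^ 2 = c\<^sup>2 * E4 q" if "q \<in> ball 0 1" for q
  proof -
    have "f q ^ 2 - c\<^sup>2 * E4 q = 0"
      by (rule modular_q_cusp_form[OF modular_q_diff[OF modular_q_power[OF f] modular_q_cmult[OF modular_q_E4]] _ _ that])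
         (auto simp: c_def)
    then show ?thesis by simp
  qed
  have f3: "f q ^ 3 = c ^ 3 * E6 q" if "q \<in> ball 0 1" for q
  proof -
    have "f q ^ 3 - c ^ 3 * E6 q = 0"
      by (rule modular_q_cusp_form[OF modular_q_diff[OF modular_q_power[OF f] modular_q_cmult[OF modular_q_E6]] _ _ that])
         (auto simp: c_def)
    then show ?thesis by simp
  qed
  obtain q1 where q1: "q1 \<in> ball 0 1" "delta_q q1 \<noteq> 0" using delta_q_not_identically_0 by blast
  have "c ^ 6 * delta_q q1 = (c\<^sup>2 * E4 q1) ^ 3 - (c ^ 3 * E6 q1)\<^sup>2"
    unfolding delta_q_def by (simp add: power_mult_distrib algebra_simps flip: power_mult)
  also have "\<dots> = 0"
    unfolding f2[OF q1(1), symmetric] f3[OF q1(1), symmetric] by (simp flip: power_mult)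
  finally have "c = 0" using q1 by simp
  then show ?thesis using modular_q_cusp_form[OF f _ _ q] by (simp add: c_def)
qed

text \<open>The inversion applied twice is the identity on \<tau>, while the factors of automorphy
  multiply to the k-th power of -1.\<close>

lemma modular_q_odd:
  assumes f: "modular_q k f" "odd k" and q: "q \<in> ball 0 1"
  shows "f q = 0"
proof -
  have *: "f (nome \<tau>) = 0" if \<tau>: "Im \<tau> > 0" for \<tau>
  proof -
    have nz: "\<tau> \<noteq> 0" using \<tau> by auto
    have "f (nome (-1 / (-1 / \<tau>))) = (-1 / \<tau>) powi k * (\<tau> powi k * f (nome \<tau>))"
      unfolding modular_q_S[OF f(1) minus_inverse_upper_half_plane[OF \<tau>]] modular_q_S[OF f(1) \<tau>] ..
    also have "\<dots> = ((-1 / \<tau>) * \<tau>) powi k * f (nome \<tau>)"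
      by (simp only: power_int_mult_distrib mult.assoc)
    also have "(-1 / \<tau>) * \<tau> = -1" using nz by simp
    also have "(-1 :: complex) powi k = -1" using f(2) by (simp add: power_int_minus_left_odd)
    also have "-1 / (-1 / \<tau>) = \<tau>" using nz by simp
    finally show ?thesis by simp
  qed
  have "f 0 = 0"
  proof (rule holomorphic_eq_0_at[OF modular_q_holomorphic[OF f(1)] open_ball])
    show "f z = 0" if "z \<in> ball 0 1 - {0}" for z
      using that * by (metis DiffD1 DiffD2 mem_ball_0 nome_surj singletonI)
  qed simp
  then show ?thesis using * q by (metis mem_ball_0 nome_surj)
qed

section \<open>Level one forms and the ring generated by E4 and E6\<close>

lemma ring_E4_E6_monomial: "(\<lambda>\<tau>. c * eisenstein 4 \<tau> ^ i * eisenstein 6 \<tau> ^ j) \<in> ring_E4_E6"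
  unfolding ring_E4_E6_def
  by (rule CollectI, rule exI[of _ "{(i, j)}"], rule exI[of _ "\<lambda>_ _. c"]) auto

lemma ring_E4_E6_add:
  assumes "r \<in> ring_E4_E6" "s \<in> ring_E4_E6"
  shows "(\<lambda>\<tau>. r \<tau> + s \<tau>) \<in> ring_E4_E6"
proof -
  obtain A c where r: "r = (\<lambda>\<tau>. \<Sum>(i, j)\<in>A. c i j * eisenstein 4 \<tau> ^ i * eisenstein 6 \<tau> ^ j)" "finite A"
    using assms(1) by (auto simp: ring_E4_E6_def)
  obtain B d where s: "s = (\<lambda>\<tau>. \<Sum>(i, j)\<in>B. d i j * eisenstein 4 \<tau> ^ i * eisenstein 6 \<tau> ^ j)" "finite B"
    using assms(2) by (auto simp: ring_E4_E6_def)
  define c' d' where "c' i j = (if (i, j) \<in> A then c i j else 0)"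
    and "d' i j = (if (i, j) \<in> B then d i j else 0)" for i j
  have "r \<tau> = (\<Sum>(i, j)\<in>A \<union> B. c' i j * eisenstein 4 \<tau> ^ i * eisenstein 6 \<tau> ^ j)" for \<tau>
    unfolding r(1) by (rule sum.mono_neutral_cong_left) (use r s in \<open>auto simp: c'_def\<close>)
  moreover have "s \<tau> = (\<Sum>(i, j)\<in>A \<union> B. d' i j * eisenstein 4 \<tau> ^ i * eisenstein 6 \<tau> ^ j)" for \<tau>
    unfolding s(1) by (rule sum.mono_neutral_cong_left) (use r s in \<open>auto simp: d'_def\<close>)
  ultimately have "(\<lambda>\<tau>. r \<tau> + s \<tau>) =
      (\<lambda>\<tau>. \<Sum>(i, j)\<in>A \<union> B. (c' i j + d' i j) * eisenstein 4 \<tau> ^ i * eisenstein 6 \<tau> ^ j)"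
    by (auto simp: algebra_simps case_prod_unfold sum.distrib intro!: ext)
  then show ?thesis unfolding ring_E4_E6_def using r(2) s(2)
    by (intro CollectI exI[of _ "A \<union> B"] exI[of _ "\<lambda>i j. c' i j + d' i j"]) simp
qed

lemma ring_E4_E6_mult_monomial:
  assumes "r \<in> ring_E4_E6"
  shows "(\<lambda>\<tau>. c * eisenstein 4 \<tau> ^ m * eisenstein 6 \<tau> ^ n * r \<tau>) \<in> ring_E4_E6"
proof -
  obtain A d where r: "r = (\<lambda>\<tau>. \<Sum>(i, j)\<in>A. d i j * eisenstein 4 \<tau> ^ i * eisenstein 6 \<tau> ^ j)" "finite A"
    using assms(1) by (auto simp: ring_E4_E6_def)
  let ?g = "\<lambda>(i, j). (i + m, j + n)"
  have "(\<Sum>(i, j)\<in>?g ` A. (c * d (i - m) (j - n)) * eisenstein 4 \<tau> ^ i * eisenstein 6 \<tau> ^ j) =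
     c * eisenstein 4 \<tau> ^ m * eisenstein 6 \<tau> ^ n * r \<tau>" for \<tau>
    unfolding r(1) sum_distrib_left
    by (subst sum.reindex) (auto simp: inj_on_def case_prod_unfold power_add mult_ac intro!: sum.cong)
  then have "(\<lambda>\<tau>. c * eisenstein 4 \<tau> ^ m * eisenstein 6 \<tau> ^ n * r \<tau>) =
    (\<lambda>\<tau>. \<Sum>(i, j)\<in>?g ` A. (c * d (i - m) (j - n)) * eisenstein 4 \<tau> ^ i * eisenstein 6 \<tau> ^ j)"
    by auto
  moreover have "finite (?g ` A)" using r by blast
  ultimately show ?thesis unfolding ring_E4_E6_def by (intro CollectI exI conjI) assumption+
qed

lemma ring_E4_E6_sum:
  assumes "finite K" "\<And>k. k \<in> K \<Longrightarrow> r k \<in> ring_E4_E6"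
  shows "(\<lambda>\<tau>. \<Sum>k\<in>K. r k \<tau>) \<in> ring_E4_E6"
  using assms
proof (induction K rule: finite_induct)
  case empty
  then show ?case using ring_E4_E6_monomial[of 0] by simp
next
  case (insert k K)
  then show ?case using ring_E4_E6_add[of "r k" "\<lambda>\<tau>. \<Sum>k\<in>K. r k \<tau>"] by simp
qed

text \<open>Induction on the weight: every even weight from 4 on is 4 i + 6 j, so a multiple of a
  monomial cancels the constant term, and the rest is divisible by the discriminant. Below that only
  constants occur.\<close>

lemma modular_q_in_ring:
  assumes "modular_q k f"
  obtains r where "r \<in> ring_E4_E6" "\<And>\<tau>. Im \<tau> > 0 \<Longrightarrow> r \<tau> = f (nome \<tau>)"
proof -
  have "\<exists>r\<in>ring_E4_E6. \<forall>\<tau>. Im \<tau> > 0 \<longrightarrow> r \<tau> = f (nome \<tau>)"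
    using assms
  proof (induction "nat k" arbitrary: k f rule: less_induct)
    case (less k f)
    show ?case
    proof (cases "even k \<and> k \<ge> 4")
      case False
      have f0: "f q = f 0" if q: "q \<in> ball 0 1" for q
      proof (cases "k = 0")
        case True
        then show ?thesis using modular_q_weight_0[of f q] less.prems q by simp
      next
        case False
        have "f q = 0" if "q \<in> ball 0 1" for q
        proof -
          have "k < 0 \<or> odd k \<or> k = 2" using False \<open>\<not> (even k \<and> k \<ge> 4)\<close> by presburger
          then show ?thesis
            using modular_q_negative[OF less.prems _ that] modular_q_odd[OF less.prems _ that]
              modular_q_weight_2[of f q] less.prems that by auto
        qed
        from this[OF q] this[of 0] show ?thesis by (metis centre_in_ball zero_less_one)
      qed
      have "f (nome \<tau>) = f 0 * eisenstein 4 \<tau> ^ 0 * eisenstein 6 \<tau> ^ 0" if "Im \<tau> > 0" for \<tau>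
        using f0[of "nome \<tau>"] that by simp
      with ring_E4_E6_monomial[of "f 0" 0 0] show ?thesis by (intro bexI) auto
    next
      case 2: True
      have "\<exists>i j. int (4 * i + 6 * j) = k"
      proof (cases "4 dvd k")
        case True
        then have "int (4 * nat (k div 4) + 6 * 0) = k" using 2 by auto
        then show ?thesis by blast
      next
        case False
        then have "\<exists>m\<ge>0. k = 4 * m + 6" using 2 by presburger
        then obtain m where "m \<ge> 0" "k = 4 * m + 6" by blast
        then have "int (4 * nat m + 6 * 1) = k" by simp
        then show ?thesis by blast
      qed
      then obtain i j where ij: "int (4 * i + 6 * j) = k" by blast
      have "modular_q k (\<lambda>q. f q - f 0 * (E4 q ^ i * E6 q ^ j))"
        using ij by (intro modular_q_diff less.prems modular_q_cmult
           modular_q_mult[OF modular_q_power[OF modular_q_E4 refl] modular_q_power[OF modular_q_E6 refl]]) simp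
      then obtain g where g: "modular_q (k - 12) g"
          "\<And>q. q \<in> ball 0 1 \<Longrightarrow> f q - f 0 * (E4 q ^ i * E6 q ^ j) = delta_q q * g q"
        by (rule modular_q_divide_delta) auto
      have "nat (k - 12) < nat k" using 2 by simp
      from less.hyps[OF this g(1)] obtain s where s: "s \<in> ring_E4_E6" "\<And>\<tau>. Im \<tau> > 0 \<Longrightarrow> s \<tau> = g (nome \<tau>)"
        by blast
      let ?r = "\<lambda>\<tau>. f 0 * eisenstein 4 \<tau> ^ i * eisenstein 6 \<tau> ^ j +
         (1 * eisenstein 4 \<tau> ^ 3 * eisenstein 6 \<tau> ^ 0 * s \<tau> + (-1) * eisenstein 4 \<tau> ^ 0 * eisenstein 6 \<tau> ^ 2 * s \<tau>)"
      have r: "?r \<in> ring_E4_E6"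
        by (intro ring_E4_E6_add ring_E4_E6_monomial ring_E4_E6_mult_monomial s)
      have "?r \<tau> = f (nome \<tau>)" if "Im \<tau> > 0" for \<tau>
      proof -
        have q: "nome \<tau> \<in> ball 0 1" using that by simp
        have "f (nome \<tau>) = f 0 * (E4 (nome \<tau>) ^ i * E6 (nome \<tau>) ^ j) + delta_q (nome \<tau>) * g (nome \<tau>)"
          unfolding g(2)[OF q, symmetric] by (rule diff_add_cancel[symmetric, THEN trans]) (rule add.commute)
        then show ?thesis
          unfolding delta_q_def eisenstein_q_nome[OF that] s(2)[OF that, symmetric]
          by (simp add: left_diff_distrib mult.assoc)
      qed
      then show ?thesis by (intro bexI[OF _ r] allI impI)
    qed
  qed
  then show ?thesis using that by blast
qed

text \<open>Monomials are grouped by weight. The components exist for every weight and vanish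
  outside K, so that sums can later be extended to a common index set.\<close>

lemma ring_E4_E6_homogeneous:
  assumes "r \<in> ring_E4_E6"
  obtains K f where "finite K" "\<And>k. modular_q k (f k)" "\<And>\<tau>. Im \<tau> > 0 \<Longrightarrow> r \<tau> = (\<Sum>k\<in>K. f k (nome \<tau>))"
    "\<And>k q. k \<notin> K \<Longrightarrow> f k q = 0"
proof -
  obtain A c where r: "r = (\<lambda>\<tau>. \<Sum>(i, j)\<in>A. c i j * eisenstein 4 \<tau> ^ i * eisenstein 6 \<tau> ^ j)" "finite A"
    using assms(1) by (auto simp: ring_E4_E6_def)
  define w where "w = (\<lambda>(i, j). int (4 * i + 6 * j))"
  define f where "f k q = (\<Sum>(i, j)\<in>{x \<in> A. w x = k}. c i j * E4 q ^ i * E6 q ^ j)" for k q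
  show ?thesis
  proof (rule that[of "w ` A" f])
    have *: "modular_q k (\<lambda>q. \<Sum>(i, j)\<in>B. c i j * E4 q ^ i * E6 q ^ j)" if "finite B" "\<And>x. x \<in> B \<Longrightarrow> w x = k" for k B
      using that
    proof (induction B rule: finite_induct)
      case (insert x B)
      obtain i j where x: "x = (i, j)" by force
      have k: "k = int i * 4 + int j * 6" using insert.prems[of x] by (simp add: x w_def)
      have "modular_q k (\<lambda>q. E4 q ^ i * E6 q ^ j)"
        by (rule modular_q_mult[OF modular_q_power[OF modular_q_E4 refl] modular_q_power[OF modular_q_E6 refl] k])
      then have "modular_q k (\<lambda>q. c i j * (E4 q ^ i * E6 q ^ j))" by (rule modular_q_cmult)
      with insert show ?case by (simp add: x mult.assoc modular_q_add)
    qed (simp add: modular_q_zero)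
    show "modular_q k (f k)" for k
      unfolding f_def[abs_def] by (rule *) (use r in auto)
    show "r \<tau> = (\<Sum>k\<in>w ` A. f k (nome \<tau>))" if "Im \<tau> > 0" for \<tau>
      unfolding r(1) f_def eisenstein_q_nome[OF that]
      by (rule sum.group[symmetric]) (use r in auto)
    show "f k q = 0" if "k \<notin> w ` A" for k q
    proof -
      have "{x \<in> A. w x = k} = {}" using that by blast
      then show ?thesis by (simp only: f_def sum.empty)
    qed
  qed (use r in auto)
qed

section \<open>A twelfth root of the discriminant\<close>

text \<open>\<open>G\<close> is the 12th root of \<open>\<Delta>/q\<close>, so that \<open>e(\<tau>/12) G(q)\<close> is, up to a constant, the square of Dedekind's
  \<open>\<eta>\<close>-function.\<close>

lemma eta_square:
  obtains G where "G holomorphic_on ball 0 1" "\<And>q. q \<in> ball 0 1 \<Longrightarrow> G q \<noteq> 0"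
    "\<And>\<tau>. Im \<tau> > 0 \<Longrightarrow> nome (-1 / \<tau> / 12) * G (nome (-1 / \<tau>)) = - \<i> * \<tau> * (nome (\<tau> / 12) * G (nome \<tau>))"
proof -
  obtain P where P: "P holomorphic_on ball 0 1" "\<And>q. q \<in> ball 0 1 \<Longrightarrow> delta_q q = q * P q"
    "\<And>q. q \<in> ball 0 1 \<Longrightarrow> P q \<noteq> 0" using delta_q_factor by blast
  obtain g where g: "g holomorphic_on ball 0 1" "\<And>q. q \<in> ball 0 1 \<Longrightarrow> P q = exp (g q)"
    using contractible_imp_holomorphic_log[OF P(1) convex_imp_contractible[OF convex_ball] P(3)] by metis
  define G where "G q = exp (g q / 12)" for q
  have holG: "G holomorphic_on ball 0 1" unfolding G_def by (intro holomorphic_intros g) auto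
  define \<eta> where "\<eta> \<tau> = nome (\<tau> / 12) * G (nome \<tau>)" for \<tau>
  have \<eta>12: "\<eta> \<tau> ^ 12 = delta_q (nome \<tau>)" if "Im \<tau> > 0" for \<tau>
  proof -
    have "nome (\<tau> / 12) ^ 12 = nome \<tau>"
      by (simp add: nome_def mult_ac flip: exp_of_nat_mult)
    moreover have "G (nome \<tau>) ^ 12 = P (nome \<tau>)"
      using g(2)[of "nome \<tau>"] that by (simp add: G_def flip: exp_of_nat_mult)
    ultimately show ?thesis using P(2)[of "nome \<tau>"] that by (simp add: \<eta>_def power_mult_distrib)
  qed
  have \<eta>nz: "\<eta> \<tau> \<noteq> 0" for \<tau> by (simp add: \<eta>_def G_def)
  \<comment> \<open>A continuous function whose 12th power is 1 on a connected domain, hence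
    constant. Its value is read off at the fixed point \<i> of the inversion, where it is 1 /
    \<i>.\<close>
  define u where "u \<tau> = \<eta> (-1 / \<tau>) / (\<tau> * \<eta> \<tau>)" for \<tau>
  have u12: "u \<tau> ^ 12 = 1" if \<tau>: "Im \<tau> > 0" for \<tau>
  proof -
    have nz: "\<tau> \<noteq> 0" using \<tau> by auto
    have "delta_q (nome \<tau>) \<noteq> 0" by (rule delta_q_nonzero) (use \<tau> in auto)
    then show ?thesis
      unfolding u_def power_divide power_mult_distrib \<eta>12[OF \<tau>] \<eta>12[OF minus_inverse_upper_half_plane[OF \<tau>]]
        modular_q_S[OF modular_q_delta \<tau>] using nz by simp
  qed
  let ?H = "{\<tau>. Im \<tau> > 0}"
  have "continuous_on ?H u"
  proof -
    have c: "continuous_on ?H (\<lambda>\<tau>. G (nome (h \<tau>)))" if "continuous_on ?H h" "\<And>\<tau>. Im \<tau> > 0 \<Longrightarrow> Im (h \<tau>) > 0" for h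
      by (rule continuous_on_compose2[OF holomorphic_on_imp_continuous_on[OF holG]])
         (use that in \<open>auto intro!: continuous_intros\<close>)
    show ?thesis
      unfolding u_def \<eta>_def using minus_inverse_upper_half_plane
      by (intro continuous_intros c) (auto simp: G_def)
  qed
  moreover have "finite (u ` ?H)"
  proof (rule finite_subset)
    show "u ` ?H \<subseteq> {z. z ^ 12 = 1}" using u12 by auto
    show "finite {z :: complex. z ^ 12 = 1}" using finite_roots_unity[of 12] by simp
  qed
  moreover have "connected ?H" by (rule convex_connected[OF convex_halfspace_Im_gt])
  ultimately have "u constant_on ?H" by (intro continuous_finite_range_constant)
  then obtain s where s: "\<And>\<tau>. Im \<tau> > 0 \<Longrightarrow> u \<tau> = s" by (auto simp: constant_on_def)
  have "u \<i> = - \<i>" using \<eta>nz[of \<i>] by (simp add: u_def)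
  then have "s = - \<i>" using s[of \<i>] by simp
  then have "\<eta> (-1 / \<tau>) = - \<i> * \<tau> * \<eta> \<tau>" if \<tau>: "Im \<tau> > 0" for \<tau>
  proof -
    have "\<tau> \<noteq> 0" using \<tau> by auto
    then have "\<eta> (-1 / \<tau>) = u \<tau> * (\<tau> * \<eta> \<tau>)" using \<eta>nz[of \<tau>] by (simp add: u_def)
    then show ?thesis by (simp only: s[OF \<tau>] \<open>s = - \<i>\<close> mult.assoc)
  qed
  then show ?thesis using that[of G] holG by (simp add: \<eta>_def G_def)
qed

section \<open>Generators of \<open>SL\<^sub>2(\<int>)\<close> and matrix exponentials\<close>

definition mat2 :: "'a \<Rightarrow> 'a \<Rightarrow> 'a \<Rightarrow> 'a \<Rightarrow> 'a::zero^2^2" where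
  "mat2 a b c d = vector [vector [a, b], vector [c, d]]"

lemma mat2_nth [simp]:
  "mat2 a b c d $ 1 $ 1 = a" "mat2 a b c d $ 1 $ 2 = b" "mat2 a b c d $ 2 $ 1 = c" "mat2 a b c d $ 2 $ 2 = d"
  by (simp_all add: mat2_def)

lemma mat2_collapse [simp]: "mat2 (A $ 1 $ 1) (A $ 1 $ 2) (A $ 2 $ 1) (A $ 2 $ 2) = A"
  by (simp add: vec_eq_iff forall_2)

lemma mat2_mult:
  fixes a b c d :: "'a::comm_ring_1"
  shows "mat2 a b c d ** mat2 a' b' c' d' = mat2 (a * a' + b * c') (a * b' + b * d') (c * a' + d * c') (c * b' + d * d')"
  by (simp add: vec_eq_iff forall_2 matrix_matrix_mult_def sum_2)

lemma mat2_vec: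
  fixes a b c d :: "'a::comm_ring_1"
  shows "mat2 a b c d *v vector [x, y] = vector [a * x + b * y, c * x + d * y]"
  by (simp add: vec_eq_iff forall_2 matrix_vector_mult_def sum_2)

lemma det_mat2: "det (mat2 a b c d :: 'a::comm_ring_1^2^2) = a * d - b * c"
  by (simp add: det_2)

definition S_mat :: "int^2^2" where "S_mat = mat2 0 (-1) 1 0"
definition T_inv_mat :: "int^2^2" where "T_inv_mat = mat2 1 (-1) 0 1"

lemma T_mat_eq: "T_mat = mat2 1 1 0 1"
  by (simp add: T_mat_def mat2_def)

lemma carrier_SL2Z: "A \<in> carrier SL2Z \<longleftrightarrow> det A = 1"
  by (simp add: SL2Z_def)

lemma generators_in_SL2Z [simp]:
  "S_mat \<in> carrier SL2Z" "T_mat \<in> carrier SL2Z" "T_inv_mat \<in> carrier SL2Z" "mat 1 \<in> carrier SL2Z"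
  by (simp_all add: carrier_SL2Z S_mat_def T_mat_eq T_inv_mat_def det_mat2 det_I)

lemma SL2Z_mult_closed [simp]: "A \<in> carrier SL2Z \<Longrightarrow> B \<in> carrier SL2Z \<Longrightarrow> A ** B \<in> carrier SL2Z"
  by (simp add: carrier_SL2Z det_mul)

text \<open>The Euclidean algorithm on the first column, with the lower left entry as measure. The
  inverse of T has its own case because words grow by left multiplication only; the inverse of S is
  a power of S.\<close>

lemma SL2Z_induct [consumes 1, case_names one S T T_inv]:
  assumes "\<gamma> \<in> carrier SL2Z"
    and one: "P (mat 1)"
    and S: "\<And>\<gamma>. \<gamma> \<in> carrier SL2Z \<Longrightarrow> P \<gamma> \<Longrightarrow> P (S_mat ** \<gamma>)"
    and T: "\<And>\<gamma>. \<gamma> \<in> carrier SL2Z \<Longrightarrow> P \<gamma> \<Longrightarrow> P (T_mat ** \<gamma>)"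
    and T': "\<And>\<gamma>. \<gamma> \<in> carrier SL2Z \<Longrightarrow> P \<gamma> \<Longrightarrow> P (T_inv_mat ** \<gamma>)"
  shows "P \<gamma>"
proof -
  define Q where "Q a b c d \<longleftrightarrow> a * d - b * c = 1 \<and> P (mat2 a b c d)" for a b c d :: int
  have Q1: "Q 1 0 0 1"
  proof -
    have "mat2 1 0 0 1 = (mat 1 :: int^2^2)" by (simp add: vec_eq_iff forall_2 mat_def)
    then show ?thesis using one by (simp add: Q_def)
  qed
  have QS: "Q (-c) (-d) a b" if "Q a b c d" for a b c d
    using S[of "mat2 a b c d"] that
    by (auto simp: Q_def carrier_SL2Z det_mat2 S_mat_def mat2_mult algebra_simps)
  have QT: "Q (a + c) (b + d) c d" if "Q a b c d" for a b c d
    using T[of "mat2 a b c d"] that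
    by (auto simp: Q_def carrier_SL2Z det_mat2 T_mat_eq mat2_mult algebra_simps)
  have QT': "Q (a - c) (b - d) c d" if "Q a b c d" for a b c d
    using T'[of "mat2 a b c d"] that
    by (auto simp: Q_def carrier_SL2Z det_mat2 T_inv_mat_def mat2_mult algebra_simps)
  have QTn: "Q (a + n * c) (b + n * d) c d" if "Q a b c d" for a b c d n
  proof (induction n rule: int_induct[of _ 0])
    case (step1 n)
    then show ?case using QT[OF step1(2)] by (simp add: algebra_simps)
  next
    case (step2 n)
    then show ?case using QT'[OF step2(2)] by (simp add: algebra_simps)
  qed (use that in simp)
  have Q: "Q a b c d" if "a * d - b * c = 1" for a b c d
    using that
  proof (induction "nat \<bar>c\<bar>" arbitrary: a b c d rule: less_induct)
    case less
    show ?case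
    proof (cases "c = 0")
      case True
      then have "a * d = 1" using less.prems by simp
      then consider "a = 1" "d = 1" | "a = -1" "d = -1" by (auto simp: zmult_eq_1_iff)
      then show ?thesis
      proof cases
        case 1
        then show ?thesis using QTn[OF Q1, of b] True by simp
      next
        case 2
        have "Q (-1) 0 0 (-1)" using QS[OF QS[OF Q1]] by simp
        from QTn[OF this, of "-b"] show ?thesis using 2 True by simp
      qed
    next
      case False
      \<comment> \<open>Division with remainder in the first column: the matrix is T^n S applied to
        one with rows (c, d) and (-a', -b'), whose lower left entry is smaller in absolute
        value.\<close>
      define n a' b' where "n = a div c" and "a' = a mod c" and "b' = b - n * d"
      have a: "a = a' + n * c" by (simp add: n_def a'_def)
      have "nat \<bar>- a'\<bar> < nat \<bar>c\<bar>" using False abs_mod_less[of c a] by (simp add: a'_def)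
      moreover have "c * (- b') - d * (- a') = 1"
        using less.prems by (simp add: a b'_def algebra_simps)
      ultimately have "Q c d (- a') (- b')" by (rule less.hyps)
      from QTn[OF QS[OF this], of n] show ?thesis by (simp add: a b'_def)
    qed
  qed
  have "\<gamma> $ 1 $ 1 * \<gamma> $ 2 $ 2 - \<gamma> $ 1 $ 2 * \<gamma> $ 2 $ 1 = 1"
    using assms(1) by (simp add: carrier_SL2Z det_2)
  from Q[OF this] show ?thesis by (simp add: Q_def)
qed

lemma hom_SL2Z_mult:
  assumes "\<rho> \<in> hom SL2Z GL" "A \<in> carrier SL2Z" "B \<in> carrier SL2Z"
  shows "\<rho> (A ** B) = \<rho> A ** \<rho> B"
  using assms by (auto simp: hom_def SL2Z_def GL_def)

lemma hom_SL2Z_invertible: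
  assumes "\<rho> \<in> hom SL2Z GL" "A \<in> carrier SL2Z"
  shows "invertible (\<rho> A)"
  using assms by (auto simp: hom_def GL_def)

lemma hom_SL2Z_one:
  assumes "\<rho> \<in> hom SL2Z GL"
  shows "\<rho> (mat 1) = mat 1"
proof -
  obtain B where B: "B ** \<rho> (mat 1) = mat 1"
    using hom_SL2Z_invertible[OF assms, of "mat 1"] by (auto simp: invertible_def)
  have "\<rho> (mat 1) ** \<rho> (mat 1) = \<rho> (mat 1)"
    using hom_SL2Z_mult[OF assms, of "mat 1" "mat 1"] by simp
  then have "B ** (\<rho> (mat 1) ** \<rho> (mat 1)) = B ** \<rho> (mat 1)" by simp
  then show ?thesis by (simp add: matrix_mul_assoc B)
qed

lemma T_inv_mult: "T_inv_mat ** T_mat = mat 1" "T_mat ** T_inv_mat = mat 1"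
  by (simp_all add: T_inv_mat_def T_mat_eq mat2_mult vec_eq_iff forall_2 mat_def)

lemma hom_T_inv:
  assumes "\<rho> \<in> hom SL2Z GL"
  shows "\<rho> T_inv_mat ** \<rho> T_mat = mat 1" "\<rho> T_mat ** \<rho> T_inv_mat = mat 1"
  using hom_SL2Z_mult[OF assms, of T_inv_mat T_mat] hom_SL2Z_mult[OF assms, of T_mat T_inv_mat]
  by (simp_all add: T_inv_mult hom_SL2Z_one[OF assms])

lemma aut_factor_generators:
  "aut_factor (T_mat ** \<gamma>) \<tau> = aut_factor \<gamma> \<tau>" "aut_factor (T_inv_mat ** \<gamma>) \<tau> = aut_factor \<gamma> \<tau>"
  "aut_factor (S_mat ** \<gamma>) \<tau> = of_int (\<gamma> $ 1 $ 1) * \<tau> + of_int (\<gamma> $ 1 $ 2)"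
  by (simp_all add: aut_factor_def T_mat_eq T_inv_mat_def S_mat_def matrix_matrix_mult_def sum_2)

lemma moebius_generators:
  assumes "aut_factor \<gamma> \<tau> \<noteq> 0"
  shows "moebius (T_mat ** \<gamma>) \<tau> = moebius \<gamma> \<tau> + 1" "moebius (T_inv_mat ** \<gamma>) \<tau> = moebius \<gamma> \<tau> - 1"
    "moebius (S_mat ** \<gamma>) \<tau> = -1 / moebius \<gamma> \<tau>" "aut_factor (S_mat ** \<gamma>) \<tau> = moebius \<gamma> \<tau> * aut_factor \<gamma> \<tau>"
proof -
  have *: "(T_mat ** \<gamma>) $ 1 $ 1 = \<gamma> $ 1 $ 1 + \<gamma> $ 2 $ 1" "(T_mat ** \<gamma>) $ 1 $ 2 = \<gamma> $ 1 $ 2 + \<gamma> $ 2 $ 2"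
    "(T_inv_mat ** \<gamma>) $ 1 $ 1 = \<gamma> $ 1 $ 1 - \<gamma> $ 2 $ 1" "(T_inv_mat ** \<gamma>) $ 1 $ 2 = \<gamma> $ 1 $ 2 - \<gamma> $ 2 $ 2"
    "(S_mat ** \<gamma>) $ 1 $ 1 = - \<gamma> $ 2 $ 1" "(S_mat ** \<gamma>) $ 1 $ 2 = - \<gamma> $ 2 $ 2"
    by (simp_all add: T_mat_eq T_inv_mat_def S_mat_def matrix_matrix_mult_def sum_2)
  define j n where "j = aut_factor \<gamma> \<tau>" and "n = of_int (\<gamma> $ 1 $ 1) * \<tau> + of_int (\<gamma> $ 1 $ 2)"
  have j: "j \<noteq> 0" "j = of_int (\<gamma> $ 2 $ 1) * \<tau> + of_int (\<gamma> $ 2 $ 2)"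
    using assms by (simp_all add: j_def aut_factor_def)
  have m: "moebius \<gamma> \<tau> = n / j" by (simp add: moebius_def n_def j_def)
  have "moebius (T_mat ** \<gamma>) \<tau> = (n + j) / j"
    unfolding moebius_def aut_factor_generators * j_def[symmetric] by (simp add: n_def j(2) algebra_simps)
  then show "moebius (T_mat ** \<gamma>) \<tau> = moebius \<gamma> \<tau> + 1" using j(1) by (simp add: m add_divide_distrib)
  have "moebius (T_inv_mat ** \<gamma>) \<tau> = (n - j) / j"
    unfolding moebius_def aut_factor_generators * j_def[symmetric] by (simp add: n_def j(2) algebra_simps)
  then show "moebius (T_inv_mat ** \<gamma>) \<tau> = moebius \<gamma> \<tau> - 1" using j(1) by (simp add: m diff_divide_distrib)
  have "moebius (S_mat ** \<gamma>) \<tau> = - j / n"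
    unfolding moebius_def aut_factor_generators * n_def[symmetric] by (simp add: j(2) algebra_simps)
  then show "moebius (S_mat ** \<gamma>) \<tau> = -1 / moebius \<gamma> \<tau>" by (simp add: m)
  show "aut_factor (S_mat ** \<gamma>) \<tau> = moebius \<gamma> \<tau> * aut_factor \<gamma> \<tau>"
    using j(1) by (simp add: aut_factor_generators m flip: j_def n_def)
qed

text \<open>The factors of automorphy form a cocycle, so the generators suffice. The induction
  carries along that the denominator is nonzero and that the image stays in the upper half-plane,
  since the laws for S and T are available only there.\<close>

lemma modular_transformation_generators:
  fixes \<rho> :: "int^2^2 \<Rightarrow> complex^'n^'n"
  assumes hom: "\<rho> \<in> hom SL2Z GL"
    and T: "\<And>\<tau>. Im \<tau> > 0 \<Longrightarrow> F (\<tau> + 1) = \<rho> T_mat *v F \<tau>"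
    and S: "\<And>\<tau>. Im \<tau> > 0 \<Longrightarrow> F (-1 / \<tau>) = (\<tau> powi k) *s (\<rho> S_mat *v F \<tau>)"
    and \<gamma>: "\<gamma> \<in> carrier SL2Z" and \<tau>: "Im \<tau> > 0"
  shows "F (moebius \<gamma> \<tau>) = (aut_factor \<gamma> \<tau> powi k) *s (\<rho> \<gamma> *v F \<tau>)"
proof -
  have "aut_factor \<gamma> \<tau> \<noteq> 0 \<and> Im (moebius \<gamma> \<tau>) > 0 \<and>
    F (moebius \<gamma> \<tau>) = (aut_factor \<gamma> \<tau> powi k) *s (\<rho> \<gamma> *v F \<tau>)"
    using \<gamma>
  proof (induction rule: SL2Z_induct)
    case one
    have "(mat 1 :: int^2^2) $ 1 $ 1 = 1" "(mat 1 :: int^2^2) $ 1 $ 2 = 0"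
      "(mat 1 :: int^2^2) $ 2 $ 1 = 0" "(mat 1 :: int^2^2) $ 2 $ 2 = 1"
      by (simp_all add: mat_def)
    then show ?case using \<tau> by (simp add: aut_factor_def moebius_def hom_SL2Z_one[OF hom])
  next
    case (S \<gamma>)
    define \<sigma> where "\<sigma> = moebius \<gamma> \<tau>"
    have \<sigma>: "Im \<sigma> > 0" "\<sigma> \<noteq> 0" using S by (auto simp: \<sigma>_def)
    have j: "aut_factor \<gamma> \<tau> \<noteq> 0" using S by blast
    have "F (-1 / \<sigma>) = ((\<sigma> * aut_factor \<gamma> \<tau>) powi k) *s (\<rho> (S_mat ** \<gamma>) *v F \<tau>)"
      unfolding assms(3)[OF \<sigma>(1)] hom_SL2Z_mult[OF hom generators_in_SL2Z(1) S(1)]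
      using S by (simp add: \<sigma>_def power_int_mult_distrib matrix_vector_mul_assoc[symmetric]
        vec.linear_scale[OF matrix_vector_mul_linear_gen])
    then show ?case
      using j \<sigma> minus_inverse_upper_half_plane[OF \<sigma>(1)] by (simp only: moebius_generators[OF j] flip: \<sigma>_def) simp
  next
    case (T \<gamma>)
    define \<sigma> where "\<sigma> = moebius \<gamma> \<tau>"
    have \<sigma>: "Im \<sigma> > 0" using T by (simp add: \<sigma>_def)
    have j: "aut_factor \<gamma> \<tau> \<noteq> 0" using T by blast
    have "F (\<sigma> + 1) = (aut_factor \<gamma> \<tau> powi k) *s (\<rho> (T_mat ** \<gamma>) *v F \<tau>)"
      unfolding assms(2)[OF \<sigma>] hom_SL2Z_mult[OF hom generators_in_SL2Z(2) T(1)]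
      using T by (simp add: \<sigma>_def matrix_vector_mul_assoc[symmetric] vec.linear_scale[OF matrix_vector_mul_linear_gen])
    then show ?case
      using j \<sigma> by (simp only: moebius_generators[OF j] aut_factor_generators flip: \<sigma>_def) simp
  next
    case (T_inv \<gamma>)
    define \<sigma> where "\<sigma> = moebius \<gamma> \<tau>"
    have \<sigma>: "Im \<sigma> > 0" using T_inv by (simp add: \<sigma>_def)
    have j: "aut_factor \<gamma> \<tau> \<noteq> 0" using T_inv by blast
    have "F (\<sigma> - 1) = \<rho> T_inv_mat *v (\<rho> T_mat *v F (\<sigma> - 1))"
      by (simp add: matrix_vector_mul_assoc hom_T_inv[OF hom])
    also have "\<rho> T_mat *v F (\<sigma> - 1) = F \<sigma>" using assms(2)[of "\<sigma> - 1"] \<sigma> by simp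
    also have "\<rho> T_inv_mat *v F \<sigma> = (aut_factor \<gamma> \<tau> powi k) *s (\<rho> (T_inv_mat ** \<gamma>) *v F \<tau>)"
      unfolding hom_SL2Z_mult[OF hom generators_in_SL2Z(3) T_inv(1)]
      using T_inv by (simp add: \<sigma>_def matrix_vector_mul_assoc[symmetric] vec.linear_scale[OF matrix_vector_mul_linear_gen])
    finally show ?case
      using j \<sigma> by (simp only: moebius_generators[OF j] aut_factor_generators flip: \<sigma>_def) simp
  qed
  then show ?thesis by blast
qed

lemma moebius_S [simp]: "moebius S_mat \<tau> = -1 / \<tau>" "aut_factor S_mat \<tau> = \<tau>"
  by (simp_all add: moebius_def aut_factor_def S_mat_def)

section \<open>Matrix powers and the matrix exponential\<close>

abbreviation matrix_power :: "'a::comm_ring_1^'n^'n \<Rightarrow> nat \<Rightarrow> 'a^'n^'n" where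
  "matrix_power A m \<equiv> (((**) A) ^^ m) (mat 1)"

lemma matrix_power_commute: "matrix_power A m ** A = A ** matrix_power A m"
  by (induction m) (simp_all flip: matrix_mul_assoc)

lemma matrix_power_eigenvector:
  fixes A :: "complex^'n^'n"
  assumes "A *v v = l *s v"
  shows "matrix_power A m *v v = (l ^ m) *s v"
proof (induction m)
  case (Suc m)
  have "matrix_power A (Suc m) *v v = A *v (matrix_power A m *v v)"
    by (simp add: matrix_vector_mul_assoc)
  then show ?case
    unfolding Suc by (simp add: vec.linear_scale[OF matrix_vector_mul_linear_gen] assms mult_ac)
qed simp

lemma matrix_power_entry_bound:
  fixes A :: "complex^'n^'n"
  shows "norm (matrix_power A m $ i $ j) \<le> (\<Sum>i\<in>UNIV. \<Sum>j\<in>UNIV. norm (A $ i $ j)) ^ m"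
proof (induction m arbitrary: i)
  case 0
  show ?case by (simp add: mat_def)
next
  case (Suc m)
  define N where "N = (\<Sum>i\<in>UNIV. \<Sum>j\<in>UNIV. norm (A $ i $ j))"
  have "norm (matrix_power A (Suc m) $ i $ j) \<le> (\<Sum>k\<in>UNIV. norm (A $ i $ k * matrix_power A m $ k $ j))"
    by (simp add: matrix_matrix_mult_def norm_sum)
  also have "\<dots> \<le> (\<Sum>k\<in>UNIV. norm (A $ i $ k) * N ^ m)"
    unfolding norm_mult N_def by (intro sum_mono mult_left_mono Suc.IH) auto
  also have "\<dots> = (\<Sum>k\<in>UNIV. norm (A $ i $ k)) * N ^ m" by (simp add: sum_distrib_right)
  also have "\<dots> \<le> N * N ^ m"
    unfolding N_def by (intro mult_right_mono member_le_sum zero_le_power sum_nonneg) auto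
  finally show ?case by (simp add: N_def)
qed

text \<open>\<open>matrix_exp\<close> is a bare infinite sum and says nothing before convergence is
  known. The m-th power has entries of norm at most N^m, with N the sum of the norms of all entries
  of A, so the exponential series of N dominates.\<close>

lemma matrix_exp_sums:
  fixes A :: "complex^'n^'n"
  shows "(\<lambda>m. matrix_power A m /\<^sub>R fact m) sums matrix_exp A"
proof -
  define N where "N = (\<Sum>i\<in>UNIV. \<Sum>j\<in>UNIV. norm (A $ i $ j))"
  define C where "C = real (CARD('n)) * real (CARD('n))"
  have "norm (matrix_power A m /\<^sub>R fact m) \<le> C * (N ^ m /\<^sub>R fact m)" for m
  proof -
    have "norm (matrix_power A m) \<le> (\<Sum>i\<in>UNIV. norm (matrix_power A m $ i))"
      unfolding norm_vec_def by (rule L2_set_le_sum) auto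
    also have "\<dots> \<le> (\<Sum>i\<in>UNIV. \<Sum>j\<in>UNIV. norm (matrix_power A m $ i $ j))"
    proof (rule sum_mono)
      fix i :: 'n
      show "norm (matrix_power A m $ i) \<le> (\<Sum>j\<in>UNIV. norm (matrix_power A m $ i $ j))"
        unfolding norm_vec_def[of "matrix_power A m $ i"] by (rule L2_set_le_sum) auto
    qed
    also have "\<dots> \<le> (\<Sum>i\<in>(UNIV::'n set). \<Sum>j\<in>(UNIV::'n set). N ^ m)"
      unfolding N_def by (intro sum_mono matrix_power_entry_bound)
    also have "\<dots> = C * N ^ m" by (simp add: C_def)
    finally have "inverse (fact m) * norm (matrix_power A m) \<le> inverse (fact m) * (C * N ^ m)"
      by (intro mult_left_mono) auto
    then show ?thesis by (simp add: mult_ac)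
  qed
  moreover have "summable (\<lambda>m. C * (N ^ m /\<^sub>R fact m))"
    by (intro summable_mult summable_exp_generic)
  ultimately have "summable (\<lambda>m. matrix_power A m /\<^sub>R fact m)"
    by (rule summable_comparison_test'[where N = 0, rotated])
  then show ?thesis by (simp add: matrix_exp_def summable_sums)
qed

lemma matrix_exp_commute:
  fixes A :: "complex^'n^'n"
  shows "matrix_exp A ** A = A ** matrix_exp A"
proof -
  have "bounded_linear (\<lambda>X. X ** A)" "bounded_linear (\<lambda>X. A ** X)"
    unfolding linear_conv_bounded_linear[symmetric]
    by (auto intro!: linearI simp: matrix_matrix_mult_def vec_eq_iff sum.distrib ring_distribs scaleR_sum_right)
  then have s: "(\<lambda>m. (matrix_power A m /\<^sub>R fact m) ** A) sums (matrix_exp A ** A)"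
    "(\<lambda>m. A ** (matrix_power A m /\<^sub>R fact m)) sums (A ** matrix_exp A)"
    using bounded_linear.sums[OF _ matrix_exp_sums] by blast+
  have e: "(matrix_power A m /\<^sub>R fact m) ** A = A ** (matrix_power A m /\<^sub>R fact m)" for m
  proof -
    have "(c *\<^sub>R X) ** A = c *\<^sub>R (X ** A)" "A ** (c *\<^sub>R X) = c *\<^sub>R (A ** X)" for c and X :: "complex^'n^'n"
      by (simp_all add: matrix_matrix_mult_def vec_eq_iff scaleR_sum_right)
    then show ?thesis by (simp add: matrix_power_commute)
  qed
  show ?thesis by (rule sums_unique2[OF s(1)[unfolded e] s(2)])
qed

lemma matrix_exp_eigenvector:
  fixes A :: "complex^'n^'n"
  assumes "A *v v = l *s v"
  shows "matrix_exp A *v v = exp l *s v"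
proof -
  have "bounded_linear (\<lambda>X :: complex^'n^'n. X *v v)"
    unfolding linear_conv_bounded_linear[symmetric]
    by (auto intro!: linearI simp: matrix_vector_mult_def vec_eq_iff sum.distrib ring_distribs scaleR_sum_right)
  from bounded_linear.sums[OF this matrix_exp_sums]
  have "(\<lambda>m. (matrix_power A m /\<^sub>R fact m) *v v) sums (matrix_exp A *v v)" .
  moreover have "(matrix_power A m /\<^sub>R fact m) *v v = (l ^ m /\<^sub>R fact m) *s v" for m
  proof -
    have "(c *\<^sub>R X) *v v = c *\<^sub>R (X *v v)" for c and X :: "complex^'n^'n"
      by (simp add: matrix_vector_mult_def vec_eq_iff scaleR_sum_right)
    then show ?thesis by (simp add: matrix_power_eigenvector[OF assms] vec_eq_iff)
  qed
  moreover have "bounded_linear (\<lambda>z. z *s v)"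
    unfolding linear_conv_bounded_linear[symmetric]
    by (auto intro!: linearI simp: vec_eq_iff ring_distribs)
  then have "(\<lambda>m. (l ^ m /\<^sub>R fact m) *s v) sums (exp l *s v)"
    using bounded_linear.sums[OF _ exp_converges] by blast
  ultimately show ?thesis by (simp add: sums_unique2)
qed

section \<open>Indecomposable extensions of characters\<close>

lemma nome_power: "nome x ^ n = nome (of_nat n * x)"
  by (simp add: nome_def mult_ac flip: exp_of_nat_mult)

lemma nome_quarter: "nome (1/4) = \<i>"
proof -
  have "nome (1/4) = exp (\<i> * of_real (pi / 2))" by (simp add: nome_def mult_ac)
  then show ?thesis by (simp only: flip: cis_conv_exp) simp
qed

abbreviation zeta12 :: complex where "zeta12 \<equiv> nome (1/12)"

lemma zeta12_powers: "zeta12 ^ 3 = \<i>" "zeta12 ^ 6 = -1"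
proof -
  show 3: "zeta12 ^ 3 = \<i>" using nome_quarter by (simp add: nome_power)
  have "zeta12 ^ 6 = (zeta12 ^ 3)\<^sup>2" by (simp flip: power_mult)
  then show "zeta12 ^ 6 = -1" using 3 by simp
qed

lemma zeta12_eq_imp:
  assumes "zeta12 ^ m = zeta12 ^ n"
  shows "m mod 12 = n mod 12"
proof -
  have "nome (of_nat m / 12) = nome (of_nat n / 12)" using assms by (simp add: nome_power)
  then obtain l :: int where l: "of_nat m / 12 = (of_nat n / 12 + of_int l :: complex)"
    by (rule nome_eq_imp)
  have "of_int (int m) = 12 * (of_nat m / 12 :: complex)" by simp
  also have "\<dots> = 12 * (of_nat n / 12 + of_int l)" by (simp only: l)
  also have "\<dots> = of_int (int n + 12 * l)" by simp
  finally have "int m = int n + 12 * l" by (simp only: of_int_eq_iff)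
  then have "int (m mod 12) = int (n mod 12)" by (simp add: zmod_int)
  then show ?thesis by (simp only: of_nat_eq_iff)
qed

text \<open>The numbers 9 and 6 are the exponents of -\<i> and -1 as powers of the 12th root of
  unity. The congruence says that a - b is 2 modulo 4.\<close>

lemma weight_difference:
  fixes a b :: nat
  assumes "a < 12" "b < 12" "(9 * b) mod 12 = (9 * a + 6) mod 12"
  shows "a = b + 2 \<or> b = a + 10 \<or> b = a + 2 \<or> a = b + 10 \<or> a = b + 6 \<or> b = a + 6"
proof -
  have "\<forall>a\<in>set [0..<12]. \<forall>b\<in>set [0..<12]. (9 * b) mod 12 = (9 * a + 6) mod 12 \<longrightarrow>
    a = b + 2 \<or> b = a + 10 \<or> b = a + 2 \<or> a = b + 10 \<or> a = b + 6 \<or> b = a + (6::nat)"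
    by code_simp
  with assms show ?thesis by simp
qed

lemma minus_i_power: "(- \<i>) ^ n = zeta12 ^ (9 * n)"
proof -
  have "zeta12 ^ 9 = (zeta12 ^ 3) ^ 3" by (simp flip: power_mult)
  also have "\<dots> = - \<i>" unfolding zeta12_powers by (simp add: power3_eq_cube)
  finally show ?thesis by (simp add: power_mult)
qed

section \<open>Relations between the images of S and T\<close>

definition cols2 :: "complex^2 \<Rightarrow> complex^2 \<Rightarrow> complex^2^2" where
  "cols2 u w = (\<chi> i j. if j = 1 then u $ i else w $ i)"

lemma cols2_vec: "cols2 u w *v v = v $ 1 *s u + v $ 2 *s w"
  by (simp add: cols2_def vec_eq_iff matrix_vector_mult_def sum_2 mult_ac)

lemma mult_cols2: "A ** cols2 u w = cols2 (A *v u) (A *v w)"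
  by (simp add: cols2_def vec_eq_iff matrix_matrix_mult_def matrix_vector_mult_def)

lemma cols2_mat2: "cols2 u w ** mat2 a b c d = cols2 (a *s u + c *s w) (b *s u + d *s w)"
  by (simp add: cols2_def vec_eq_iff forall_2 matrix_matrix_mult_def sum_2 mult_ac)

text \<open>\<open>A\<close> and \<open>B\<close> stand for the images of T and S in a basis whose
  first vector spans the subrepresentation. Equal characters force both upper right entries to
  vanish, so that this case splits.\<close>

lemma triangular_relations:
  fixes s s' y t :: complex and a b :: nat
  defines "A \<equiv> mat2 (zeta12 ^ a) t 0 (zeta12 ^ b)" and "B \<equiv> mat2 s y 0 s'"
  assumes B4: "B ** B ** (B ** B) = mat 1" and BA: "(B ** A) ** (B ** A) ** (B ** A) = B ** B"
    and ab: "a < 12" "b < 12" and t: "a \<noteq> b \<Longrightarrow> t = 0"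
  shows "s = (- \<i>) ^ a \<and> s' = (- \<i>) ^ b \<and>
    (y = 0 \<and> t = 0 \<or> y \<noteq> 0 \<and> t = 0 \<and> s' = - s \<and> (a = b + 2 \<or> b = a + 10 \<or> b = a + 2 \<or> a = b + 10))"
proof -
  define z z' where "z = zeta12 ^ a" and "z' = zeta12 ^ b"
  have nz: "z \<noteq> 0" "z' \<noteq> 0" by (simp_all add: z_def z'_def)
  have "(B ** B ** (B ** B)) $ 1 $ 1 = 1" "(B ** B ** (B ** B)) $ 2 $ 2 = 1" "(B ** B ** (B ** B)) $ 1 $ 2 = 0"
    unfolding B4 by (simp_all add: mat_def)
  then have s4: "s ^ 4 = 1" "s' ^ 4 = 1" and y4: "y * (s ^ 3 + s ^ 2 * s' + s * s' ^ 2 + s' ^ 3) = 0"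
    unfolding B_def mat2_mult by (simp_all add: algebra_simps eval_nat_numeral)
  have snz: "s \<noteq> 0" "s' \<noteq> 0" using s4 by auto
  have *: "((B ** A) ** (B ** A) ** (B ** A)) $ i $ j = (B ** B) $ i $ j" for i j using BA by simp
  have d1: "(s * z) ^ 3 = s\<^sup>2" using *[of 1 1] unfolding A_def B_def mat2_mult z_def[symmetric] z'_def[symmetric]
    by (simp add: eval_nat_numeral algebra_simps)
  have d2: "(s' * z') ^ 3 = s'\<^sup>2" using *[of 2 2] unfolding A_def B_def mat2_mult z_def[symmetric] z'_def[symmetric]
    by (simp add: eval_nat_numeral algebra_simps)
  have off: "(s * t + y * z') * ((s * z)\<^sup>2 + (s * z) * (s' * z') + (s' * z')\<^sup>2) = y * (s + s')"
    using *[of 1 2] unfolding A_def B_def mat2_mult z_def[symmetric] z'_def[symmetric]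
    by (simp add: eval_nat_numeral algebra_simps)
  \<comment> \<open>The hypothesis cancels to \<sigma> \<i>^n = 1, because the cube of
    \<open>zeta12\<close> is \<i>.\<close>
  have val: "\<sigma> = (- \<i>) ^ n" if "(\<sigma> * zeta12 ^ n) ^ 3 = \<sigma>\<^sup>2" "\<sigma> \<noteq> 0" for \<sigma> n
  proof -
    have "\<sigma>\<^sup>2 * (\<sigma> * (zeta12 ^ 3) ^ n) = \<sigma>\<^sup>2 * 1"
      using that(1) by (simp add: power_mult_distrib power2_eq_square power3_eq_cube flip: power_mult)
        (simp add: mult_ac)
    then have "\<sigma> * \<i> ^ n = 1" using that(2) unfolding zeta12_powers by simp
    moreover have "(- \<i>) ^ n * \<i> ^ n = 1" by (simp flip: power_mult_distrib)
    ultimately show ?thesis by (metis mult_cancel_right zero_neq_one mult_zero_right)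
  qed
  have s: "s = (- \<i>) ^ a" "s' = (- \<i>) ^ b"
    using val[of s a] val[of s' b] d1 d2 snz by (simp_all add: z_def z'_def)
  show ?thesis
  proof (cases "a = b")
    case True
    then have e: "s' = s" "z' = z" using s by (simp_all add: z_def z'_def)
    have "4 * s ^ 3 * y = 0" using y4 unfolding e by (simp add: algebra_simps eval_nat_numeral)
    then have y: "y = 0" using snz by simp
    have "3 * (s * z)\<^sup>2 * s * t = 0"
      using off unfolding e y by (simp add: algebra_simps power2_eq_square)
    then have "t = 0" using snz nz by simp
    with y s show ?thesis by blast
  next
    case False
    then have t0: "t = 0" by (rule t)
    show ?thesis
    proof (cases "y = 0")
      case False
      have "z \<noteq> z'"
        using zeta12_eq_imp[of a b] \<open>a \<noteq> b\<close> ab by (auto simp: z_def z'_def)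
      \<comment> \<open>The square of \<open>B\<close> is the cube of \<open>B ** A\<close>, hence
        commutes with \<open>B ** A\<close> and with \<open>B\<close>, and so with \<open>A\<close>.
        This is the upper right entry of that commutation.\<close>
      have comm: "y * (s + s') * (z' - z) = 0"
      proof -
        define C where "C = B ** A"
        have C: "C ** C ** C = B ** B" using BA by (simp add: C_def)
        then have "C ** (B ** B) = (B ** B) ** C" by (metis matrix_mul_assoc)
        moreover have "C ** (B ** B) = B ** (A ** (B ** B))" "(B ** B) ** C = B ** ((B ** B) ** A)"
          by (simp_all add: C_def matrix_mul_assoc)
        ultimately have "B ** (A ** (B ** B)) = B ** ((B ** B) ** A)" by simp
        then have "(B ** B ** B) ** (B ** (A ** (B ** B))) = (B ** B ** B) ** (B ** ((B ** B) ** A))" by simp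
        moreover have B3: "(B ** B ** B) ** (B ** X) = X" for X :: "complex^2^2"
          using B4 by (simp add: matrix_mul_assoc)
        ultimately have "A ** (B ** B) = (B ** B) ** A" unfolding B3 by simp
        then have "(A ** (B ** B)) $ 1 $ 2 = ((B ** B) ** A) $ 1 $ 2" by simp
        then show ?thesis
          unfolding A_def B_def mat2_mult z_def[symmetric] z'_def[symmetric] t0 by (simp add: algebra_simps)
      qed
      have s': "s' = - s"
      proof -
        have "s + s' = 0" using comm False \<open>z \<noteq> z'\<close> by simp
        then show ?thesis by (simp add: add_eq_0_iff)
      qed
      have "s\<^sup>2 * (z\<^sup>2 - z * z' + z'\<^sup>2) * (y * z') = 0"
        using off unfolding s' t0 by (simp add: algebra_simps power2_eq_square)
      \<comment> \<open>So z / z' is a primitive sixth root of unity. This excludes z = - z'; the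
        congruence modulo 4 comes from s' = - s.\<close>
      then have q: "z\<^sup>2 - z * z' + z'\<^sup>2 = 0" using snz nz False by simp
      have n6: "\<not> (a = b + 6 \<or> b = a + 6)"
      proof
        assume "a = b + 6 \<or> b = a + 6"
        then have "z = - z'" unfolding z_def z'_def using zeta12_powers(2) by (auto simp: power_add)
        with q nz show False by (simp add: power2_eq_square)
      qed
      have "zeta12 ^ (9 * b) = zeta12 ^ (9 * a + 6)"
        using s' unfolding s minus_i_power power_add zeta12_powers by simp
      then have "(9 * b) mod 12 = (9 * a + 6) mod 12" by (rule zeta12_eq_imp)
      then have "a = b + 2 \<or> b = a + 10 \<or> b = a + 2 \<or> a = b + 10"
        using weight_difference[OF ab] n6 by blast
      with False t0 s' s show ?thesis by blast
    qed (use s t0 in simp)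
  qed
qed

lemma SL2Z_relations:
  "S_mat ** S_mat ** (S_mat ** S_mat) = mat 1"
  "(S_mat ** T_mat) ** (S_mat ** T_mat) ** (S_mat ** T_mat) = S_mat ** S_mat"
  by (simp_all add: S_mat_def T_mat_eq mat2_mult vec_eq_iff forall_2 mat_def)

text \<open>A common eigenvector of S and T is one of the whole group, so w spans an invariant
  complement of the line of u.\<close>

lemma diagonal_decomposable:
  fixes \<rho> :: "int^2^2 \<Rightarrow> complex^2^2"
  assumes hom: "\<rho> \<in> hom SL2Z GL"
    and u: "\<And>\<gamma>. \<gamma> \<in> carrier SL2Z \<Longrightarrow> \<exists>c. \<rho> \<gamma> *v u = c *s u"
    and S: "\<rho> S_mat *v w = s *s w" and T: "\<rho> T_mat *v w = z *s w" "z \<noteq> 0"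
    and basis: "\<And>f g. f *s u + g *s w = 0 \<Longrightarrow> f = 0 \<and> g = 0" "\<And>v. \<exists>f g. v = f *s u + g *s w"
  shows "\<not> indecomposable \<rho>"
proof -
  define L where "L v = vec.span {v}" for v :: "complex^2"
  have L: "x \<in> L v \<longleftrightarrow> (\<exists>c. x = c *s v)" for x v
    by (auto simp: L_def vec.span_singleton)
  have w: "\<exists>c. \<rho> \<gamma> *v w = c *s w" if "\<gamma> \<in> carrier SL2Z" for \<gamma>
    using that
  proof (induction rule: SL2Z_induct)
    case one
    show ?case by (intro exI[of _ 1]) (simp add: hom_SL2Z_one[OF hom])
  next
    case (S \<gamma>)
    then obtain c where "\<rho> \<gamma> *v w = c *s w" by blast
    then have "\<rho> (S_mat ** \<gamma>) *v w = (c * s) *s w"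
      using hom_SL2Z_mult[OF hom generators_in_SL2Z(1) S(1)] assms(3)
      by (simp add: matrix_vector_mul_assoc[symmetric] vec.linear_scale[OF matrix_vector_mul_linear_gen])
    then show ?case by blast
  next
    case (T \<gamma>)
    then obtain c where "\<rho> \<gamma> *v w = c *s w" by blast
    then have "\<rho> (T_mat ** \<gamma>) *v w = (c * z) *s w"
      using hom_SL2Z_mult[OF hom generators_in_SL2Z(2) T(1)] assms(4)
      by (simp add: matrix_vector_mul_assoc[symmetric] vec.linear_scale[OF matrix_vector_mul_linear_gen])
    then show ?case by blast
  next
    case (T_inv \<gamma>)
    then obtain c where c: "\<rho> \<gamma> *v w = c *s w" by blast
    have "\<rho> T_inv_mat *v (\<rho> T_mat *v w) = w"
      using hom_T_inv(1)[OF hom] by (simp add: matrix_vector_mul_assoc)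
    then have "z *s (\<rho> T_inv_mat *v w) = w"
      by (simp add: T vec.linear_scale[OF matrix_vector_mul_linear_gen])
    then have "(1 / z) *s (z *s (\<rho> T_inv_mat *v w)) = (1 / z) *s w" by simp
    then have "\<rho> T_inv_mat *v w = (1 / z) *s w"
      unfolding vec.scale_scale using T(2) by simp
    then have "\<rho> (T_inv_mat ** \<gamma>) *v w = (c * (1 / z)) *s w"
      using hom_SL2Z_mult[OF hom generators_in_SL2Z(3) T_inv(1)] c
      by (simp add: matrix_vector_mul_assoc[symmetric] vec.linear_scale[OF matrix_vector_mul_linear_gen])
    then show ?case by blast
  qed
  have sub: "subrepresentation \<rho> (L v)" if v: "\<And>\<gamma>. \<gamma> \<in> carrier SL2Z \<Longrightarrow> \<exists>c. \<rho> \<gamma> *v v = c *s v" for v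
    unfolding subrepresentation_def
  proof (intro conjI ballI)
    show "vec.subspace (L v)"
      unfolding L_def by (rule vec.subspace_span)
    fix \<gamma> x assume \<gamma>: "\<gamma> \<in> carrier SL2Z" and x: "x \<in> L v"
    obtain c d where "\<rho> \<gamma> *v v = c *s v" "x = d *s v" using v[OF \<gamma>] x by (auto simp: L)
    then have "\<rho> \<gamma> *v x = (d * c) *s v"
      by (simp add: vec.linear_scale[OF matrix_vector_mul_linear_gen])
    then show "\<rho> \<gamma> *v x \<in> L v" unfolding L by blast
  qed
  have unz: "u \<noteq> 0" using basis(1)[of 1 0] by auto
  have wnz: "w \<noteq> 0" using basis(1)[of 0 1] by auto
  have mem: "v \<in> L v" for v by (simp add: L_def vec.span_base)
  have int0: "L u \<inter> L w = {0}"
  proof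
    show "L u \<inter> L w \<subseteq> {0}"
    proof
      fix v assume "v \<in> L u \<inter> L w"
      then obtain c d where cd: "v = c *s u" "v = d *s w" unfolding Int_iff L by blast
      then have "c *s u + (- d) *s w = 0" by (simp add: vec.scale_minus_left)
      then have "c = 0" using basis(1) by blast
      then show "v \<in> {0}" using cd by simp
    qed
    show "{0} \<subseteq> L u \<inter> L w" by (simp add: L_def vec.span_zero)
  qed
  have sum: "{u' + w' | u' w'. u' \<in> L u \<and> w' \<in> L w} = UNIV"
    using basis(2) unfolding L by blast
  have "L u \<noteq> {0}" "L w \<noteq> {0}" using mem[of u] mem[of w] unz wnz by auto
  then have "subrepresentation \<rho> (L u) \<and> subrepresentation \<rho> (L w) \<and> L u \<noteq> {0} \<and> L w \<noteq> {0} \<and>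
      L u \<inter> L w = {0} \<and> {u' + w' | u' w'. u' \<in> L u \<and> w' \<in> L w} = UNIV"
    by (intro conjI sub u w int0 sum)
  then show ?thesis unfolding indecomposable_def not_not 
    by - (rule exI[of _ "L u"], rule exI[of _ "L w"])
qed

lemma extension_normal_form:
  fixes a b :: nat and \<rho> :: "int^2^2 \<Rightarrow> complex^2^2"
  assumes ab: "a < 12" "b < 12" and \<alpha>: "is_chi a \<alpha>" and \<beta>: "is_chi b \<beta>"
    and hom: "\<rho> \<in> hom SL2Z GL" and indec: "indecomposable \<rho>" and ext: "is_extension \<alpha> \<rho> \<beta>"
  obtains P Q x where "P ** Q = mat 1" "Q ** P = mat 1"
    "\<rho> T_mat ** P = P ** mat2 (zeta12 ^ a) 0 0 (zeta12 ^ b)"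
    "\<rho> S_mat ** P = P ** mat2 ((- \<i>) ^ a) x 0 ((- \<i>) ^ b)"
    "x \<noteq> 0" "(- \<i>) ^ b = - ((- \<i>) ^ a)" "a = b + 2 \<or> b = a + 10 \<or> b = a + 2 \<or> a = b + 10"
proof -
  obtain \<iota> p where lin: "Vector_Spaces.linear (*) (*s) \<iota>" "Vector_Spaces.linear (*s) (*) p"
    and inj: "inj \<iota>" and surj: "surj p" and exact: "range \<iota> = {v. p v = 0}"
    and equ: "\<And>\<gamma> z. \<gamma> \<in> carrier SL2Z \<Longrightarrow> \<iota> (\<alpha> \<gamma> * z) = \<rho> \<gamma> *v \<iota> z"
      "\<And>\<gamma> v. \<gamma> \<in> carrier SL2Z \<Longrightarrow> p (\<rho> \<gamma> *v v) = \<beta> \<gamma> * p v"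
    using ext unfolding is_extension_def by (elim exE conjE) blast
  interpret \<iota>: Vector_Spaces.linear "(*)" "(*s)" \<iota> by (rule lin)
  interpret p: Vector_Spaces.linear "(*s)" "(*)" p by (rule lin)
  define u where "u = \<iota> 1"
  have \<iota>: "\<iota> z = z *s u" for z using \<iota>.scale[of z 1] by (simp add: u_def)
  have pu: "p u = 0" using exact by (auto simp: u_def)
  have u0: "u \<noteq> 0"
  proof
    assume "u = 0"
    then have "\<iota> 1 = \<iota> 0" by (simp add: u_def \<iota>.zero)
    from injD[OF inj this] show False by simp
  qed
  have ker: "\<exists>c. v = c *s u" if "p v = 0" for v
  proof -
    have "v \<in> range \<iota>" using that exact by simp
    then show ?thesis using \<iota> by auto
  qed
  have \<rho>u: "\<rho> \<gamma> *v u = \<alpha> \<gamma> *s u" if "\<gamma> \<in> carrier SL2Z" for \<gamma>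
    using equ(1)[OF that, of 1] by (simp add: \<iota>)
  have zeta: "\<alpha> T_mat = zeta12 ^ a" "\<beta> T_mat = zeta12 ^ b"
    using \<alpha> \<beta> by (simp_all add: is_chi_def nome_power) (simp_all add: nome_def)
  have \<rho>w: "\<exists>y. \<rho> \<gamma> *v w = y *s u + \<beta> \<gamma> *s w" if "\<gamma> \<in> carrier SL2Z" "p w = 1" for \<gamma> w
  proof -
    have "p (\<rho> \<gamma> *v w - \<beta> \<gamma> *s w) = 0"
      using equ(2)[OF that(1), of w] that(2) by (simp add: p.diff p.scale)
    then obtain y where "\<rho> \<gamma> *v w - \<beta> \<gamma> *s w = y *s u" using ker by blast
    then show ?thesis by (auto simp: algebra_simps)
  qed
  obtain w t where w: "p w = 1" "\<rho> T_mat *v w = t *s u + zeta12 ^ b *s w" "a \<noteq> b \<Longrightarrow> t = 0"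
  proof -
    obtain w0 where w0: "p w0 = 1" using surj by (metis surj_def)
    obtain t where t: "\<rho> T_mat *v w0 = t *s u + zeta12 ^ b *s w0"
      using \<rho>w[OF generators_in_SL2Z(2) w0] zeta by auto
    show ?thesis
    proof (cases "a = b")
      case True
      then show ?thesis using that[OF w0 t] by blast
    next
      case False
      \<comment> \<open>The preimage w0 of 1 is determined up to multiples of u. This multiple makes
        it an eigenvector of T, which is possible as the eigenvalues differ.\<close>
      define c where "c = t / (zeta12 ^ b - zeta12 ^ a)"
      have "zeta12 ^ b \<noteq> zeta12 ^ a" using zeta12_eq_imp[of b a] False ab by auto
      then have c: "t + c * zeta12 ^ a = zeta12 ^ b * c" by (simp add: c_def field_simps)
      have "p (w0 + c *s u) = 1" by (simp add: p.add p.scale pu w0)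
      moreover have "\<rho> T_mat *v (w0 + c *s u) = 0 *s u + zeta12 ^ b *s (w0 + c *s u)"
      proof -
        have "\<rho> T_mat *v (w0 + c *s u) = (t + c * zeta12 ^ a) *s u + zeta12 ^ b *s w0"
          using \<rho>u[OF generators_in_SL2Z(2)]
          by (simp add: t zeta matrix_vector_right_distrib vec.linear_scale[OF matrix_vector_mul_linear_gen]
              vec.scale_left_distrib)
        also have "\<dots> = 0 *s u + zeta12 ^ b *s (w0 + c *s u)"
          unfolding c by (simp add: vec.scale_right_distrib)
        finally show ?thesis .
      qed
      ultimately show ?thesis by (rule that) simp
    qed
  qed
  obtain y where y: "\<rho> S_mat *v w = y *s u + \<beta> S_mat *s w" using \<rho>w[OF generators_in_SL2Z(1) w(1)] by blast
  have basis1: "f = 0 \<and> g = 0" if "f *s u + g *s w = 0" for f g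
  proof -
    have "p (f *s u + g *s w) = 0" unfolding that by (rule p.zero)
    then have "g = 0" by (simp add: p.add p.scale pu w)
    then show ?thesis using that u0 by simp
  qed
  have basis2: "\<exists>f g. v = f *s u + g *s w" for v
  proof -
    have "p (v - p v *s w) = 0" by (simp add: p.diff p.scale w)
    then obtain c where "v - p v *s w = c *s u" using ker by blast
    then have "v = c *s u + p v *s w" by (simp add: algebra_simps)
    then show ?thesis by blast
  qed
  define M where "M = cols2 u w"
  have "v = 0" if "M *v v = 0" for v
  proof -
    have "v $ 1 = 0 \<and> v $ 2 = 0" by (rule basis1) (use that in \<open>simp only: M_def cols2_vec\<close>)
    then show ?thesis by (simp add: vec_eq_iff forall_2)
  qed
  then obtain Q where QM: "Q ** M = mat 1" using matrix_left_invertible_ker[of M] by blast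
  then have MQ: "M ** Q = mat 1" using matrix_left_right_inverse by blast
  define A B where "A = mat2 (zeta12 ^ a) t 0 (zeta12 ^ b)" and "B = mat2 (\<alpha> S_mat) y 0 (\<beta> S_mat)"
  have TM: "\<rho> T_mat ** M = M ** A" and SM: "\<rho> S_mat ** M = M ** B"
    using \<rho>u[OF generators_in_SL2Z(1)] \<rho>u[OF generators_in_SL2Z(2)] w y
    by (simp_all add: M_def A_def B_def mult_cols2 cols2_mat2 zeta)
  have cancel: "X = Y" if "M ** X = M ** Y" for X Y :: "complex^2^2"
    using arg_cong[OF that, of "\<lambda>X. Q ** X"] by (simp add: matrix_mul_assoc QM)
  have mult: "\<rho> (g ** h) ** M = M ** (X ** Y)"
    if "\<rho> g ** M = M ** X" "\<rho> h ** M = M ** Y" "g \<in> carrier SL2Z" "h \<in> carrier SL2Z" for g h X Y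
  proof -
    have "\<rho> (g ** h) ** M = \<rho> g ** (\<rho> h ** M)"
      by (simp add: hom_SL2Z_mult[OF hom that(3,4)] matrix_mul_assoc)
    also have "\<dots> = (\<rho> g ** M) ** Y" by (simp add: that(2) matrix_mul_assoc)
    finally show ?thesis by (simp add: that(1) matrix_mul_assoc)
  qed
  have "M ** (B ** B ** (B ** B)) = M ** mat 1"
  proof -
    have "\<rho> (S_mat ** S_mat ** (S_mat ** S_mat)) ** M = M ** (B ** B ** (B ** B))"
      by (intro mult SM) auto
    then show ?thesis by (simp add: SL2Z_relations hom_SL2Z_one[OF hom])
  qed
  then have B4: "B ** B ** (B ** B) = mat 1" by (rule cancel)
  have "M ** ((B ** A) ** (B ** A) ** (B ** A)) = M ** (B ** B)"
  proof -
    have "\<rho> ((S_mat ** T_mat) ** (S_mat ** T_mat) ** (S_mat ** T_mat)) ** M = M ** ((B ** A) ** (B ** A) ** (B ** A))"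
      by (intro mult SM TM) auto
    moreover have "\<rho> (S_mat ** S_mat) ** M = M ** (B ** B)" by (intro mult SM) auto
    ultimately show ?thesis by (simp add: SL2Z_relations)
  qed
  then have BA: "(B ** A) ** (B ** A) ** (B ** A) = B ** B" by (rule cancel)
  note rel = triangular_relations[OF B4[unfolded B_def] BA[unfolded A_def B_def] ab w(3)]
  have "\<not> (y = 0 \<and> t = 0)"
  proof
    assume "y = 0 \<and> t = 0"
    then have "\<rho> S_mat *v w = \<beta> S_mat *s w" "\<rho> T_mat *v w = zeta12 ^ b *s w"
      using y w by simp_all
    then have "\<not> indecomposable \<rho>"
      using \<rho>u by (intro diagonal_decomposable[OF hom _ _ _ _ basis1 basis2]) auto
    then show False using indec by blast
  qed
  with rel have *: "\<alpha> S_mat = (- \<i>) ^ a" "\<beta> S_mat = (- \<i>) ^ b" "y \<noteq> 0" "t = 0" "\<beta> S_mat = - \<alpha> S_mat"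
    "a = b + 2 \<or> b = a + 10 \<or> b = a + 2 \<or> a = b + 10" by blast+
  show ?thesis
    by (rule that[of M Q y]) (use MQ QM TM SM * in \<open>simp_all add: A_def B_def\<close>)
qed

section \<open>Vector-valued forms in coordinates\<close>

lemma mat_mult_vec: "(mat c ** A) *v v = c *s (A *v v)" for A :: "complex^'n^'n"
proof -
  have "mat c *v w = c *s w" for w :: "complex^'n"
    by (simp add: vec_eq_iff matrix_vector_mult_def mat_def if_distrib if_distribR cong: if_cong)
  then show ?thesis by (simp flip: matrix_vector_mul_assoc)
qed

lemma vector2_collapse [simp]: "vector [v $ 1, v $ 2] = (v :: 'a::zero^2)"
  by (simp add: vec_eq_iff forall_2)

locale normal_form =
  fixes \<rho> :: "int^2^2 \<Rightarrow> complex^2^2" and P Q :: "complex^2^2" and a b :: nat and x :: complex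
  assumes hom: "\<rho> \<in> hom SL2Z GL"
    and PQ: "P ** Q = mat 1" and QP: "Q ** P = mat 1"
    and T: "\<rho> T_mat ** P = P ** mat2 (zeta12 ^ a) 0 0 (zeta12 ^ b)"
    and S: "\<rho> S_mat ** P = P ** mat2 ((- \<i>) ^ a) x 0 ((- \<i>) ^ b)"
    and ab: "a < 12" "b < 12" "a \<noteq> b"
begin

definition V :: "complex \<Rightarrow> complex \<Rightarrow> complex^2" where "V f g = P *v vector [f, g]"

lemma Q_V: "Q *v V f g = vector [f, g]"
  by (simp add: V_def matrix_vector_mul_assoc QP)

lemma V_eq_iff: "V f g = V f' g' \<longleftrightarrow> f = f' \<and> g = g'"
proof
  assume "V f g = V f' g'"
  then have "vector [f, g] = (vector [f', g'] :: complex^2)" by (metis Q_V)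
  then show "f = f' \<and> g = g'" by (metis vector_2)
qed simp

lemma V_cases: obtains f g where "v = V f g"
proof
  show "v = V ((Q *v v) $ 1) ((Q *v v) $ 2)"
    by (simp add: V_def matrix_vector_mul_assoc PQ)
qed

lemma V_add: "V f g + V f' g' = V (f + f') (g + g')"
proof -
  have "vector [f, g] + vector [f', g'] = (vector [f + f', g + g'] :: complex^2)"
    by (simp add: vec_eq_iff forall_2)
  then show ?thesis by (simp add: V_def flip: matrix_vector_right_distrib)
qed

lemma V_scale: "c *s V f g = V (c * f) (c * g)"
proof -
  have "c *s vector [f, g] = (vector [c * f, c * g] :: complex^2)"
    by (simp add: vec_eq_iff forall_2)
  then show ?thesis by (simp add: V_def flip: vec.linear_scale[OF matrix_vector_mul_linear_gen])
qed

lemma V_0: "V 0 0 = 0"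
  using V_scale[of 0 0 0] by simp

lemma \<rho>_T: "\<rho> T_mat *v V f g = V (zeta12 ^ a * f) (zeta12 ^ b * g)"
  by (simp add: V_def matrix_vector_mul_assoc T) (simp add: mat2_vec flip: matrix_vector_mul_assoc)

lemma \<rho>_S: "\<rho> S_mat *v V f g = V ((- \<i>) ^ a * f + x * g) ((- \<i>) ^ b * g)"
  by (simp add: V_def matrix_vector_mul_assoc S) (simp add: mat2_vec flip: matrix_vector_mul_assoc)

lemma matrix_eqI:
  assumes "X *v V 1 0 = Y *v V 1 0" "X *v V 0 1 = Y *v V 0 1"
  shows "X = Y"
proof -
  have "X *v v = Y *v v" for v
  proof -
    obtain f g where v: "v = V f g" by (rule V_cases)
    have "v = f *s V 1 0 + g *s V 0 1" by (simp add: v V_scale V_add)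
    then show ?thesis
      by (simp add: matrix_vector_right_distrib vec.linear_scale[OF matrix_vector_mul_linear_gen] assms)
  qed
  then show ?thesis by (simp add: matrix_eq)
qed

lemma zeta12_ab: "zeta12 ^ a \<noteq> zeta12 ^ b"
  using zeta12_eq_imp[of a b] ab by auto

lemma nome_div_12: "nome (of_nat n / 12) = zeta12 ^ n"
  by (simp add: nome_power)

text \<open>An exponent matrix commutes with \<open>\<rho>(T)\<close>, which has distinct eigenvalues; so it is diagonal in the
  same basis.\<close>

lemma exponent_matrix_V: "exponent_matrix \<rho> *v V f g = V (of_nat a / 12 * f) (of_nat b / 12 * g)"
proof -
  define c where "c = 2 * of_real pi * \<i>"
  have c: "c \<noteq> 0" by (simp add: c_def)
  have nome_c: "exp (c * l) = nome l" for l by (simp add: nome_def c_def)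
  define L where "L = P ** mat2 (of_nat a / 12) 0 0 (of_nat b / 12) ** Q"
  have L: "L *v V f g = V (of_nat a / 12 * f) (of_nat b / 12 * g)" for f g
    by (simp add: L_def Q_V flip: matrix_vector_mul_assoc) (simp add: mat2_vec V_def)
  have "exponent_matrix \<rho> = L"
    unfolding exponent_matrix_def c_def[symmetric]
  proof (rule the_equality, intro conjI allI impI)
    show "matrix_exp (mat c ** L) = \<rho> T_mat"
    proof (rule matrix_eqI)
      have "(mat c ** L) *v V 1 0 = (c * (of_nat a / 12)) *s V 1 0"
        by (simp add: mat_mult_vec L V_scale)
      from matrix_exp_eigenvector[OF this]
      show "matrix_exp (mat c ** L) *v V 1 0 = \<rho> T_mat *v V 1 0"
        by (simp only: nome_c nome_div_12 \<rho>_T V_scale) simp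
      have "(mat c ** L) *v V 0 1 = (c * (of_nat b / 12)) *s V 0 1"
        by (simp add: mat_mult_vec L V_scale)
      from matrix_exp_eigenvector[OF this]
      show "matrix_exp (mat c ** L) *v V 0 1 = \<rho> T_mat *v V 0 1"
        by (simp only: nome_c nome_div_12 \<rho>_T V_scale) simp
    qed
    fix l assume "matrix_eigenvalue L l"
    then obtain v where v: "v \<noteq> 0" "L *v v = l *s v" by (auto simp: matrix_eigenvalue_def)
    obtain f g where fg: "v = V f g" by (rule V_cases)
    have "f \<noteq> 0 \<or> g \<noteq> 0" using v(1) V_0 by (auto simp: fg)
    moreover have "of_nat a / 12 * f = l * f" "of_nat b / 12 * g = l * g"
      using v(2) unfolding fg L V_scale V_eq_iff by auto
    ultimately have "l = of_nat a / 12 \<or> l = of_nat b / 12" by (metis mult_cancel_right)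
    moreover have "Re (of_nat n / 12) = real n / 12" for n by simp
    ultimately have "Re l = real a / 12 \<or> Re l = real b / 12" by metis
    then show "0 \<le> Re l" "Re l < 1" using ab(1,2) by linarith+
  next
    fix L' assume L': "matrix_exp (mat c ** L') = \<rho> T_mat \<and> (\<forall>l. matrix_eigenvalue L' l \<longrightarrow> 0 \<le> Re l \<and> Re l < 1)"
    define A where "A = mat c ** L'"
    have comm: "\<rho> T_mat ** A = A ** \<rho> T_mat" using matrix_exp_commute[of A] L' by (simp add: A_def)
    \<comment> \<open>The eigenvalue h / c has the same nome as n / 12, so they differ by an
      integer; real parts in [0, 1) make this integer 0.\<close>
    have eig: "L' *v v = (of_nat n / 12) *s v"
      if v: "v \<noteq> 0" "A *v v = h *s v" "\<rho> T_mat *v v = zeta12 ^ n *s v" "n < 12" for v h n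
    proof -
      have cl: "c *s (L' *v v) = h *s v" using v(2) by (simp add: A_def mat_mult_vec)
      have "(1 / c) *s (c *s (L' *v v)) = (1 / c) *s (h *s v)" by (simp only: cl)
      then have l: "L' *v v = (h / c) *s v" unfolding vec.scale_scale using c by simp
      then have Re: "0 \<le> Re (h / c)" "Re (h / c) < 1"
        using L' v(1) by (auto simp: matrix_eigenvalue_def)
      have "matrix_exp A *v v = zeta12 ^ n *s v" using L' v(3) by (simp add: A_def)
      then have "exp h *s v = zeta12 ^ n *s v" unfolding matrix_exp_eigenvector[OF v(2)] .
      then have "exp h = zeta12 ^ n" using v(1) by (simp add: vec.scale_cancel_right)
      then have "nome (h / c) = nome (of_nat n / 12)"
        using c nome_c[of "h / c"] by (simp add: nome_div_12)
      then obtain m :: int where m: "h / c = of_nat n / 12 + of_int m" by (rule nome_eq_imp)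
      have "Re (h / c) = real n / 12 + real_of_int m" unfolding m by simp
      then have "m = 0" using Re v(4) by linarith
      then show ?thesis using l m by simp
    qed
    have A1: "\<exists>h. A *v V 1 0 = h *s V 1 0"
    proof -
      obtain f g where fg: "A *v V 1 0 = V f g" by (rule V_cases)
      have "\<rho> T_mat *v (A *v V 1 0) = A *v (\<rho> T_mat *v V 1 0)"
        by (simp add: matrix_vector_mul_assoc comm)
      also have "\<rho> T_mat *v V 1 0 = zeta12 ^ a *s V 1 0" by (simp add: \<rho>_T V_scale)
      finally have "\<rho> T_mat *v V f g = zeta12 ^ a *s V f g"
        by (simp add: fg vec.linear_scale[OF matrix_vector_mul_linear_gen])
      then have "zeta12 ^ b * g = zeta12 ^ a * g" unfolding \<rho>_T V_scale V_eq_iff by blast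
      then have "g = 0" using zeta12_ab by simp
      then have "A *v V 1 0 = f *s V 1 0" using fg by (simp add: V_scale)
      then show ?thesis by blast
    qed
    have A2: "\<exists>h. A *v V 0 1 = h *s V 0 1"
    proof -
      obtain f g where fg: "A *v V 0 1 = V f g" by (rule V_cases)
      have "\<rho> T_mat *v (A *v V 0 1) = A *v (\<rho> T_mat *v V 0 1)"
        by (simp add: matrix_vector_mul_assoc comm)
      also have "\<rho> T_mat *v V 0 1 = zeta12 ^ b *s V 0 1" by (simp add: \<rho>_T V_scale)
      finally have "\<rho> T_mat *v V f g = zeta12 ^ b *s V f g"
        by (simp add: fg vec.linear_scale[OF matrix_vector_mul_linear_gen])
      then have "zeta12 ^ a * f = zeta12 ^ b * f" unfolding \<rho>_T V_scale V_eq_iff by blast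
      then have "f = 0" using zeta12_ab by simp
      then have "A *v V 0 1 = g *s V 0 1" using fg by (simp add: V_scale)
      then show ?thesis by blast
    qed
    have nz: "V 1 0 \<noteq> 0" "V 0 1 \<noteq> 0" unfolding V_0[symmetric] V_eq_iff by auto
    show "L' = L"
    proof (rule matrix_eqI)
      obtain h where h: "A *v V 1 0 = h *s V 1 0" using A1 by blast
      show "L' *v V 1 0 = L *v V 1 0"
        unfolding eig[OF nz(1) h, of a, OF _ ab(1), unfolded \<rho>_T V_scale, simplified] L by simp
      obtain h where h: "A *v V 0 1 = h *s V 0 1" using A2 by blast
      show "L' *v V 0 1 = L *v V 0 1"
        unfolding eig[OF nz(2) h, of b, OF _ ab(2), unfolded \<rho>_T V_scale, simplified] L by simp
    qed
  qed
  then show ?thesis by (simp add: L)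
qed

lemma exp_exponent_matrix_V:
  "matrix_exp (mat (- 2 * of_real pi * \<i> * \<tau>) ** exponent_matrix \<rho>) *v V f g =
     V (f / nome (\<tau> / 12) ^ a) (g / nome (\<tau> / 12) ^ b)"
proof -
  define c where "c = - 2 * of_real pi * \<i> * \<tau>"
  define X where "X = mat c ** exponent_matrix \<rho>"
  have e: "exp (c * (of_nat n / 12)) = 1 / nome (\<tau> / 12) ^ n" for n
  proof -
    have "exp (c * (of_nat n / 12)) * nome (\<tau> / 12) ^ n =
        exp (c * (of_nat n / 12) + 2 * of_real pi * \<i> * (of_nat n * (\<tau> / 12)))"
      unfolding nome_power by (simp only: nome_def exp_add)
    also have "c * (of_nat n / 12) + 2 * of_real pi * \<i> * (of_nat n * (\<tau> / 12)) = 0"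
      by (simp add: c_def)
    finally have "exp (c * (of_nat n / 12)) * nome (\<tau> / 12) ^ n = 1" by simp
    then show ?thesis by (simp add: field_simps)
  qed
  have "X *v V 1 0 = (c * (of_nat a / 12)) *s V 1 0" "X *v V 0 1 = (c * (of_nat b / 12)) *s V 0 1"
    by (simp_all add: X_def mat_mult_vec exponent_matrix_V V_scale)
  then have X: "matrix_exp X *v V 1 0 = (1 / nome (\<tau> / 12) ^ a) *s V 1 0"
    "matrix_exp X *v V 0 1 = (1 / nome (\<tau> / 12) ^ b) *s V 0 1"
    by (simp_all only: matrix_exp_eigenvector e)
  have "V f g = f *s V 1 0 + g *s V 0 1" by (simp add: V_scale V_add)
  then have "matrix_exp X *v V f g = f *s (matrix_exp X *v V 1 0) + g *s (matrix_exp X *v V 0 1)"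
    by (simp add: matrix_vector_right_distrib vec.linear_scale[OF matrix_vector_mul_linear_gen])
  also have "\<dots> = V (f / nome (\<tau> / 12) ^ a) (g / nome (\<tau> / 12) ^ b)"
    unfolding X by (simp add: V_scale V_add)
  finally show ?thesis by (simp only: X_def c_def)
qed

text \<open>The powers of exp(2 pi i \<tau> / 12) carry the action of T and are what the exponent
  matrix strips off. So the condition at the cusp becomes holomorphy of \<phi> and \<psi> on the
  whole disc.\<close>

definition vform :: "(complex \<Rightarrow> complex) \<Rightarrow> (complex \<Rightarrow> complex) \<Rightarrow> complex \<Rightarrow> complex^2" where
  "vform \<phi> \<psi> \<tau> = (if Im \<tau> > 0
     then V (nome (\<tau> / 12) ^ a * \<phi> (nome \<tau>)) (nome (\<tau> / 12) ^ b * \<psi> (nome \<tau>)) else 0)"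

section \<open>Modular forms as pairs of functions of q\<close>

lemma matrix_vec_holomorphic:
  fixes A :: "complex^2^2" and f :: "complex \<Rightarrow> complex^2"
  assumes "\<And>i. (\<lambda>z. f z $ i) holomorphic_on D"
  shows "(\<lambda>z. (A *v f z) $ i) holomorphic_on D"
  unfolding matrix_vector_mult_def by (simp add: sum_2) (intro holomorphic_intros assms)

lemma vform_modular:
  assumes hol: "\<phi> holomorphic_on ball 0 1" "\<psi> holomorphic_on ball 0 1"
    and S1: "\<And>\<tau>. Im \<tau> > 0 \<Longrightarrow> nome (-1 / \<tau> / 12) ^ a * \<phi> (nome (-1 / \<tau>)) =
      \<tau> powi k * ((- \<i>) ^ a * (nome (\<tau> / 12) ^ a * \<phi> (nome \<tau>)) + x * (nome (\<tau> / 12) ^ b * \<psi> (nome \<tau>)))"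
    and S2: "\<And>\<tau>. Im \<tau> > 0 \<Longrightarrow> nome (-1 / \<tau> / 12) ^ b * \<psi> (nome (-1 / \<tau>)) =
      \<tau> powi k * ((- \<i>) ^ b * (nome (\<tau> / 12) ^ b * \<psi> (nome \<tau>)))"
  shows "vform \<phi> \<psi> \<in> modular_forms \<rho> k"
  unfolding modular_forms_def
proof (intro CollectI conjI ballI allI impI)
  have holH: "(\<lambda>\<tau>. \<phi> (nome \<tau>)) holomorphic_on upper_half_plane" "(\<lambda>\<tau>. \<psi> (nome \<tau>)) holomorphic_on upper_half_plane"
    by (rule holomorphic_on_compose_gen[OF _ hol(1), unfolded o_def] holomorphic_on_compose_gen[OF _ hol(2), unfolded o_def],
        intro holomorphic_intros, force simp: upper_half_plane_def)+
  have comp: "(\<lambda>\<tau>. vector [f \<tau>, g \<tau>] $ j) holomorphic_on D"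
    if "f holomorphic_on D" "g holomorphic_on D" for f g :: "complex \<Rightarrow> complex" and j :: 2 and D
    using that exhaust_2[of j] by auto
  show "(\<lambda>\<tau>. vform \<phi> \<psi> \<tau> $ i) holomorphic_on upper_half_plane" for i
  proof (rule holomorphic_transform)
    show "(\<lambda>\<tau>. V (nome (\<tau> / 12) ^ a * \<phi> (nome \<tau>)) (nome (\<tau> / 12) ^ b * \<psi> (nome \<tau>)) $ i) holomorphic_on upper_half_plane"
      unfolding V_def by (intro matrix_vec_holomorphic comp holomorphic_intros holH) auto
  qed (simp add: vform_def upper_half_plane_def)
  show "vform \<phi> \<psi> \<tau> = 0" if "\<tau> \<notin> upper_half_plane" for \<tau>
    using that by (simp add: vform_def upper_half_plane_def)
  show "vform \<phi> \<psi> (moebius \<gamma> \<tau>) = (aut_factor \<gamma> \<tau> powi k) *s (\<rho> \<gamma> *v vform \<phi> \<psi> \<tau>)"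
    if "\<gamma> \<in> carrier SL2Z" "\<tau> \<in> upper_half_plane" for \<gamma> \<tau>
  proof (rule modular_transformation_generators[OF hom _ _ that(1)])
    fix \<tau> :: complex assume \<tau>: "Im \<tau> > 0"
    have "nome ((\<tau> + 1) / 12) = zeta12 * nome (\<tau> / 12)"
      by (simp add: nome_def add_divide_distrib ring_distribs exp_add)
    then show "vform \<phi> \<psi> (\<tau> + 1) = \<rho> T_mat *v vform \<phi> \<psi> \<tau>"
      using \<tau> by (simp add: vform_def \<rho>_T power_mult_distrib mult_ac)
    show "vform \<phi> \<psi> (-1 / \<tau>) = (\<tau> powi k) *s (\<rho> S_mat *v vform \<phi> \<psi> \<tau>)"
      unfolding vform_def if_P[OF \<tau>] if_P[OF minus_inverse_upper_half_plane[OF \<tau>]] \<rho>_S V_scale S1[OF \<tau>] S2[OF \<tau>] ..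
  qed (use that in \<open>simp add: upper_half_plane_def\<close>)
  show "\<exists>G. (\<forall>i. (\<lambda>q. G q $ i) holomorphic_on ball 0 1) \<and>
    (\<forall>\<tau>\<in>upper_half_plane. matrix_exp (mat (- 2 * of_real pi * \<i> * \<tau>) ** exponent_matrix \<rho>) *v vform \<phi> \<psi> \<tau> =
        G (exp (2 * of_real pi * \<i> * \<tau>)))"
  proof (intro exI[of _ "\<lambda>q. V (\<phi> q) (\<psi> q)"] conjI allI ballI)
    show "(\<lambda>q. V (\<phi> q) (\<psi> q) $ i) holomorphic_on ball 0 1" for i
      unfolding V_def by (intro matrix_vec_holomorphic comp hol)
    show "matrix_exp (mat (- 2 * of_real pi * \<i> * \<tau>) ** exponent_matrix \<rho>) *v vform \<phi> \<psi> \<tau> =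
        V (\<phi> (exp (2 * of_real pi * \<i> * \<tau>))) (\<psi> (exp (2 * of_real pi * \<i> * \<tau>)))"
      if "\<tau> \<in> upper_half_plane" for \<tau>
    proof -
      have \<tau>: "Im \<tau> > 0" using that by (simp add: upper_half_plane_def)
      show ?thesis
        unfolding vform_def if_P[OF \<tau>] exp_exponent_matrix_V nome_def[symmetric] by simp
    qed
  qed
qed

lemma modular_formE:
  assumes F: "F \<in> modular_forms \<rho> k"
  obtains \<phi> \<psi> where "\<phi> holomorphic_on ball 0 1" "\<psi> holomorphic_on ball 0 1" "F = vform \<phi> \<psi>"
    "\<And>\<tau>. Im \<tau> > 0 \<Longrightarrow> nome (-1 / \<tau> / 12) ^ a * \<phi> (nome (-1 / \<tau>)) =
      \<tau> powi k * ((- \<i>) ^ a * (nome (\<tau> / 12) ^ a * \<phi> (nome \<tau>)) + x * (nome (\<tau> / 12) ^ b * \<psi> (nome \<tau>)))"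
    "\<And>\<tau>. Im \<tau> > 0 \<Longrightarrow> nome (-1 / \<tau> / 12) ^ b * \<psi> (nome (-1 / \<tau>)) =
      \<tau> powi k * ((- \<i>) ^ b * (nome (\<tau> / 12) ^ b * \<psi> (nome \<tau>)))"
proof -
  obtain G :: "complex \<Rightarrow> complex^2" where G: "\<And>i. (\<lambda>q. G q $ i) holomorphic_on ball 0 1"
    "\<And>\<tau>. Im \<tau> > 0 \<Longrightarrow> matrix_exp (mat (- 2 * of_real pi * \<i> * \<tau>) ** exponent_matrix \<rho>) *v F \<tau> = G (nome \<tau>)"
    using F unfolding modular_forms_def upper_half_plane_def nome_def by blast
  have F0: "F \<tau> = 0" if "\<not> Im \<tau> > 0" for \<tau>
    using F that by (simp add: modular_forms_def upper_half_plane_def)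
  have FS: "F (-1 / \<tau>) = (\<tau> powi k) *s (\<rho> S_mat *v F \<tau>)" if "Im \<tau> > 0" for \<tau>
  proof -
    have "F (moebius S_mat \<tau>) = (aut_factor S_mat \<tau> powi k) *s (\<rho> S_mat *v F \<tau>)"
      using F that generators_in_SL2Z(1) unfolding modular_forms_def upper_half_plane_def by blast
    then show ?thesis by (simp only: moebius_S)
  qed
  define \<phi> \<psi> where "\<phi> q = (Q *v G q) $ 1" and "\<psi> q = (Q *v G q) $ 2" for q
  have hol: "\<phi> holomorphic_on ball 0 1" "\<psi> holomorphic_on ball 0 1"
    unfolding \<phi>_def \<psi>_def by (intro matrix_vec_holomorphic G)+
  have Fv: "F \<tau> = V (nome (\<tau> / 12) ^ a * \<phi> (nome \<tau>)) (nome (\<tau> / 12) ^ b * \<psi> (nome \<tau>))" if "Im \<tau> > 0" for \<tau>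
  proof -
    obtain f g where fg: "F \<tau> = V f g" by (rule V_cases)
    have "G (nome \<tau>) = V (f / nome (\<tau> / 12) ^ a) (g / nome (\<tau> / 12) ^ b)"
      using G(2)[OF that] unfolding fg exp_exponent_matrix_V by simp
    then have "\<phi> (nome \<tau>) = f / nome (\<tau> / 12) ^ a" "\<psi> (nome \<tau>) = g / nome (\<tau> / 12) ^ b"
      by (simp_all add: \<phi>_def \<psi>_def Q_V)
    then show ?thesis by (simp add: fg)
  qed
  have "F = vform \<phi> \<psi>" by (rule ext) (simp add: vform_def Fv F0)
  moreover have S: "nome (-1 / \<tau> / 12) ^ a * \<phi> (nome (-1 / \<tau>)) =
      \<tau> powi k * ((- \<i>) ^ a * (nome (\<tau> / 12) ^ a * \<phi> (nome \<tau>)) + x * (nome (\<tau> / 12) ^ b * \<psi> (nome \<tau>))) \<and>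
      nome (-1 / \<tau> / 12) ^ b * \<psi> (nome (-1 / \<tau>)) =
      \<tau> powi k * ((- \<i>) ^ b * (nome (\<tau> / 12) ^ b * \<psi> (nome \<tau>)))" if \<tau>: "Im \<tau> > 0" for \<tau>
    using FS[OF \<tau>] unfolding Fv[OF \<tau>] Fv[OF minus_inverse_upper_half_plane[OF \<tau>]] \<rho>_S V_scale V_eq_iff .
  ultimately show ?thesis using that[of \<phi> \<psi>] hol by blast
qed

end

section \<open>Uniqueness of the generating weights\<close>

lemma aut_factor_nonzero:
  assumes "\<gamma> \<in> carrier SL2Z" "Im \<tau> > 0"
  shows "aut_factor \<gamma> \<tau> \<noteq> 0"
proof
  assume *: "aut_factor \<gamma> \<tau> = 0"
  then have "Im (aut_factor \<gamma> \<tau>) = 0" by simp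
  then have c: "\<gamma> $ 2 $ 1 = 0" using assms(2) by (simp add: aut_factor_def)
  with * have "\<gamma> $ 2 $ 2 = 0" by (simp add: aut_factor_def)
  with c show False using assms(1) by (simp add: carrier_SL2Z det_2)
qed

lemma modular_q_transformation:
  assumes \<phi>: "modular_q k \<phi>" and \<gamma>: "\<gamma> \<in> carrier SL2Z" and \<tau>: "Im \<tau> > 0"
  shows "\<phi> (nome (moebius \<gamma> \<tau>)) = aut_factor \<gamma> \<tau> powi k * \<phi> (nome \<tau>)"
proof -
  \<comment> \<open>A scalar form is a form for the trivial representation of dimension 1, to which
    the reduction to generators applies.\<close>
  define F where "F \<tau> = (\<chi> i. \<phi> (nome \<tau>) :: complex^1)" for \<tau>
  have hom: "(\<lambda>_. mat 1 :: complex^1^1) \<in> hom SL2Z GL"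
    by (auto simp: hom_def GL_def invertible_def intro!: exI[of _ "mat 1"])
  have "F (moebius \<gamma> \<tau>) = (aut_factor \<gamma> \<tau> powi k) *s (mat 1 *v F \<tau>)"
    by (rule modular_transformation_generators[OF hom _ _ \<gamma> \<tau>])
       (use modular_q_S[OF \<phi>] in \<open>simp_all only: F_def vec_eq_iff nome_add_1 matrix_vector_mul_lid vec_lambda_beta vector_smult_component simp_thms\<close>)
  then show ?thesis by (simp add: F_def vec_eq_iff)
qed

lemma modular_forms_mult:
  fixes \<rho> :: "int^2^2 \<Rightarrow> complex^'n^'n"
  assumes F: "F \<in> modular_forms \<rho> k" and \<phi>: "modular_q l \<phi>" and m: "m = k + l"
  shows "(\<lambda>\<tau>. \<phi> (nome \<tau>) *s F \<tau>) \<in> modular_forms \<rho> m"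
  unfolding modular_forms_def
proof (intro CollectI conjI allI impI ballI)
  obtain G :: "complex \<Rightarrow> complex^'n" where G: "\<And>i. (\<lambda>q. G q $ i) holomorphic_on ball 0 1"
    "\<And>\<tau>. \<tau> \<in> upper_half_plane \<Longrightarrow> matrix_exp (mat (- 2 * of_real pi * \<i> * \<tau>) ** exponent_matrix \<rho>) *v F \<tau> =
       G (exp (2 * of_real pi * \<i> * \<tau>))"
    using F unfolding modular_forms_def by blast
  have hol: "(\<lambda>\<tau>. \<phi> (nome \<tau>)) holomorphic_on upper_half_plane"
    by (rule holomorphic_on_compose_gen[OF _ modular_q_holomorphic[OF \<phi>], unfolded o_def],
        intro holomorphic_intros, force simp: upper_half_plane_def)
  have "(\<lambda>\<tau>. F \<tau> $ i) holomorphic_on upper_half_plane" for i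
    using F by (simp add: modular_forms_def)
  then show "(\<lambda>\<tau>. (\<phi> (nome \<tau>) *s F \<tau>) $ i) holomorphic_on upper_half_plane" for i
    using hol by (simp add: holomorphic_on_mult)
  show "\<phi> (nome \<tau>) *s F \<tau> = 0" if "\<tau> \<notin> upper_half_plane" for \<tau>
    using F that by (simp add: modular_forms_def)
  show "\<phi> (nome (moebius \<gamma> \<tau>)) *s F (moebius \<gamma> \<tau>) = (aut_factor \<gamma> \<tau> powi m) *s (\<rho> \<gamma> *v (\<phi> (nome \<tau>) *s F \<tau>))"
    if \<gamma>: "\<gamma> \<in> carrier SL2Z" and "\<tau> \<in> upper_half_plane" for \<gamma> \<tau>
  proof -
    have \<tau>: "Im \<tau> > 0" using that by (simp add: upper_half_plane_def)
    have "F (moebius \<gamma> \<tau>) = (aut_factor \<gamma> \<tau> powi k) *s (\<rho> \<gamma> *v F \<tau>)"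
      using F that by (simp add: modular_forms_def)
    then show ?thesis
      unfolding modular_q_transformation[OF \<phi> \<gamma> \<tau>] m
      using aut_factor_nonzero[OF \<gamma> \<tau>]
      by (simp add: power_int_add vec.linear_scale[OF matrix_vector_mul_linear_gen] mult_ac)
  qed
  show "\<exists>G. (\<forall>i. (\<lambda>q. G q $ i) holomorphic_on ball 0 1) \<and>
    (\<forall>\<tau>\<in>upper_half_plane. matrix_exp (mat (- 2 * of_real pi * \<i> * \<tau>) ** exponent_matrix \<rho>) *v (\<phi> (nome \<tau>) *s F \<tau>) =
        G (exp (2 * of_real pi * \<i> * \<tau>)))"
  proof (intro exI[of _ "\<lambda>q. \<phi> q *s G q"] conjI allI ballI)
    show "(\<lambda>q. (\<phi> q *s G q) $ i) holomorphic_on ball 0 1" for i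
      using holomorphic_on_mult[OF modular_q_holomorphic[OF \<phi>] G(1)] by simp
    show "matrix_exp (mat (- 2 * of_real pi * \<i> * \<tau>) ** exponent_matrix \<rho>) *v (\<phi> (nome \<tau>) *s F \<tau>) =
        \<phi> (exp (2 * of_real pi * \<i> * \<tau>)) *s G (exp (2 * of_real pi * \<i> * \<tau>))"
      if "\<tau> \<in> upper_half_plane" for \<tau>
      using G(2)[OF that] by (simp add: vec.linear_scale[OF matrix_vector_mul_linear_gen] nome_def)
  qed
qed

lemma modular_forms_add:
  fixes \<rho> :: "int^2^2 \<Rightarrow> complex^'n^'n"
  assumes F: "F \<in> modular_forms \<rho> k" and F': "F' \<in> modular_forms \<rho> k"
  shows "(\<lambda>\<tau>. F \<tau> + F' \<tau>) \<in> modular_forms \<rho> k"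
  unfolding modular_forms_def
proof (intro CollectI conjI allI impI ballI)
  obtain G :: "complex \<Rightarrow> complex^'n" where G: "\<And>i. (\<lambda>q. G q $ i) holomorphic_on ball 0 1"
    "\<And>\<tau>. \<tau> \<in> upper_half_plane \<Longrightarrow> matrix_exp (mat (- 2 * of_real pi * \<i> * \<tau>) ** exponent_matrix \<rho>) *v F \<tau> =
       G (exp (2 * of_real pi * \<i> * \<tau>))"
    using F unfolding modular_forms_def by blast
  obtain G' :: "complex \<Rightarrow> complex^'n" where G': "\<And>i. (\<lambda>q. G' q $ i) holomorphic_on ball 0 1"
    "\<And>\<tau>. \<tau> \<in> upper_half_plane \<Longrightarrow> matrix_exp (mat (- 2 * of_real pi * \<i> * \<tau>) ** exponent_matrix \<rho>) *v F' \<tau> =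
       G' (exp (2 * of_real pi * \<i> * \<tau>))"
    using F' unfolding modular_forms_def by blast
  have "(\<lambda>\<tau>. F \<tau> $ i) holomorphic_on upper_half_plane" "(\<lambda>\<tau>. F' \<tau> $ i) holomorphic_on upper_half_plane" for i
    using F F' by (simp_all add: modular_forms_def)
  then show "(\<lambda>\<tau>. (F \<tau> + F' \<tau>) $ i) holomorphic_on upper_half_plane" for i
    by (simp add: holomorphic_on_add)
  show "F \<tau> + F' \<tau> = 0" if "\<tau> \<notin> upper_half_plane" for \<tau>
    using F F' that by (simp add: modular_forms_def)
  show "F (moebius \<gamma> \<tau>) + F' (moebius \<gamma> \<tau>) = (aut_factor \<gamma> \<tau> powi k) *s (\<rho> \<gamma> *v (F \<tau> + F' \<tau>))"
    if "\<gamma> \<in> carrier SL2Z" and "\<tau> \<in> upper_half_plane" for \<gamma> \<tau>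
    using F F' that by (simp add: modular_forms_def matrix_vector_right_distrib vec.scale_right_distrib)
  show "\<exists>G. (\<forall>i. (\<lambda>q. G q $ i) holomorphic_on ball 0 1) \<and>
    (\<forall>\<tau>\<in>upper_half_plane. matrix_exp (mat (- 2 * of_real pi * \<i> * \<tau>) ** exponent_matrix \<rho>) *v (F \<tau> + F' \<tau>) =
        G (exp (2 * of_real pi * \<i> * \<tau>)))"
    using G G' by (intro exI[of _ "\<lambda>q. G q + G' q"])
      (simp add: matrix_vector_right_distrib holomorphic_on_add)
qed

lemma modular_forms_zero: "(\<lambda>\<tau>. 0) \<in> modular_forms \<rho> k"
  by (auto simp: modular_forms_def intro!: exI[of _ "\<lambda>q. 0"])

lemma modular_forms_sum:
  assumes "finite I" "\<And>i. i \<in> I \<Longrightarrow> F i \<in> modular_forms \<rho> k"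
  shows "(\<lambda>\<tau>. \<Sum>i\<in>I. F i \<tau>) \<in> modular_forms \<rho> k"
  using assms by (induction I rule: finite_induct) (simp_all add: modular_forms_zero modular_forms_add)

lemma modular_forms_diff:
  assumes "F \<in> modular_forms \<rho> k" "F' \<in> modular_forms \<rho> k"
  shows "(\<lambda>\<tau>. F \<tau> - F' \<tau>) \<in> modular_forms \<rho> k"
proof -
  have "(\<lambda>\<tau>. F \<tau> + (-1) *s F' \<tau>) \<in> modular_forms \<rho> k"
    by (intro modular_forms_add assms modular_forms_mult[OF assms(2) modular_q_const[of "-1"]]) simp
  then show ?thesis by (simp add: vec.scale_minus_left)
qed

lemma modular_forms_outside:
  assumes "F \<in> modular_forms \<rho> k" "\<not> Im \<tau> > 0"
  shows "F \<tau> = 0"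
  using assms by (simp add: modular_forms_def upper_half_plane_def)

section \<open>Homogeneous coefficients and change of basis\<close>

text \<open>Since the sum of the weight spaces is direct, the coefficients of a form of weight \<open>k\<close> with respect
  to a homogeneous basis may be replaced by their homogeneous components of the right weights.\<close>

lemma homogeneous_basis_coefficients:
  fixes \<rho> :: "int^2^2 \<Rightarrow> complex^'n^'n"
  assumes hom: "\<rho> \<in> hom SL2Z GL" and basis: "homogeneous_basis \<rho> Fs ws" and F: "F \<in> modular_forms \<rho> k"
  obtains s where "\<And>i. modular_q (k - ws ! i) (s i)"
    "\<And>\<tau>. F \<tau> = (\<Sum>i<length ws. s i (nome \<tau>) *s (Fs ! i) \<tau>)"
proof -
  define n where "n = length ws"
  have n: "length Fs = n" and Fs: "\<And>i. i < n \<Longrightarrow> Fs ! i \<in> modular_forms \<rho> (ws ! i)"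
    using basis by (auto simp: homogeneous_basis_def n_def)
  have "F \<in> all_modular_forms \<rho>"
    unfolding all_modular_forms_def using F by (auto intro!: exI[of _ "{k}"] exI[of _ "\<lambda>_. F"])
  then obtain r where r: "\<And>i. i < n \<Longrightarrow> r i \<in> ring_E4_E6" "\<And>\<tau>. F \<tau> = (\<Sum>i<n. r i \<tau> *s (Fs ! i) \<tau>)"
    using basis unfolding homogeneous_basis_def n by blast
  have "\<exists>K f. finite K \<and> (\<forall>k. modular_q k (f k)) \<and> (\<forall>\<tau>. Im \<tau> > 0 \<longrightarrow> r i \<tau> = (\<Sum>k\<in>K. f k (nome \<tau>))) \<and>
    (\<forall>k q. k \<notin> K \<longrightarrow> f k q = 0)" if "i < n" for i
    using ring_E4_E6_homogeneous[OF r(1)[OF that]] by metis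
  then obtain K f where *: "\<And>i. i < n \<Longrightarrow> finite (K i) \<and> (\<forall>k. modular_q k (f i k)) \<and>
    (\<forall>\<tau>. Im \<tau> > 0 \<longrightarrow> r i \<tau> = (\<Sum>k\<in>K i. f i k (nome \<tau>))) \<and> (\<forall>k q. k \<notin> K i \<longrightarrow> f i k q = 0)"
    by metis
  define M where "M = insert k (\<Union>i<n. (\<lambda>l. l + ws ! i) ` K i)"
  have M: "finite M" "k \<in> M" using * by (auto simp: M_def)
  \<comment> \<open>The component of weight m of the representation of F, with F itself moved to the
    same side. All components add up to 0, so the one of weight k vanishes.\<close>
  define g where "g m \<tau> = (\<Sum>i<n. f i (m - ws ! i) (nome \<tau>) *s (Fs ! i) \<tau>) - (if m = k then F \<tau> else 0)" for m \<tau>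
  have g: "g m \<in> modular_forms \<rho> m" for m
  proof -
    have "(\<lambda>\<tau>. f i (m - ws ! i) (nome \<tau>) *s (Fs ! i) \<tau>) \<in> modular_forms \<rho> m" if "i < n" for i
      by (rule modular_forms_mult[OF Fs[OF that]]) (use *[OF that] in auto)
    then have "(\<lambda>\<tau>. \<Sum>i<n. f i (m - ws ! i) (nome \<tau>) *s (Fs ! i) \<tau>) \<in> modular_forms \<rho> m"
      by (intro modular_forms_sum) auto
    moreover have "(\<lambda>\<tau>. if m = k then F \<tau> else 0) \<in> modular_forms \<rho> m"
      using F by (cases "m = k") (simp_all add: modular_forms_zero)
    ultimately show ?thesis unfolding g_def[abs_def] by (rule modular_forms_diff)
  qed
  have "(\<Sum>m\<in>M. g m \<tau>) = 0" for \<tau>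
  proof (cases "Im \<tau> > 0")
    case False
    then show ?thesis using modular_forms_outside[OF g] by simp
  next
    case True
    have fK: "(\<Sum>m\<in>M. f i (m - ws ! i) (nome \<tau>)) = r i \<tau>" if i: "i < n" for i
    proof -
      have "(\<Sum>m\<in>M. f i (m - ws ! i) (nome \<tau>)) = (\<Sum>m\<in>(\<lambda>l. l + ws ! i) ` K i. f i (m - ws ! i) (nome \<tau>))"
      proof (rule sum.mono_neutral_right[OF M(1)])
        show "\<forall>m\<in>M - (\<lambda>l. l + ws ! i) ` K i. f i (m - ws ! i) (nome \<tau>) = 0"
        proof
          fix m assume m: "m \<in> M - (\<lambda>l. l + ws ! i) ` K i"
          have "m - ws ! i \<notin> K i"
          proof
            assume "m - ws ! i \<in> K i"
            then have "(m - ws ! i) + ws ! i \<in> (\<lambda>l. l + ws ! i) ` K i" by (rule imageI)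
            with m show False by simp
          qed
          then show "f i (m - ws ! i) (nome \<tau>) = 0" using *[OF i] by blast
        qed
      qed (use i in \<open>auto simp: M_def\<close>)
      also have "\<dots> = (\<Sum>l\<in>K i. f i l (nome \<tau>))"
        by (subst sum.reindex) (auto simp: inj_on_def)
      finally show ?thesis using *[OF i] True by simp
    qed
    have "(\<Sum>m\<in>M. g m \<tau>) = (\<Sum>m\<in>M. \<Sum>i<n. f i (m - ws ! i) (nome \<tau>) *s (Fs ! i) \<tau>) - (\<Sum>m\<in>M. if m = k then F \<tau> else 0)"
      unfolding g_def by (rule sum_subtractf)
    also have "(\<Sum>m\<in>M. \<Sum>i<n. f i (m - ws ! i) (nome \<tau>) *s (Fs ! i) \<tau>) =
        (\<Sum>i<n. (\<Sum>m\<in>M. f i (m - ws ! i) (nome \<tau>)) *s (Fs ! i) \<tau>)"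
      by (subst sum.swap) (simp add: vec.scale_sum_left)
    also have "\<dots> = F \<tau>" unfolding r(2) by (intro sum.cong refl) (simp add: fK)
    finally show ?thesis using M by simp
  qed
  then have g0: "g k \<tau> = 0" for \<tau>
    by (rule modular_forms_direct[OF hom M(1) g _ M(2)])
  \<comment> \<open>Beyond the list, \<open>ws ! i\<close> has no definite value; the zero function
    is modular of every weight.\<close>
  define s where "s i = (if i < n then f i (k - ws ! i) else (\<lambda>q. 0))" for i
  show ?thesis
  proof (rule that[of s])
    show "modular_q (k - ws ! i) (s i)" for i
      using * by (simp add: s_def modular_q_zero)
    show "F \<tau> = (\<Sum>i<length ws. s i (nome \<tau>) *s (Fs ! i) \<tau>)" for \<tau>
      using g0[of \<tau>] by (simp add: g_def s_def n_def)
  qed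
qed

text \<open>Substituting one expansion into the other expresses \<open>Fs ! i\<close> through the
  list \<open>Fs\<close>. The coefficients are forms, hence lie in the ring, and independence
  compares them with the identity matrix.\<close>

lemma homogeneous_basis_transition:
  fixes \<rho> :: "int^2^2 \<Rightarrow> complex^'n^'n"
  assumes basis: "homogeneous_basis \<rho> Fs ws"
    and S: "\<And>i j. modular_q (ws ! i - vs ! j) (S i j)" and R: "\<And>i j. modular_q (vs ! j - ws ! i) (R j i)"
    and FG: "\<And>i \<tau>. i < length ws \<Longrightarrow> (Fs ! i) \<tau> = (\<Sum>j<length vs. S i j (nome \<tau>) *s (Gs ! j) \<tau>)"
    and GF: "\<And>j \<tau>. j < length vs \<Longrightarrow> (Gs ! j) \<tau> = (\<Sum>i<length ws. R j i (nome \<tau>) *s (Fs ! i) \<tau>)"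
    and i: "i < length ws" and \<tau>: "Im \<tau> > 0"
  shows "(\<Sum>j<length vs. S i j (nome \<tau>) * R j i (nome \<tau>)) = 1"
proof -
  define n where "n = length ws"
  have n: "length Fs = n" and Fs: "\<And>i. i < n \<Longrightarrow> Fs ! i \<in> modular_forms \<rho> (ws ! i)"
    using basis by (auto simp: homogeneous_basis_def n_def)
  define U where "U l q = (\<Sum>j<length vs. S i j q * R j l q) - (if l = i then 1 else 0)" for l q
  have U: "modular_q (ws ! i - ws ! l) (U l)" for l
  proof -
    have "modular_q (ws ! i - ws ! l) (\<lambda>q. \<Sum>j\<in>J. S i j q * R j l q)" if "finite J" for J
      using that
    proof (induction J rule: finite_induct)
      case (insert j J)
      have "modular_q (ws ! i - ws ! l) (\<lambda>q. S i j q * R j l q)"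
        by (rule modular_q_mult[OF S R]) simp
      with insert show ?case by (simp add: modular_q_add)
    qed (simp add: modular_q_zero)
    moreover have "modular_q (ws ! i - ws ! l) (\<lambda>q. if l = i then 1 else 0)"
      by (cases "l = i") (simp_all add: modular_q_zero modular_q_const)
    ultimately show ?thesis unfolding U_def[abs_def] by (intro modular_q_diff) auto
  qed
  have "\<forall>l. \<exists>r\<in>ring_E4_E6. \<forall>\<tau>. Im \<tau> > 0 \<longrightarrow> r \<tau> = U l (nome \<tau>)"
    using modular_q_in_ring[OF U] by metis
  then obtain r where r: "\<And>l. r l \<in> ring_E4_E6" "\<And>l \<tau>. Im \<tau> > 0 \<Longrightarrow> r l \<tau> = U l (nome \<tau>)" by metis
  have "(\<Sum>l<n. r l \<tau> *s (Fs ! l) \<tau>) = 0" for \<tau>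
  proof (cases "Im \<tau> > 0")
    case False
    then show ?thesis using modular_forms_outside[OF Fs] by simp
  next
    case True
    have "(Fs ! i) \<tau> = (\<Sum>j<length vs. S i j (nome \<tau>) *s (\<Sum>l<n. R j l (nome \<tau>) *s (Fs ! l) \<tau>))"
      unfolding FG[OF i] by (intro sum.cong refl) (simp add: GF n_def)
    also have "\<dots> = (\<Sum>l<n. (\<Sum>j<length vs. S i j (nome \<tau>) * R j l (nome \<tau>)) *s (Fs ! l) \<tau>)"
      unfolding vec.scale_sum_right vec.scale_sum_left vec.scale_scale by (rule sum.swap)
    finally have e: "(Fs ! i) \<tau> = (\<Sum>l<n. (\<Sum>j<length vs. S i j (nome \<tau>) * R j l (nome \<tau>)) *s (Fs ! l) \<tau>)" .
    have d: "(\<Sum>l<n. (if l = i then 1 else 0) *s (Fs ! l) \<tau>) = (Fs ! i) \<tau>"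
    proof -
      have "(\<Sum>l<n. (if l = i then 1 else 0) *s (Fs ! l) \<tau>) = (\<Sum>l<n. if l = i then (Fs ! l) \<tau> else 0)"
        by (intro sum.cong refl) simp
      then show ?thesis using i by (simp add: n_def)
    qed
    have "(\<Sum>l<n. r l \<tau> *s (Fs ! l) \<tau>) =
        (\<Sum>l<n. (\<Sum>j<length vs. S i j (nome \<tau>) * R j l (nome \<tau>)) *s (Fs ! l) \<tau>) -
        (\<Sum>l<n. (if l = i then 1 else 0) *s (Fs ! l) \<tau>)"
      unfolding r(2)[OF True] U_def vec.scale_left_diff_distrib by (rule sum_subtractf)
    then show ?thesis unfolding e[symmetric] d by simp
  qed
  then have "\<forall>l<n. \<forall>\<tau>\<in>upper_half_plane. r l \<tau> = 0"
    using basis r(1) unfolding homogeneous_basis_def n by blast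
  then have "U i (nome \<tau>) = 0" using i \<tau> r(2)[OF \<tau>, of i] by (simp add: n_def upper_half_plane_def)
  then show ?thesis by (simp add: U_def)
qed

text \<open>The transition matrices \<open>S\<close> and \<open>R\<close> between two homogeneous bases are inverse to each other, and
  \<open>S\<^sub>i\<^sub>j R\<^sub>j\<^sub>i\<close> vanishes unless the weights of the \<open>i\<close>-th and the \<open>j\<close>-th basis element agree, because
  there are no forms of negative weight. So the sum of all \<open>S\<^sub>i\<^sub>j R\<^sub>j\<^sub>i\<close> with both weights equal to \<open>w\<close>
  counts the elements of weight \<open>w\<close> in either basis.\<close>

lemma homogeneous_basis_weights_unique:
  fixes \<rho> :: "int^2^2 \<Rightarrow> complex^'n^'n"
  assumes hom: "\<rho> \<in> hom SL2Z GL" and F: "homogeneous_basis \<rho> Fs ws" and G: "homogeneous_basis \<rho> Gs vs"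
  shows "mset ws = mset vs"
proof -
  have Fs: "\<And>i. i < length ws \<Longrightarrow> Fs ! i \<in> modular_forms \<rho> (ws ! i)"
    using F by (auto simp: homogeneous_basis_def)
  have Gs: "\<And>i. i < length vs \<Longrightarrow> Gs ! i \<in> modular_forms \<rho> (vs ! i)"
    using G by (auto simp: homogeneous_basis_def)
  have "\<forall>i. \<exists>s. (\<forall>j. modular_q (ws ! i - vs ! j) (s j)) \<and>
      (i < length ws \<longrightarrow> (\<forall>\<tau>. (Fs ! i) \<tau> = (\<Sum>j<length vs. s j (nome \<tau>) *s (Gs ! j) \<tau>)))"
    (is "\<forall>i. ?P i")
  proof
    show "?P i" for i
    proof (cases "i < length ws")
      case True
      then show ?thesis using homogeneous_basis_coefficients[OF hom G Fs[OF True]] by metis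
    qed (intro exI[of _ "\<lambda>j q. 0"], simp add: modular_q_zero)
  qed
  from choice[OF this] obtain S where S: "\<And>i j. modular_q (ws ! i - vs ! j) (S i j)"
    "\<And>i \<tau>. i < length ws \<Longrightarrow> (Fs ! i) \<tau> = (\<Sum>j<length vs. S i j (nome \<tau>) *s (Gs ! j) \<tau>)" by blast
  have "\<forall>j. \<exists>s. (\<forall>i. modular_q (vs ! j - ws ! i) (s i)) \<and>
      (j < length vs \<longrightarrow> (\<forall>\<tau>. (Gs ! j) \<tau> = (\<Sum>i<length ws. s i (nome \<tau>) *s (Fs ! i) \<tau>)))"
    (is "\<forall>j. ?P j")
  proof
    show "?P j" for j
    proof (cases "j < length vs")
      case True
      then show ?thesis using homogeneous_basis_coefficients[OF hom F Gs[OF True]] by metis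
    qed (intro exI[of _ "\<lambda>j q. 0"], simp add: modular_q_zero)
  qed
  from choice[OF this] obtain R where R: "\<And>i j. modular_q (vs ! j - ws ! i) (R j i)"
    "\<And>j \<tau>. j < length vs \<Longrightarrow> (Gs ! j) \<tau> = (\<Sum>i<length ws. R j i (nome \<tau>) *s (Fs ! i) \<tau>)" by blast
  \<comment> \<open>Evaluation at one point of the upper half-plane turns the matrices of forms into
    complex matrices.\<close>
  define t where "t i j = S i j (nome \<i>) * R j i (nome \<i>)" for i j
  have t1: "(\<Sum>j<length vs. t i j) = 1" if "i < length ws" for i
    unfolding t_def by (rule homogeneous_basis_transition[OF F S(1) R(1) S(2) R(2) that]) simp_all
  have t2: "(\<Sum>i<length ws. t i j) = 1" if "j < length vs" for j
    unfolding t_def mult.commute[of "S _ _ _"]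
    by (rule homogeneous_basis_transition[OF G R(1) S(1) R(2) S(2) that]) simp_all
  have t0: "t i j = 0" if "ws ! i \<noteq> vs ! j" for i j
  proof -
    have q: "nome \<i> \<in> ball 0 1" by simp
    have "ws ! i - vs ! j < 0 \<or> vs ! j - ws ! i < 0" using that by linarith
    then show ?thesis
      using modular_q_negative[OF S(1)[of i j] _ q] modular_q_negative[OF R(1)[of j i] _ q] by (auto simp: t_def)
  qed
  show ?thesis
  proof (rule multiset_eqI)
    fix w
    define I J where "I = {i. i < length ws \<and> ws ! i = w}" and "J = {j. j < length vs \<and> vs ! j = w}"
    have tI: "t i j = 0" if "i \<in> I" "j \<in> {..<length vs} - J" for i j
      by (rule t0) (use that in \<open>auto simp: I_def J_def\<close>)
    have tJ: "t i j = 0" if "j \<in> J" "i \<in> {..<length ws} - I" for i j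
      by (rule t0) (use that in \<open>auto simp: I_def J_def\<close>)
    have "of_nat (card I) = (\<Sum>i\<in>I. \<Sum>j<length vs. t i j)" using t1 by (simp add: I_def)
    also have "\<dots> = (\<Sum>i\<in>I. \<Sum>j\<in>J. t i j)"
      by (intro sum.cong refl sum.mono_neutral_right ballI) (auto simp: J_def tI)
    also have "\<dots> = (\<Sum>j\<in>J. \<Sum>i\<in>I. t i j)" by (rule sum.swap)
    also have "\<dots> = (\<Sum>j\<in>J. \<Sum>i<length ws. t i j)"
      by (intro sum.cong refl sum.mono_neutral_left ballI) (auto simp: I_def tJ)
    also have "\<dots> = of_nat (card J)" using t2 by (simp add: J_def)
    finally have "card I = card J" by (simp only: of_nat_eq_iff)
    then show "count (mset ws) w = count (mset vs) w"
      by (simp add: I_def J_def count_mset count_list_eq_length_filter length_filter_conv_card eq_commute[of w])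
  qed
qed

lemma generating_weights_eqI:
  fixes \<rho> :: "int^2^2 \<Rightarrow> complex^'n^'n"
  assumes "\<rho> \<in> hom SL2Z GL" "homogeneous_basis \<rho> Fs ws"
  shows "generating_weights \<rho> = mset ws"
  unfolding generating_weights_def
  by (rule the_equality) (use assms homogeneous_basis_weights_unique in blast)+

section \<open>Primitives of forms of weight 2\<close>

text \<open>The n-th Taylor coefficient is divided by n + \<mu>, and the lower bound on these
  numbers preserves convergence on the unit disc. Up to 2 pi i, multiplication by exp(2 pi i \<mu>
  \<tau>) turns the equation into the search for a primitive in \<tau>.\<close>

lemma euler_operator_surj:
  fixes \<mu> :: complex
  assumes W: "W holomorphic_on ball 0 1" and \<delta>: "\<delta> > 0" "\<And>n. norm (of_nat n + \<mu>) \<ge> \<delta>"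
  obtains H where "H holomorphic_on ball 0 1" "\<And>q. q \<in> ball 0 1 \<Longrightarrow> \<mu> * H q + theta H q = W q"
proof -
  define a where "a n = (deriv ^^ n) W 0 / fact n" for n
  define b where "b n = a n / (of_nat n + \<mu>)" for n
  have nz: "of_nat n + \<mu> \<noteq> 0" for n using \<delta>(2)[of n] \<delta>(1) by auto
  have a: "(\<lambda>n. a n * q ^ n) sums W q" if "q \<in> ball 0 1" for q
    using holomorphic_power_series[OF W that] by (simp add: a_def)
  have b: "summable (\<lambda>n. b n * q ^ n)" if q: "norm q < 1" for q
  proof -
    obtain r where r: "norm q < r" "r < 1" using q dense by blast
    have "r > 0" using r norm_ge_zero[of q] by linarith
    then have "norm (of_real r :: complex) = r" by simp
    moreover have "summable (\<lambda>n. a n * (of_real r) ^ n)"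
      by (rule sums_summable[OF a]) (use calculation r in simp)
    ultimately have sa: "summable (\<lambda>n. norm (a n * q ^ n))"
      using r by (intro powser_insidea[of a "of_real r"]) auto
    have "norm (b n * q ^ n) \<le> (1 / \<delta>) * norm (a n * q ^ n)" for n
    proof -
      have "norm (a n * q ^ n) / norm (of_nat n + \<mu>) \<le> norm (a n * q ^ n) / \<delta>"
        using \<delta> by (intro divide_left_mono mult_pos_pos) (auto simp: nz)
      then show ?thesis by (simp add: b_def norm_mult norm_divide)
    qed
    then show ?thesis
      by (intro summable_comparison_test'[OF summable_mult[OF sa, of "1 / \<delta>"], of 0])
  qed
  define H where "H q = (\<Sum>n. b n * q ^ n)" for q
  have H: "(\<lambda>n. b n * q ^ n) sums H q" if "norm q < 1" for q
    unfolding H_def by (rule summable_sums[OF b[OF that]])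
  have "H holomorphic_on ball 0 1"
    by (rule power_series_holomorphic[of _ _ b]) (use H in simp)
  moreover have "\<mu> * H q + theta H q = W q" if q: "q \<in> ball 0 1" for q
  proof -
    have q1: "norm q < 1" using q by simp
    then obtain r where r: "norm q < r" "r < 1" using dense by blast
    have "r > 0" using r norm_ge_zero[of q] by linarith
    then have nr: "norm (of_real r :: complex) = r" by simp
    have "(H has_field_derivative (\<Sum>n. diffs b n * q ^ n)) (at q)"
      unfolding H_def[abs_def] by (rule termdiffs_strong[of _ "of_real r"]) (use r nr b in auto)
    then have th: "theta H q = q * (\<Sum>n. diffs b n * q ^ n)"
      by (simp add: theta_def DERIV_imp_deriv)
    have "summable (\<lambda>n. diffs b n * q ^ n)"
      by (rule termdiff_converges[OF q1]) (rule b)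
    from sums_mult[OF diffs_equiv[OF this], of q]
    have "(\<lambda>n. q * (of_nat n * b n * q ^ (n - Suc 0))) sums theta H q" by (simp add: th)
    moreover have "q * (of_nat n * b n * q ^ (n - Suc 0)) = of_nat n * b n * q ^ n" for n
      by (cases n) simp_all
    ultimately have "(\<lambda>n. of_nat n * b n * q ^ n) sums theta H q" by simp
    from sums_add[OF sums_mult[OF H[OF q1], of \<mu>] this]
    have "(\<lambda>n. \<mu> * (b n * q ^ n) + of_nat n * b n * q ^ n) sums (\<mu> * H q + theta H q)" .
    moreover have "\<mu> * (b n * q ^ n) + of_nat n * b n * q ^ n = a n * q ^ n" for n
    proof -
      have "\<mu> * (b n * q ^ n) + of_nat n * b n * q ^ n = (b n * (of_nat n + \<mu>)) * q ^ n"
        by (simp add: algebra_simps)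
      also have "b n * (of_nat n + \<mu>) = a n" using nz[of n] by (simp add: b_def)
      finally show ?thesis .
    qed
    ultimately show ?thesis using a[OF q] by (simp add: sums_unique2)
  qed
  ultimately show ?thesis by (rule that)
qed

lemma nome_minus: "nome (- x) = 1 / nome x"
  by (simp add: nome_def exp_minus inverse_eq_divide)

locale eta_root =
  fixes G :: "complex \<Rightarrow> complex"
  assumes G: "G holomorphic_on ball 0 1" "\<And>q. q \<in> ball 0 1 \<Longrightarrow> G q \<noteq> 0"
    and G_S: "\<And>\<tau>. Im \<tau> > 0 \<Longrightarrow> nome (-1 / \<tau> / 12) * G (nome (-1 / \<tau>)) = - \<i> * \<tau> * (nome (\<tau> / 12) * G (nome \<tau>))"
begin

definition eta2 :: "complex \<Rightarrow> complex" where
  "eta2 \<tau> = nome (\<tau> / 12) * G (nome \<tau>)"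

lemma eta2_nonzero: "Im \<tau> > 0 \<Longrightarrow> eta2 \<tau> \<noteq> 0"
  using G(2)[of "nome \<tau>"] by (simp add: eta2_def)

lemma eta2_S: "Im \<tau> > 0 \<Longrightarrow> eta2 (-1 / \<tau>) = - \<i> * \<tau> * eta2 \<tau>"
  unfolding eta2_def by (rule G_S)

lemma eta2_S_power: "Im \<tau> > 0 \<Longrightarrow> eta2 (-1 / \<tau>) ^ n = (- \<i>) ^ n * \<tau> ^ n * eta2 \<tau> ^ n"
  by (simp only: eta2_S power_mult_distrib)

lemma nome_sixth: "nome (\<tau> / 6) = nome (\<tau> / 12) ^ 2"
  by (simp add: nome_power)

lemma eta2_square: "eta2 \<tau> ^ 2 = nome (\<tau> / 6) * G (nome \<tau>) ^ 2"
  by (simp only: eta2_def power_mult_distrib nome_sixth)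

text \<open>The function \<open>h(\<tau>) = e(\<mu>\<tau>) H(q)\<close> is the primitive of a form of weight 2, namely of \<open>\<eta>\<^sup>4\<close> for
  \<open>\<mu> = 1/6\<close> and of \<open>E\<^sub>4/\<eta>\<^sup>4\<close> for \<open>\<mu> = -1/6\<close>. If the constant \<open>K\<close> were 0, then \<open>h\<close> would be a modular form,
  and \<open>h/\<eta>\<^sup>4\<close> or \<open>h \<eta>\<^sup>4\<close> would be a form of weight \<open>-2\<close> or 2 for the trivial character.\<close>

lemma primitive_cocycle:
  assumes \<mu>: "\<mu> = 1/6 \<or> \<mu> = -1/6"
  obtains H K where "H holomorphic_on ball 0 1" "H 0 \<noteq> 0" "K \<noteq> 0"
    "\<And>\<tau>. Im \<tau> > 0 \<Longrightarrow> nome (\<mu> * (-1 / \<tau>)) * H (nome (-1 / \<tau>)) = K - nome (\<mu> * \<tau>) * H (nome \<tau>)"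
proof -
  \<comment> \<open>The form of weight 2 with its fractional leading power of q removed.\<close>
  define W where "W q = (if \<mu> = 1/6 then G q ^ 2 else E4 q / G q ^ 2)" for q
  have W: "W holomorphic_on ball 0 1"
  proof (cases "\<mu> = 1/6")
    case True
    then show ?thesis unfolding W_def by (simp add: holomorphic_on_power G(1))
  next
    case False
    have "(\<lambda>q. E4 q / G q ^ 2) holomorphic_on ball 0 1"
      using G(2) by (intro holomorphic_intros G(1)) auto
    then show ?thesis unfolding W_def using False by simp
  qed
  have W0: "W 0 \<noteq> 0" using G(2)[of 0] by (simp add: W_def)
  have \<delta>: "norm (of_nat n + \<mu>) \<ge> 1/6" for n
  proof -
    have "Re (1/6) = 1/6" "Re (-1/6) = -1/6" by simp_all
    then have "Re \<mu> = 1/6 \<or> Re \<mu> = -1/6" using \<mu> by metis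
    then have "\<bar>Re (of_nat n + \<mu>)\<bar> \<ge> 1/6" by (cases n) auto
    then show ?thesis using abs_Re_le_cmod[of "of_nat n + \<mu>"] by linarith
  qed
  obtain H where H: "H holomorphic_on ball 0 1" "\<And>q. q \<in> ball 0 1 \<Longrightarrow> \<mu> * H q + theta H q = W q"
    using euler_operator_surj[OF W _ \<delta>] by auto
  define w h where "w \<tau> = nome (\<mu> * \<tau>) * W (nome \<tau>)" and "h \<tau> = nome (\<mu> * \<tau>) * H (nome \<tau>)" for \<tau>
  have w: "w \<tau> = (if \<mu> = 1/6 then eta2 \<tau> ^ 2 else E4 (nome \<tau>) / eta2 \<tau> ^ 2)" for \<tau>
  proof (cases "\<mu> = 1/6")
    case True
    have "nome (\<mu> * \<tau>) = nome (\<tau> / 6)" unfolding True by simp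
    then show ?thesis unfolding w_def W_def eta2_square if_P[OF True] by simp
  next
    case False
    then have "\<mu> = - (1/6)" using \<mu> by simp
    then have "nome (\<mu> * \<tau>) = 1 / nome (\<tau> / 6)" using nome_minus[of "\<tau> / 6"] by simp
    then show ?thesis unfolding w_def W_def eta2_square if_not_P[OF False] by simp
  qed
  \<comment> \<open>The sign is the square of -\<i>. Because of it the sum, not the difference, of
    h(-1/\<tau>) and h(\<tau>) has derivative 0.\<close>
  have wS: "w (-1 / \<tau>) = - (\<tau>\<^sup>2 * w \<tau>)" if \<tau>: "Im \<tau> > 0" for \<tau>
  proof -
    define t where "t = \<tau>\<^sup>2"
    have t: "t \<noteq> 0" using \<tau> by (auto simp: t_def)
    have e: "eta2 (-1 / \<tau>) ^ 2 = - (t * eta2 \<tau> ^ 2)"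
      unfolding eta2_S_power[OF \<tau>] by (simp add: power2_eq_square t_def)
    have "\<tau> ^ 4 = t * t" by (simp add: t_def eval_nat_numeral)
    then have E: "E4 (nome (-1 / \<tau>)) = t * (t * E4 (nome \<tau>))"
      using modular_q_S[OF modular_q_E4 \<tau>] by (simp only: power_int_numeral mult.assoc)
    have "t * (t * E4 (nome \<tau>)) / - (t * eta2 \<tau> ^ 2) = - (t * (E4 (nome \<tau>) / eta2 \<tau> ^ 2))"
      using t by simp
    then show ?thesis unfolding w e E t_def[symmetric] by simp
  qed
  have dh: "((\<lambda>\<tau>. h (f \<tau>)) has_field_derivative 2 * of_real pi * \<i> * w (f \<tau>) * f') (at \<tau>)"
    if f: "Im (f \<tau>) > 0" "(f has_field_derivative f') (at \<tau>)" for f f' \<tau>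
  proof -
    have "((\<lambda>\<tau>. nome (\<mu> * f \<tau>)) has_field_derivative 2 * of_real pi * \<i> * nome (\<mu> * f \<tau>) * (\<mu> * f')) (at \<tau>)"
      by (intro derivative_intros f DERIV_cmult)
    from DERIV_mult[OF this has_field_derivative_compose_nome[OF H(1) f]]
    have "((\<lambda>\<tau>. h (f \<tau>)) has_field_derivative
       2 * of_real pi * \<i> * nome (\<mu> * f \<tau>) * (\<mu> * f') * H (nome (f \<tau>)) +
       2 * of_real pi * \<i> * theta H (nome (f \<tau>)) * f' * nome (\<mu> * f \<tau>)) (at \<tau>)"
      by (simp only: h_def)
    also have "2 * of_real pi * \<i> * nome (\<mu> * f \<tau>) * (\<mu> * f') * H (nome (f \<tau>)) +
       2 * of_real pi * \<i> * theta H (nome (f \<tau>)) * f' * nome (\<mu> * f \<tau>) =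
       2 * of_real pi * \<i> * (nome (\<mu> * f \<tau>) * (\<mu> * H (nome (f \<tau>)) + theta H (nome (f \<tau>)))) * f'"
      by (simp only: ring_distribs mult_ac)
    also have "\<mu> * H (nome (f \<tau>)) + theta H (nome (f \<tau>)) = W (nome (f \<tau>))"
      using H(2)[of "nome (f \<tau>)"] f(1) by simp
    finally show ?thesis by (simp only: w_def)
  qed
  have "\<exists>K. \<forall>\<tau>\<in>{\<tau>. Im \<tau> > 0}. h (-1 / \<tau>) + h \<tau> = K"
  proof (rule has_field_derivative_zero_constant)
    show "convex {\<tau>. Im \<tau> > 0}" by (rule convex_halfspace_Im_gt)
    fix \<tau> assume "\<tau> \<in> {\<tau>. Im \<tau> > 0}"
    then have \<tau>: "Im \<tau> > 0" by simp
    then have nz: "\<tau> \<noteq> 0" by auto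
    have "((\<lambda>\<tau>. h (-1 / \<tau>) + h \<tau>) has_field_derivative
       2 * of_real pi * \<i> * w (-1 / \<tau>) * (1 / \<tau>\<^sup>2) + 2 * of_real pi * \<i> * w \<tau> * 1) (at \<tau>)"
      by (intro DERIV_add dh minus_inverse_upper_half_plane \<tau> has_field_derivative_minus_inverse nz DERIV_ident)
    also have "2 * of_real pi * \<i> * w (-1 / \<tau>) * (1 / \<tau>\<^sup>2) + 2 * of_real pi * \<i> * w \<tau> * 1 = 0"
      unfolding wS[OF \<tau>] using nz by simp
    finally show "((\<lambda>\<tau>. h (-1 / \<tau>) + h \<tau>) has_field_derivative 0) (at \<tau> within {\<tau>. Im \<tau> > 0})"
      by (rule has_field_derivative_at_within)
  qed
  then obtain K where K: "\<And>\<tau>. Im \<tau> > 0 \<Longrightarrow> h (-1 / \<tau>) + h \<tau> = K" by blast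
  have "W 0 = \<mu> * H 0" using H(2)[of 0] by simp
  then have H0: "H 0 \<noteq> 0" using W0 by auto
  have "K \<noteq> 0"
  proof
    assume "K = 0"
    then have hS: "h (-1 / \<tau>) = - h \<tau>" if "Im \<tau> > 0" for \<tau>
      using K[OF that] by (simp add: add_eq_0_iff2)
    have eS: "eta2 (-1 / \<tau>) ^ 2 = - (\<tau>\<^sup>2 * eta2 \<tau> ^ 2)" if "Im \<tau> > 0" for \<tau>
      unfolding eta2_S_power[OF that] by (simp add: power2_eq_square)
    show False
    proof (cases "\<mu> = 1/6")
      case True
      define \<phi> where "\<phi> q = H q / G q ^ 2" for q
      have \<phi>: "\<phi> (nome \<tau>) = h \<tau> / eta2 \<tau> ^ 2" for \<tau>
      proof -
        have "nome (\<mu> * \<tau>) = nome (\<tau> / 6)" unfolding True by simp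
        then show ?thesis unfolding \<phi>_def h_def eta2_square by simp
      qed
      have "modular_q (-2) \<phi>"
        unfolding modular_q_def
      proof (intro conjI allI impI)
        show "\<phi> holomorphic_on ball 0 1"
          unfolding \<phi>_def using G(2) by (intro holomorphic_intros H(1) G(1)) auto
        show "\<phi> (nome (-1 / \<tau>)) = \<tau> powi (-2) * \<phi> (nome \<tau>)" if "Im \<tau> > 0" for \<tau>
          unfolding \<phi> hS[OF that] eS[OF that] by (simp add: power_int_minus divide_inverse)
      qed
      then have "\<phi> 0 = 0" by (rule modular_q_negative) auto
      then show False using H0 G(2)[of 0] by (simp add: \<phi>_def)
    next
      case False
      then have "\<mu> = - (1/6)" using \<mu> by simp
      then have m: "nome (\<mu> * \<tau>) = 1 / nome (\<tau> / 6)" for \<tau> using nome_minus[of "\<tau> / 6"] by simp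
      define \<phi> where "\<phi> q = H q * G q ^ 2" for q
      have \<phi>: "\<phi> (nome \<tau>) = h \<tau> * eta2 \<tau> ^ 2" for \<tau>
        by (simp add: \<phi>_def h_def eta2_square m)
      have "modular_q 2 \<phi>"
        unfolding modular_q_def
      proof (intro conjI allI impI)
        show "\<phi> holomorphic_on ball 0 1"
          unfolding \<phi>_def by (intro holomorphic_intros H(1) G(1))
        show "\<phi> (nome (-1 / \<tau>)) = \<tau> powi 2 * \<phi> (nome \<tau>)" if "Im \<tau> > 0" for \<tau>
          unfolding \<phi> hS[OF that] eS[OF that] by simp
      qed
      then have "\<phi> 0 = 0" by (rule modular_q_weight_2) auto
      then show False using H0 G(2)[of 0] by (simp add: \<phi>_def)
    qed
  qed
  moreover have "h (-1 / \<tau>) = K - h \<tau>" if "Im \<tau> > 0" for \<tau>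
    using K[OF that] by (simp add: eq_diff_eq)
  ultimately show ?thesis using that[OF H(1) H0] by (simp add: h_def)
qed

end

text \<open>Independence can be demanded at each single point because the determinants of the bases
  constructed below, powers of \<open>eta2\<close> and the discriminant up to constants, have no
  zeros in the upper half-plane.\<close>

lemma homogeneous_basisI:
  assumes len: "length Fs = length ws"
    and mem: "\<And>i. i < length ws \<Longrightarrow> Fs ! i \<in> modular_forms \<rho> (ws ! i)"
    and span: "\<And>k F. F \<in> modular_forms \<rho> k \<Longrightarrow> \<exists>s. (\<forall>i<length ws. modular_q (k - ws ! i) (s i)) \<and>
        (\<forall>\<tau>. Im \<tau> > 0 \<longrightarrow> F \<tau> = (\<Sum>i<length ws. s i (nome \<tau>) *s (Fs ! i) \<tau>))"
    and indep: "\<And>c \<tau>. Im \<tau> > 0 \<Longrightarrow> (\<Sum>i<length ws. c i *s (Fs ! i) \<tau>) = 0 \<Longrightarrow> \<forall>i<length ws. c i = 0"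
  shows "homogeneous_basis \<rho> Fs ws"
  unfolding homogeneous_basis_def len
proof (intro conjI ballI allI impI)
  define n where "n = length ws"
  have out: "(Fs ! i) \<tau> = 0" if "i < n" "\<not> Im \<tau> > 0" for i \<tau>
    using modular_forms_outside[OF mem] that by (simp add: n_def)
  have single: "\<exists>r. (\<forall>i<n. r i \<in> ring_E4_E6) \<and> (\<forall>\<tau>. F \<tau> = (\<Sum>i<n. r i \<tau> *s (Fs ! i) \<tau>))"
    if F: "F \<in> modular_forms \<rho> k" for k F
  proof -
    obtain s where s: "\<And>i. i < n \<Longrightarrow> modular_q (k - ws ! i) (s i)"
      "\<And>\<tau>. Im \<tau> > 0 \<Longrightarrow> F \<tau> = (\<Sum>i<n. s i (nome \<tau>) *s (Fs ! i) \<tau>)"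
      using span[OF F] by (auto simp: n_def)
    have "\<forall>i. \<exists>r. i < n \<longrightarrow> r \<in> ring_E4_E6 \<and> (\<forall>\<tau>. Im \<tau> > 0 \<longrightarrow> r \<tau> = s i (nome \<tau>))"
    proof (intro allI)
      show "\<exists>r. i < n \<longrightarrow> r \<in> ring_E4_E6 \<and> (\<forall>\<tau>. Im \<tau> > 0 \<longrightarrow> r \<tau> = s i (nome \<tau>))" for i
      proof (cases "i < n")
        case True
        then show ?thesis using modular_q_in_ring[OF s(1)[OF True]] by metis
      qed simp
    qed
    from choice[OF this] obtain r where r: "\<And>i. i < n \<Longrightarrow> r i \<in> ring_E4_E6"
      "\<And>i \<tau>. i < n \<Longrightarrow> Im \<tau> > 0 \<Longrightarrow> r i \<tau> = s i (nome \<tau>)" by blast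
    have "F \<tau> = (\<Sum>i<n. r i \<tau> *s (Fs ! i) \<tau>)" for \<tau>
    proof (cases "Im \<tau> > 0")
      case True
      then show ?thesis unfolding s(2)[OF True] by (intro sum.cong refl) (simp add: r(2))
    next
      case False
      then show ?thesis using out modular_forms_outside[OF F] by simp
    qed
    with r(1) show ?thesis by blast
  qed
  fix F assume "F \<in> all_modular_forms \<rho>"
  then obtain K f where K: "finite K" "\<And>k. k \<in> K \<Longrightarrow> f k \<in> modular_forms \<rho> k"
    and F: "F = (\<lambda>\<tau>. \<Sum>k\<in>K. f k \<tau>)"
    unfolding all_modular_forms_def by blast
  have "\<forall>k. \<exists>r. k \<in> K \<longrightarrow> (\<forall>i<n. r i \<in> ring_E4_E6) \<and> (\<forall>\<tau>. f k \<tau> = (\<Sum>i<n. r i \<tau> *s (Fs ! i) \<tau>))"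
    using single K(2) by blast
  from choice[OF this] obtain r where r: "\<And>k i. k \<in> K \<Longrightarrow> i < n \<Longrightarrow> r k i \<in> ring_E4_E6"
    "\<And>k \<tau>. k \<in> K \<Longrightarrow> f k \<tau> = (\<Sum>i<n. r k i \<tau> *s (Fs ! i) \<tau>)" by blast
  have "F \<tau> = (\<Sum>i<n. (\<Sum>k\<in>K. r k i \<tau>) *s (Fs ! i) \<tau>)" for \<tau>
  proof -
    have "F \<tau> = (\<Sum>k\<in>K. \<Sum>i<n. r k i \<tau> *s (Fs ! i) \<tau>)" unfolding F by (intro sum.cong refl r(2))
    then show ?thesis by (subst (asm) sum.swap) (simp add: vec.scale_sum_left)
  qed
  moreover have "(\<lambda>\<tau>. \<Sum>k\<in>K. r k i \<tau>) \<in> ring_E4_E6" if "i < n" for i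
    by (rule ring_E4_E6_sum[OF K(1)]) (rule r(1)[OF _ that])
  ultimately show "\<exists>r. (\<forall>i<length ws. r i \<in> ring_E4_E6) \<and> (\<forall>\<tau>. F \<tau> = (\<Sum>i<length ws. r i \<tau> *s (Fs ! i) \<tau>))"
    unfolding n_def[symmetric] by (intro exI[of _ "\<lambda>i \<tau>. \<Sum>k\<in>K. r k i \<tau>"] conjI allI impI)
next
  fix r i \<tau>
  assume "\<forall>\<tau>. (\<Sum>i<length ws. r i \<tau> *s (Fs ! i) \<tau>) = 0" "i < length ws" "\<tau> \<in> upper_half_plane"
  then show "r i \<tau> = 0" using indep[of \<tau> "\<lambda>i. r i \<tau>"] by (simp add: upper_half_plane_def)
qed (rule refl mem, assumption?)+

section \<open>Bases\<close>

lemma nome_twelfth: "nome (\<tau> / 12) ^ 12 = nome \<tau>"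
  by (simp add: nome_power)

lemma nome_minus_sixth: "nome (-1/6 * \<tau>) = 1 / nome (\<tau> / 12) ^ 2"
  using nome_minus[of "\<tau> / 6"] by (simp add: nome_power)

locale extension_form = normal_form \<rho> P Q a b x + eta_root G
  for \<rho> :: "int^2^2 \<Rightarrow> complex^2^2" and P Q :: "complex^2^2" and a b :: nat and x :: complex
    and G :: "complex \<Rightarrow> complex" +
  assumes x: "x \<noteq> 0" and signs: "(- \<i>) ^ b = - ((- \<i>) ^ a)"
begin

text \<open>The components are named as functions of \<tau>, so that the law under S can be checked
  on formulas in \<open>eta2\<close> and \<open>lift\<close>.\<close>

lemma vform_modularI:
  assumes hol: "\<phi> holomorphic_on ball 0 1" "\<psi> holomorphic_on ball 0 1"
    and \<Phi>: "\<And>\<tau>. Im \<tau> > 0 \<Longrightarrow> nome (\<tau> / 12) ^ a * \<phi> (nome \<tau>) = \<Phi> \<tau>"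
    and \<Psi>: "\<And>\<tau>. Im \<tau> > 0 \<Longrightarrow> nome (\<tau> / 12) ^ b * \<psi> (nome \<tau>) = \<Psi> \<tau>"
    and S1: "\<And>\<tau>. Im \<tau> > 0 \<Longrightarrow> \<Phi> (-1 / \<tau>) = \<tau> powi k * ((- \<i>) ^ a * \<Phi> \<tau> + x * \<Psi> \<tau>)"
    and S2: "\<And>\<tau>. Im \<tau> > 0 \<Longrightarrow> \<Psi> (-1 / \<tau>) = \<tau> powi k * ((- \<i>) ^ b * \<Psi> \<tau>)"
  obtains F where "F \<in> modular_forms \<rho> k" "\<And>\<tau>. Im \<tau> > 0 \<Longrightarrow> F \<tau> = V (\<Phi> \<tau>) (\<Psi> \<tau>)"
proof
  show "vform \<phi> \<psi> \<in> modular_forms \<rho> k"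
    by (rule vform_modular[OF hol])
       (simp_all only: \<Phi> \<Psi> minus_inverse_upper_half_plane S1 S2)
  show "vform \<phi> \<psi> \<tau> = V (\<Phi> \<tau>) (\<Psi> \<tau>)" if "Im \<tau> > 0" for \<tau>
    using that by (simp add: vform_def \<Phi> \<Psi>)
qed

lemma modular_form_componentsE:
  assumes F: "F \<in> modular_forms \<rho> k"
  obtains \<phi> \<psi> \<Phi> \<Psi> where "\<phi> holomorphic_on ball 0 1" "\<psi> holomorphic_on ball 0 1"
    "\<And>\<tau>. Im \<tau> > 0 \<Longrightarrow> \<Phi> \<tau> = nome (\<tau> / 12) ^ a * \<phi> (nome \<tau>)"
    "\<And>\<tau>. Im \<tau> > 0 \<Longrightarrow> \<Psi> \<tau> = nome (\<tau> / 12) ^ b * \<psi> (nome \<tau>)"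
    "\<And>\<tau>. Im \<tau> > 0 \<Longrightarrow> F \<tau> = V (\<Phi> \<tau>) (\<Psi> \<tau>)"
    "\<And>\<tau>. Im \<tau> > 0 \<Longrightarrow> \<Phi> (-1 / \<tau>) = \<tau> powi k * ((- \<i>) ^ a * \<Phi> \<tau> + x * \<Psi> \<tau>)"
    "\<And>\<tau>. Im \<tau> > 0 \<Longrightarrow> \<Psi> (-1 / \<tau>) = \<tau> powi k * ((- \<i>) ^ b * \<Psi> \<tau>)"
proof -
  obtain \<phi> \<psi> where *: "\<phi> holomorphic_on ball 0 1" "\<psi> holomorphic_on ball 0 1" "F = vform \<phi> \<psi>"
    "\<And>\<tau>. Im \<tau> > 0 \<Longrightarrow> nome (-1 / \<tau> / 12) ^ a * \<phi> (nome (-1 / \<tau>)) =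
      \<tau> powi k * ((- \<i>) ^ a * (nome (\<tau> / 12) ^ a * \<phi> (nome \<tau>)) + x * (nome (\<tau> / 12) ^ b * \<psi> (nome \<tau>)))"
    "\<And>\<tau>. Im \<tau> > 0 \<Longrightarrow> nome (-1 / \<tau> / 12) ^ b * \<psi> (nome (-1 / \<tau>)) =
      \<tau> powi k * ((- \<i>) ^ b * (nome (\<tau> / 12) ^ b * \<psi> (nome \<tau>)))"
    using modular_formE[OF F] by blast
  show ?thesis
    by (rule that[of \<phi> \<psi> "\<lambda>\<tau>. nome (\<tau> / 12) ^ a * \<phi> (nome \<tau>)" "\<lambda>\<tau>. nome (\<tau> / 12) ^ b * \<psi> (nome \<tau>)"])
       (use * in \<open>simp_all only: vform_def if_True\<close>)
qed

text \<open>The c-th power of \<open>eta2\<close> has weight c, the same character and order exactly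
  c/12 at the cusp, and it has no zeros. So the quotient is a form of level one.\<close>

lemma modular_q_divide_eta2:
  assumes hol: "\<phi> holomorphic_on ball 0 1"
    and \<Phi>: "\<And>\<tau>. Im \<tau> > 0 \<Longrightarrow> \<Phi> \<tau> = nome (\<tau> / 12) ^ c * \<phi> (nome \<tau>)"
    and S: "\<And>\<tau>. Im \<tau> > 0 \<Longrightarrow> \<Phi> (-1 / \<tau>) = \<tau> powi k * ((- \<i>) ^ c * \<Phi> \<tau>)"
  obtains r where "modular_q (k - int c) r" "\<And>\<tau>. Im \<tau> > 0 \<Longrightarrow> \<Phi> \<tau> = r (nome \<tau>) * eta2 \<tau> ^ c"
    "\<And>q. q \<in> ball 0 1 \<Longrightarrow> \<phi> q = r q * G q ^ c"
proof
  define r where "r q = \<phi> q / G q ^ c" for q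
  show \<phi>: "\<phi> q = r q * G q ^ c" if "q \<in> ball 0 1" for q
    using G(2)[OF that] by (simp add: r_def)
  show r: "\<Phi> \<tau> = r (nome \<tau>) * eta2 \<tau> ^ c" if "Im \<tau> > 0" for \<tau>
    using \<phi>[of "nome \<tau>"] that by (simp add: \<Phi> eta2_def power_mult_distrib)
  show "modular_q (k - int c) r"
    unfolding modular_q_def
  proof (intro conjI allI impI)
    show "r holomorphic_on ball 0 1"
      unfolding r_def using G(2) by (intro holomorphic_intros hol G(1)) auto
    fix \<tau> :: complex assume \<tau>: "Im \<tau> > 0"
    then have nz: "\<tau> \<noteq> 0" by auto
    have "r (nome (-1 / \<tau>)) * ((- \<i>) ^ c * \<tau> ^ c * eta2 \<tau> ^ c) = \<tau> powi k * ((- \<i>) ^ c * (r (nome \<tau>) * eta2 \<tau> ^ c))"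
      using S[OF \<tau>] unfolding r[OF \<tau>] r[OF minus_inverse_upper_half_plane[OF \<tau>]] eta2_S_power[OF \<tau>] .
    then have "r (nome (-1 / \<tau>)) * \<tau> ^ c = \<tau> powi k * r (nome \<tau>)"
      using eta2_nonzero[OF \<tau>] by (simp add: mult_ac)
    then show "r (nome (-1 / \<tau>)) = \<tau> powi (k - int c) * r (nome \<tau>)"
      using nz by (simp add: power_int_diff field_simps)
  qed
qed

context
  fixes \<mu> K :: complex and H :: "complex \<Rightarrow> complex"
  assumes H: "H holomorphic_on ball 0 1" and K: "K \<noteq> 0"
    and HS: "\<And>\<tau>. Im \<tau> > 0 \<Longrightarrow> nome (\<mu> * (-1 / \<tau>)) * H (nome (-1 / \<tau>)) = K - nome (\<mu> * \<tau>) * H (nome \<tau>)"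
begin

text \<open>The constant is chosen such that the pair \<open>(lift f, f)\<close> with \<open>f = \<eta>\<^bsup>2b\<^esup>\<close> transforms by \<open>\<rho>\<close>.\<close>

definition \<kappa> :: complex where "\<kappa> = x / ((- \<i>) ^ b * K)"
definition lift :: "complex \<Rightarrow> complex" where "lift \<tau> = \<kappa> * (nome (\<mu> * \<tau>) * H (nome \<tau>))"

lemma lift_S: "Im \<tau> > 0 \<Longrightarrow> (- \<i>) ^ b * lift (-1 / \<tau>) = (- \<i>) ^ a * lift \<tau> + x"
proof -
  assume \<tau>: "Im \<tau> > 0"
  have "(- \<i>) ^ b * lift (-1 / \<tau>) = (- \<i>) ^ b * \<kappa> * K - (- \<i>) ^ b * lift \<tau>"
    unfolding lift_def HS[OF \<tau>] by (simp add: algebra_simps)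
  also have "(- \<i>) ^ b * \<kappa> * K = x" using K by (simp add: \<kappa>_def)
  finally show ?thesis by (simp add: signs)
qed

text \<open>The hypothesis reads \<mu> + b/12 = a/12 + n: the first component of the lifted vector
  exceeds the required order at the cusp by at least n. So the lift \<open>F2\<close> is a form, and
  subtracting the multiple of it with the same second component leaves a scalar multiple of
  \<open>F1\<close>.\<close>

lemma regular_basis:
  assumes n: "\<And>\<tau>. nome (\<mu> * \<tau>) * nome (\<tau> / 12) ^ b = nome (\<tau> / 12) ^ a * nome \<tau> ^ n"
  shows "\<exists>Fs. homogeneous_basis \<rho> Fs [int a, int b]"
proof -
  obtain F1 where F1: "F1 \<in> modular_forms \<rho> (int a)" "\<And>\<tau>. Im \<tau> > 0 \<Longrightarrow> F1 \<tau> = V (eta2 \<tau> ^ a) 0"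
  proof (rule vform_modularI[of "\<lambda>q. G q ^ a" "\<lambda>q. 0" "\<lambda>\<tau>. eta2 \<tau> ^ a" "\<lambda>\<tau>. 0" "int a"])
    show "(\<lambda>q. G q ^ a) holomorphic_on ball 0 1" by (intro holomorphic_intros G)
    fix \<tau> :: complex assume \<tau>: "Im \<tau> > 0"
    show "nome (\<tau> / 12) ^ a * G (nome \<tau>) ^ a = eta2 \<tau> ^ a" by (simp add: eta2_def power_mult_distrib)
    show "eta2 (-1 / \<tau>) ^ a = \<tau> powi int a * ((- \<i>) ^ a * eta2 \<tau> ^ a + x * 0)"
      unfolding eta2_S_power[OF \<tau>] by (simp add: mult_ac)
  qed simp_all
  obtain F2 where F2: "F2 \<in> modular_forms \<rho> (int b)"
    "\<And>\<tau>. Im \<tau> > 0 \<Longrightarrow> F2 \<tau> = V (lift \<tau> * eta2 \<tau> ^ b) (eta2 \<tau> ^ b)"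
  proof (rule vform_modularI)
    show "(\<lambda>q. \<kappa> * q ^ n * H q * G q ^ b) holomorphic_on ball 0 1" "(\<lambda>q. G q ^ b) holomorphic_on ball 0 1"
      by (intro holomorphic_intros G H)+
    fix \<tau> :: complex assume \<tau>: "Im \<tau> > 0"
    have "nome (\<tau> / 12) ^ a * (\<kappa> * nome \<tau> ^ n * H (nome \<tau>) * G (nome \<tau>) ^ b) =
        \<kappa> * (nome (\<tau> / 12) ^ a * nome \<tau> ^ n) * H (nome \<tau>) * G (nome \<tau>) ^ b"
      by (simp only: mult_ac)
    also have "\<dots> = lift \<tau> * eta2 \<tau> ^ b"
      unfolding n[symmetric] by (simp only: lift_def eta2_def power_mult_distrib mult_ac)
    finally show "nome (\<tau> / 12) ^ a * (\<kappa> * nome \<tau> ^ n * H (nome \<tau>) * G (nome \<tau>) ^ b) = lift \<tau> * eta2 \<tau> ^ b" .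
    show "nome (\<tau> / 12) ^ b * G (nome \<tau>) ^ b = eta2 \<tau> ^ b" by (simp add: eta2_def power_mult_distrib)
    show "eta2 (-1 / \<tau>) ^ b = \<tau> powi int b * ((- \<i>) ^ b * eta2 \<tau> ^ b)"
      unfolding eta2_S_power[OF \<tau>] by (simp add: mult_ac)
    have "lift (-1 / \<tau>) * eta2 (-1 / \<tau>) ^ b = ((- \<i>) ^ b * lift (-1 / \<tau>)) * (\<tau> ^ b * eta2 \<tau> ^ b)"
      unfolding eta2_S_power[OF \<tau>] by (simp only: mult_ac)
    also have "\<dots> = \<tau> powi int b * ((- \<i>) ^ a * (lift \<tau> * eta2 \<tau> ^ b) + x * eta2 \<tau> ^ b)"
      unfolding lift_S[OF \<tau>] by (simp add: ring_distribs mult_ac)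
    finally show "lift (-1 / \<tau>) * eta2 (-1 / \<tau>) ^ b =
        \<tau> powi int b * ((- \<i>) ^ a * (lift \<tau> * eta2 \<tau> ^ b) + x * eta2 \<tau> ^ b)" .
  qed blast
  have "homogeneous_basis \<rho> [F1, F2] [int a, int b]"
  proof (rule homogeneous_basisI)
    show "[F1, F2] ! i \<in> modular_forms \<rho> ([int a, int b] ! i)" if "i < length [int a, int b]" for i
      using that F1(1) F2(1) by (auto simp: less_Suc_eq)
    show "\<exists>s. (\<forall>i<length [int a, int b]. modular_q (l - [int a, int b] ! i) (s i)) \<and>
        (\<forall>\<tau>. Im \<tau> > 0 \<longrightarrow> F \<tau> = (\<Sum>i<length [int a, int b]. s i (nome \<tau>) *s ([F1, F2] ! i) \<tau>))"
      if F: "F \<in> modular_forms \<rho> l" for l F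
    proof -
      obtain \<phi> \<psi> \<Phi> \<Psi> where c: "\<phi> holomorphic_on ball 0 1" "\<psi> holomorphic_on ball 0 1"
        "\<And>\<tau>. Im \<tau> > 0 \<Longrightarrow> \<Phi> \<tau> = nome (\<tau> / 12) ^ a * \<phi> (nome \<tau>)"
        "\<And>\<tau>. Im \<tau> > 0 \<Longrightarrow> \<Psi> \<tau> = nome (\<tau> / 12) ^ b * \<psi> (nome \<tau>)"
        "\<And>\<tau>. Im \<tau> > 0 \<Longrightarrow> F \<tau> = V (\<Phi> \<tau>) (\<Psi> \<tau>)"
        "\<And>\<tau>. Im \<tau> > 0 \<Longrightarrow> \<Psi> (-1 / \<tau>) = \<tau> powi l * ((- \<i>) ^ b * \<Psi> \<tau>)"
        by (rule modular_form_componentsE[OF F]) blast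
      obtain r where r: "modular_q (l - int b) r" "\<And>\<tau>. Im \<tau> > 0 \<Longrightarrow> \<Psi> \<tau> = r (nome \<tau>) * eta2 \<tau> ^ b"
        using modular_q_divide_eta2[OF c(2,4,6)] by metis
      have "(\<lambda>\<tau>. F \<tau> - r (nome \<tau>) *s F2 \<tau>) \<in> modular_forms \<rho> l"
        by (intro modular_forms_diff F modular_forms_mult[OF F2(1) r(1)]) simp
      then obtain \<phi>' \<psi>' \<Phi>' \<Psi>' where c': "\<phi>' holomorphic_on ball 0 1" "\<psi>' holomorphic_on ball 0 1"
        "\<And>\<tau>. Im \<tau> > 0 \<Longrightarrow> \<Phi>' \<tau> = nome (\<tau> / 12) ^ a * \<phi>' (nome \<tau>)"
        "\<And>\<tau>. Im \<tau> > 0 \<Longrightarrow> \<Psi>' \<tau> = nome (\<tau> / 12) ^ b * \<psi>' (nome \<tau>)"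
        "\<And>\<tau>. Im \<tau> > 0 \<Longrightarrow> F \<tau> - r (nome \<tau>) *s F2 \<tau> = V (\<Phi>' \<tau>) (\<Psi>' \<tau>)"
        "\<And>\<tau>. Im \<tau> > 0 \<Longrightarrow> \<Phi>' (-1 / \<tau>) = \<tau> powi l * ((- \<i>) ^ a * \<Phi>' \<tau> + x * \<Psi>' \<tau>)"
        by (rule modular_form_componentsE) blast
      have Fr: "F \<tau> = V (\<Phi>' \<tau> + r (nome \<tau>) * (lift \<tau> * eta2 \<tau> ^ b)) (\<Psi>' \<tau> + r (nome \<tau>) * eta2 \<tau> ^ b)"
        if "Im \<tau> > 0" for \<tau>
        using c'(5)[OF that] by (simp add: F2(2)[OF that] V_scale diff_eq_eq V_add)
      have \<Psi>': "\<Psi>' \<tau> = 0" if "Im \<tau> > 0" for \<tau>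
        using Fr[OF that] unfolding c(5)[OF that] V_eq_iff r(2)[OF that] by simp
      have "\<Phi>' (-1 / \<tau>) = \<tau> powi l * ((- \<i>) ^ a * \<Phi>' \<tau>)" if "Im \<tau> > 0" for \<tau>
        using c'(6)[OF that] \<Psi>'[OF that] by simp
      then obtain s where s: "modular_q (l - int a) s" "\<And>\<tau>. Im \<tau> > 0 \<Longrightarrow> \<Phi>' \<tau> = s (nome \<tau>) * eta2 \<tau> ^ a"
        using modular_q_divide_eta2[OF c'(1,3)] by metis
      have "F \<tau> = s (nome \<tau>) *s F1 \<tau> + r (nome \<tau>) *s F2 \<tau>" if "Im \<tau> > 0" for \<tau>
        unfolding Fr[OF that] \<Psi>'[OF that] s(2)[OF that] F1(2)[OF that] F2(2)[OF that] V_scale V_add by simp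
      then show ?thesis
        using r(1) s(1) by (intro exI[of _ "\<lambda>i. if i = 0 then s else r"]) (auto simp: less_Suc_eq)
    qed
    show "\<forall>i<length [int a, int b]. c i = 0"
      if \<tau>: "Im \<tau> > 0" and "(\<Sum>i<length [int a, int b]. c i *s ([F1, F2] ! i) \<tau>) = 0" for c \<tau>
    proof -
      have "c 0 *s F1 \<tau> + c 1 *s F2 \<tau> = 0" using that(2) by simp
      then have "V (c 0 * eta2 \<tau> ^ a + c 1 * (lift \<tau> * eta2 \<tau> ^ b)) (c 1 * eta2 \<tau> ^ b) = V 0 0"
        unfolding F1(2)[OF \<tau>] F2(2)[OF \<tau>] V_scale V_add V_0 by simp
      then have "c 0 = 0 \<and> c 1 = 0" using eta2_nonzero[OF \<tau>] by (auto simp: V_eq_iff)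
      then show ?thesis by (auto simp: less_Suc_eq)
    qed
  qed simp
  then show ?thesis by blast
qed

section \<open>The exceptional case\<close>

text \<open>If \<open>a = b + 10\<close>, then the first component of \<open>(lift f, f)\<close> has a pole at the cusp. It has to be cancelled by a multiple of \<open>\<eta>\<^bsup>-4\<^esup> f\<close>,
  so that forms of weight \<open>b + l\<close> correspond to pairs of forms \<open>r, u\<close> of weights \<open>l, l + 2\<close> whose
  constant terms satisfy one linear relation.\<close>

lemma exceptional_form:
  assumes ab10: "a = b + 10" and \<mu>: "\<mu> = -1/6"
    and r: "modular_q l r" and u: "modular_q (l + 2) u" and ru: "\<kappa> * H 0 * G 0 ^ 2 * r 0 + u 0 = 0"
  obtains F where "F \<in> modular_forms \<rho> (int b + l)"
    "\<And>\<tau>. Im \<tau> > 0 \<Longrightarrow> F \<tau> = V ((lift \<tau> * r (nome \<tau>) + u (nome \<tau>) / eta2 \<tau> ^ 2) * eta2 \<tau> ^ b) (r (nome \<tau>) * eta2 \<tau> ^ b)"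
proof -
  \<comment> \<open>The first component is q^((b - 2)/12) B(q), while order at least a/12 = (b -
    2)/12 + 1 is required. So B must vanish at 0, which is the relation between the constant
    terms.\<close>
  define B where "B q = (\<kappa> * H q * r q + u q / G q ^ 2) * G q ^ b" for q
  have "B holomorphic_on ball 0 1"
    unfolding B_def using G(2) by (intro holomorphic_intros G(1) H modular_q_holomorphic[OF r] modular_q_holomorphic[OF u]) auto
  moreover have "B 0 = 0"
  proof -
    have "u 0 = - (\<kappa> * H 0 * G 0 ^ 2 * r 0)" using ru by (simp add: add_eq_0_iff)
    then show ?thesis using G(2)[of 0] by (simp add: B_def)
  qed
  ultimately obtain \<phi> where \<phi>: "\<phi> holomorphic_on ball 0 1" "\<And>q. q \<in> ball 0 1 \<Longrightarrow> B q = (q - 0) * \<phi> q"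
    using holomorphic_factor_root[of B "ball 0 1" 0] by blast
  show ?thesis
  proof (rule vform_modularI[OF \<phi>(1), of "\<lambda>q. r q * G q ^ b"
      "\<lambda>\<tau>. (lift \<tau> * r (nome \<tau>) + u (nome \<tau>) / eta2 \<tau> ^ 2) * eta2 \<tau> ^ b" "\<lambda>\<tau>. r (nome \<tau>) * eta2 \<tau> ^ b"])
    show "(\<lambda>q. r q * G q ^ b) holomorphic_on ball 0 1"
      by (intro holomorphic_intros G(1) modular_q_holomorphic[OF r])
    fix \<tau> :: complex assume \<tau>: "Im \<tau> > 0"
    then have nz: "\<tau> \<noteq> 0" by auto
    define N where "N = nome (\<tau> / 12)"
    have N: "N \<noteq> 0" "nome \<tau> = N ^ 12" "nome (\<mu> * \<tau>) = 1 / N ^ 2"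
      unfolding \<mu> by (simp_all only: N_def nome_nonzero nome_twelfth nome_minus_sixth not_False_eq_True)
    have q: "nome \<tau> \<in> ball 0 1" using \<tau> by simp
    have "B (nome \<tau>) = N ^ 12 * \<phi> (nome \<tau>)" by (simp only: \<phi>(2)[OF q] N(2)[symmetric] diff_zero)
    then have "N ^ a * \<phi> (nome \<tau>) = N ^ b * (B (nome \<tau>) / N ^ 2)"
      using N(1) by (simp add: ab10 power_add field_simps flip: power_add)
    also have "\<dots> = (lift \<tau> * r (nome \<tau>) + u (nome \<tau>) / eta2 \<tau> ^ 2) * eta2 \<tau> ^ b"
      unfolding lift_def N(3) eta2_def N_def[symmetric] power_mult_distrib B_def using N(1)
      by (simp add: field_simps)
    finally show "nome (\<tau> / 12) ^ a * \<phi> (nome \<tau>) = (lift \<tau> * r (nome \<tau>) + u (nome \<tau>) / eta2 \<tau> ^ 2) * eta2 \<tau> ^ b"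
      by (simp only: N_def)
    show "nome (\<tau> / 12) ^ b * (r (nome \<tau>) * G (nome \<tau>) ^ b) = r (nome \<tau>) * eta2 \<tau> ^ b"
      by (simp add: eta2_def power_mult_distrib)
    have p: "\<tau> powi (int b + l) = \<tau> ^ b * \<tau> powi l" using nz by (simp add: power_int_add)
    show "r (nome (-1 / \<tau>)) * eta2 (-1 / \<tau>) ^ b = \<tau> powi (int b + l) * ((- \<i>) ^ b * (r (nome \<tau>) * eta2 \<tau> ^ b))"
      unfolding eta2_S_power[OF \<tau>] modular_q_S[OF r \<tau>] p by (simp only: mult_ac)
    have e2: "u (nome (-1 / \<tau>)) / eta2 (-1 / \<tau>) ^ 2 = - (\<tau> powi l * (u (nome \<tau>) / eta2 \<tau> ^ 2))"
    proof -
      have "\<tau> powi (l + 2) = \<tau> powi l * \<tau>\<^sup>2" using nz by (simp add: power_int_add)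
      then show ?thesis
        unfolding eta2_S_power[OF \<tau>] modular_q_S[OF u \<tau>] using nz by simp
    qed
    have "(lift (-1 / \<tau>) * r (nome (-1 / \<tau>)) + u (nome (-1 / \<tau>)) / eta2 (-1 / \<tau>) ^ 2) * eta2 (-1 / \<tau>) ^ b =
      (lift (-1 / \<tau>) * r (nome (-1 / \<tau>)) - \<tau> powi l * (u (nome \<tau>) / eta2 \<tau> ^ 2)) * eta2 (-1 / \<tau>) ^ b"
      by (simp only: e2 diff_conv_add_uminus)
    also have "\<dots> = \<tau> ^ b * \<tau> powi l * (((- \<i>) ^ b * lift (-1 / \<tau>)) * r (nome \<tau>) - (- \<i>) ^ b * (u (nome \<tau>) / eta2 \<tau> ^ 2)) * eta2 \<tau> ^ b"
      unfolding eta2_S_power[OF \<tau>] modular_q_S[OF r \<tau>] by (simp add: ring_distribs mult_ac)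
    also have "\<dots> = \<tau> powi (int b + l) * ((- \<i>) ^ a * ((lift \<tau> * r (nome \<tau>) + u (nome \<tau>) / eta2 \<tau> ^ 2) * eta2 \<tau> ^ b) + x * (r (nome \<tau>) * eta2 \<tau> ^ b))"
      unfolding lift_S[OF \<tau>] p by (simp add: signs ring_distribs mult_ac)
    finally show "(lift (-1 / \<tau>) * r (nome (-1 / \<tau>)) + u (nome (-1 / \<tau>)) / eta2 (-1 / \<tau>) ^ 2) * eta2 (-1 / \<tau>) ^ b =
      \<tau> powi (int b + l) * ((- \<i>) ^ a * ((lift \<tau> * r (nome \<tau>) + u (nome \<tau>) / eta2 \<tau> ^ 2) * eta2 \<tau> ^ b) + x * (r (nome \<tau>) * eta2 \<tau> ^ b))" .
  qed (rule that)
qed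

text \<open>Conversely to \<open>exceptional_form\<close>, r and u are recovered from a form. The
  inhomogeneous term x in the law of the first component is cancelled by that of
  \<open>lift\<close>, so that u is a genuine scalar form.\<close>

lemma exceptional_components:
  assumes ab10: "a = b + 10" and \<mu>: "\<mu> = -1/6" and F: "F \<in> modular_forms \<rho> l"
  obtains r u where "modular_q (l - int b) r" "modular_q (l - int b + 2) u"
    "\<kappa> * H 0 * G 0 ^ 2 * r 0 + u 0 = 0"
    "\<And>\<tau>. Im \<tau> > 0 \<Longrightarrow> F \<tau> = V ((lift \<tau> * r (nome \<tau>) + u (nome \<tau>) / eta2 \<tau> ^ 2) * eta2 \<tau> ^ b) (r (nome \<tau>) * eta2 \<tau> ^ b)"
proof -
  obtain \<phi> \<psi> \<Phi> \<Psi> where c: "\<phi> holomorphic_on ball 0 1" "\<psi> holomorphic_on ball 0 1"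
    "\<And>\<tau>. Im \<tau> > 0 \<Longrightarrow> \<Phi> \<tau> = nome (\<tau> / 12) ^ a * \<phi> (nome \<tau>)"
    "\<And>\<tau>. Im \<tau> > 0 \<Longrightarrow> \<Psi> \<tau> = nome (\<tau> / 12) ^ b * \<psi> (nome \<tau>)"
    "\<And>\<tau>. Im \<tau> > 0 \<Longrightarrow> F \<tau> = V (\<Phi> \<tau>) (\<Psi> \<tau>)"
    "\<And>\<tau>. Im \<tau> > 0 \<Longrightarrow> \<Phi> (-1 / \<tau>) = \<tau> powi l * ((- \<i>) ^ a * \<Phi> \<tau> + x * \<Psi> \<tau>)"
    "\<And>\<tau>. Im \<tau> > 0 \<Longrightarrow> \<Psi> (-1 / \<tau>) = \<tau> powi l * ((- \<i>) ^ b * \<Psi> \<tau>)"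
    by (rule modular_form_componentsE[OF F]) blast
  obtain r where r: "modular_q (l - int b) r" "\<And>\<tau>. Im \<tau> > 0 \<Longrightarrow> \<Psi> \<tau> = r (nome \<tau>) * eta2 \<tau> ^ b"
    using modular_q_divide_eta2[OF c(2,4,7)] by metis
  \<comment> \<open>In terms of q this removes the fractional powers: a - b + 2 = 12 of them make up
    the factor q in front of \<phi>. Hence \<phi> drops out at q = 0 and the linear relation
    results.\<close>
  define u where "u q = (q * \<phi> q / G q ^ b - \<kappa> * H q * r q) * G q ^ 2" for q
  have u: "u (nome \<tau>) = (\<Phi> \<tau> / eta2 \<tau> ^ b - lift \<tau> * r (nome \<tau>)) * eta2 \<tau> ^ 2" if \<tau>: "Im \<tau> > 0" for \<tau>
  proof -
    define N where "N = nome (\<tau> / 12)"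
    have N: "N \<noteq> 0" "nome (\<mu> * \<tau>) = 1 / N ^ 2"
      unfolding \<mu> by (simp_all only: N_def nome_nonzero nome_minus_sixth not_False_eq_True)
    have q: "nome \<tau> = N ^ 12" by (simp only: N_def nome_twelfth)
    have G0: "G (nome \<tau>) \<noteq> 0" using G(2)[of "nome \<tau>"] \<tau> by simp
    have e1: "\<Phi> \<tau> / eta2 \<tau> ^ b * eta2 \<tau> ^ 2 = nome \<tau> * \<phi> (nome \<tau>) / G (nome \<tau>) ^ b * G (nome \<tau>) ^ 2"
    proof -
      have "\<Phi> \<tau> / eta2 \<tau> ^ b = N ^ 10 * \<phi> (nome \<tau>) / G (nome \<tau>) ^ b"
        unfolding c(3)[OF \<tau>] eta2_def N_def[symmetric] ab10 using N(1) G0 by (simp add: power_add power_mult_distrib)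
      moreover have "N ^ 10 * N ^ 2 = nome \<tau>" unfolding q by (simp flip: power_add)
      ultimately show ?thesis
        by (simp add: eta2_def power_mult_distrib flip: N_def)
    qed
    have e2: "lift \<tau> * eta2 \<tau> ^ 2 = \<kappa> * H (nome \<tau>) * G (nome \<tau>) ^ 2"
      unfolding lift_def eta2_def N_def[symmetric] N(2) power_mult_distrib using N(1) by simp
    have "(\<Phi> \<tau> / eta2 \<tau> ^ b - lift \<tau> * r (nome \<tau>)) * eta2 \<tau> ^ 2 =
        \<Phi> \<tau> / eta2 \<tau> ^ b * eta2 \<tau> ^ 2 - (lift \<tau> * eta2 \<tau> ^ 2) * r (nome \<tau>)"
      by (simp add: algebra_simps)
    also have "\<dots> = u (nome \<tau>)"
      unfolding e1 e2 u_def by (simp add: algebra_simps)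
    finally show ?thesis by simp
  qed
  have "modular_q (l - int b + 2) u"
    unfolding modular_q_def
  proof (intro conjI allI impI)
    show "u holomorphic_on ball 0 1"
      unfolding u_def using G(2) by (intro holomorphic_intros c(1) G(1) H modular_q_holomorphic[OF r(1)]) auto
    fix \<tau> :: complex assume \<tau>: "Im \<tau> > 0"
    then have nz: "\<tau> \<noteq> 0" by auto
    define i t e where "i = (- \<i>) ^ b" and "t = \<tau> powi (l - int b)" and "e = eta2 \<tau> ^ b"
    have i: "i \<noteq> 0" and e: "e \<noteq> 0" using eta2_nonzero[OF \<tau>] by (simp_all add: i_def e_def)
    have ia: "(- \<i>) ^ a = - i" and i2: "(- \<i>) ^ 2 = -1" using signs by (simp_all add: i_def)
    have tl: "\<tau> powi l = t * \<tau> ^ b" using nz by (simp add: t_def power_int_diff)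
    have pw: "\<tau> powi (l - int b + 2) = t * \<tau>\<^sup>2" unfolding t_def using nz by (subst power_int_add) auto
    have us: "u (nome (-1 / \<tau>)) = - ((t * \<tau> ^ b * (- i * \<Phi> \<tau> + x * (r (nome \<tau>) * e))) / (i * \<tau> ^ b * e)
        - lift (-1 / \<tau>) * (t * r (nome \<tau>))) * (\<tau>\<^sup>2 * eta2 \<tau> ^ 2)"
      unfolding u[OF minus_inverse_upper_half_plane[OF \<tau>]] c(6)[OF \<tau>] eta2_S_power[OF \<tau>]
        modular_q_S[OF r(1) \<tau>] r(2)[OF \<tau>] tl ia i2 i_def[symmetric] e_def[symmetric] t_def[symmetric]
      by (simp only: mult_minus_left mult_minus_right mult_1_left)
    have fr: "(t * \<tau> ^ b * (- i * \<Phi> \<tau> + x * (r (nome \<tau>) * e))) / (i * \<tau> ^ b * e) =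
        t * (x / i * r (nome \<tau>) - \<Phi> \<tau> / e)"
      using i e nz by (simp add: field_simps)
    have ks: "lift (-1 / \<tau>) = x / i - lift \<tau>"
    proof -
      define k' where "k' = lift (-1 / \<tau>)"
      have "i * k' = - i * lift \<tau> + x" using lift_S[OF \<tau>] unfolding ia i_def[symmetric] k'_def .
      then have "k' = x / i - lift \<tau>" using i by (simp add: field_simps)
      then show ?thesis by (simp only: k'_def)
    qed
    have "u (nome (-1 / \<tau>)) =
        - (t * (x / i * r (nome \<tau>) - \<Phi> \<tau> / e) - (x / i - lift \<tau>) * (t * r (nome \<tau>))) * (\<tau>\<^sup>2 * eta2 \<tau> ^ 2)"
      by (simp only: us fr ks)
    also have "\<dots> = t * \<tau>\<^sup>2 * ((\<Phi> \<tau> / e - lift \<tau> * r (nome \<tau>)) * eta2 \<tau> ^ 2)"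
      by (simp add: algebra_simps)
    finally show "u (nome (-1 / \<tau>)) = \<tau> powi (l - int b + 2) * u (nome \<tau>)"
      unfolding u[OF \<tau>] pw e_def[symmetric] .
  qed
  moreover have "\<kappa> * H 0 * G 0 ^ 2 * r 0 + u 0 = 0" by (simp add: u_def)
  moreover have "F \<tau> = V ((lift \<tau> * r (nome \<tau>) + u (nome \<tau>) / eta2 \<tau> ^ 2) * eta2 \<tau> ^ b) (r (nome \<tau>) * eta2 \<tau> ^ b)"
    if "Im \<tau> > 0" for \<tau>
    unfolding c(5)[OF that] r(2)[OF that] u[OF that] using eta2_nonzero[OF that] by simp
  ultimately show ?thesis using that r(1) by blast
qed

text \<open>With v = u / t the condition is r(0) = v(0). The pairs (E4, E6) and (E6, E4^2) satisfy
  it and have the discriminant as determinant. In Cramer's rule for a pair (r, v) the numerators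
  vanish at the cusp precisely because of the condition, so both are divisible by the
  discriminant.\<close>

lemma exceptional_basis:
  assumes ab10: "a = b + 10" and \<mu>: "\<mu> = -1/6" and H0: "H 0 \<noteq> 0"
  shows "\<exists>Fs. homogeneous_basis \<rho> Fs [int b + 4, int b + 6]"
proof -
  define t where "t = - (\<kappa> * H 0 * G 0 ^ 2)"
  have t: "t \<noteq> 0" using H0 x K G(2)[of 0] by (simp add: t_def \<kappa>_def)
  let ?V = "\<lambda>r u \<tau>. V ((lift \<tau> * r + u / eta2 \<tau> ^ 2) * eta2 \<tau> ^ b) (r * eta2 \<tau> ^ b)"
  have lin: "c *s ?V r u \<tau> + d *s ?V r' u' \<tau> = ?V (c * r + d * r') (c * u + d * u') \<tau>" for c d r u r' u' \<tau>
    unfolding V_scale V_add by (simp add: algebra_simps add_divide_distrib)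
  obtain F1 where F1: "F1 \<in> modular_forms \<rho> (int b + 4)"
    "\<And>\<tau>. Im \<tau> > 0 \<Longrightarrow> F1 \<tau> = ?V (E4 (nome \<tau>)) (t * E6 (nome \<tau>)) \<tau>"
  proof (rule exceptional_form[OF ab10 \<mu> modular_q_E4, of "\<lambda>q. t * E6 q"])
    show "modular_q (4 + 2) (\<lambda>q. t * E6 q)" using modular_q_cmult[OF modular_q_E6, of t] by simp
    show "\<kappa> * H 0 * G 0 ^ 2 * E4 0 + t * E6 0 = 0" by (simp add: t_def)
  qed blast
  obtain F2 where F2: "F2 \<in> modular_forms \<rho> (int b + 6)"
    "\<And>\<tau>. Im \<tau> > 0 \<Longrightarrow> F2 \<tau> = ?V (E6 (nome \<tau>)) (t * E4 (nome \<tau>) ^ 2) \<tau>"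
  proof (rule exceptional_form[OF ab10 \<mu> modular_q_E6, of "\<lambda>q. t * E4 q ^ 2"])
    show "modular_q (6 + 2) (\<lambda>q. t * E4 q ^ 2)"
      by (rule modular_q_cmult[OF modular_q_power[OF modular_q_E4]]) simp
    show "\<kappa> * H 0 * G 0 ^ 2 * E6 0 + t * E4 0 ^ 2 = 0" by (simp add: t_def)
  qed blast
  have "homogeneous_basis \<rho> [F1, F2] [int b + 4, int b + 6]"
  proof (rule homogeneous_basisI)
    show "[F1, F2] ! i \<in> modular_forms \<rho> ([int b + 4, int b + 6] ! i)" if "i < length [int b + 4, int b + 6]" for i
      using that F1(1) F2(1) by (auto simp: less_Suc_eq)
    show "\<exists>s. (\<forall>i<length [int b + 4, int b + 6]. modular_q (l - [int b + 4, int b + 6] ! i) (s i)) \<and>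
        (\<forall>\<tau>. Im \<tau> > 0 \<longrightarrow> F \<tau> = (\<Sum>i<length [int b + 4, int b + 6]. s i (nome \<tau>) *s ([F1, F2] ! i) \<tau>))"
      if F: "F \<in> modular_forms \<rho> l" for l F
    proof -
      obtain r u where r: "modular_q (l - int b) r" and u: "modular_q (l - int b + 2) u"
        and ru: "\<kappa> * H 0 * G 0 ^ 2 * r 0 + u 0 = 0"
        and Fru: "\<And>\<tau>. Im \<tau> > 0 \<Longrightarrow> F \<tau> = ?V (r (nome \<tau>)) (u (nome \<tau>)) \<tau>"
        by (rule exceptional_components[OF ab10 \<mu> F]) blast
      define v where "v q = 1 / t * u q" for q
      have v: "modular_q (l - int b + 2) v" unfolding v_def[abs_def] by (rule modular_q_cmult[OF u])
      have ut: "u q = t * v q" for q using t by (simp add: v_def)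
      have v0: "v 0 = r 0"
      proof -
        have "\<kappa> * H 0 * G 0 ^ 2 = - t" by (simp add: t_def)
        then have "- t * r 0 + t * v 0 = 0" using ru by (simp only: ut)
        then have "t * (v 0 - r 0) = 0" by (simp add: algebra_simps)
        then show ?thesis using t by simp
      qed
      have "modular_q (l - int b + 8) (\<lambda>q. r q * E4 q ^ 2 - v q * E6 q)"
        by (rule modular_q_diff; rule modular_q_mult[OF r modular_q_power[OF modular_q_E4 refl]]
            modular_q_mult[OF v modular_q_E6]) simp_all
      moreover have "r 0 * E4 0 ^ 2 - v 0 * E6 0 = 0" by (simp add: v0)
      ultimately obtain X where X: "modular_q (l - int b + 8 - 12) X"
          "\<And>q. q \<in> ball 0 1 \<Longrightarrow> r q * E4 q ^ 2 - v q * E6 q = delta_q q * X q"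
        by (rule modular_q_divide_delta) blast
      have "modular_q (l - int b + 6) (\<lambda>q. v q * E4 q - r q * E6 q)"
        by (rule modular_q_diff; rule modular_q_mult[OF v modular_q_E4]
            modular_q_mult[OF r modular_q_E6]) simp_all
      moreover have "v 0 * E4 0 - r 0 * E6 0 = 0" by (simp add: v0)
      ultimately obtain Y where Y: "modular_q (l - int b + 6 - 12) Y"
          "\<And>q. q \<in> ball 0 1 \<Longrightarrow> v q * E4 q - r q * E6 q = delta_q q * Y q"
        by (rule modular_q_divide_delta) blast
      have "F \<tau> = X (nome \<tau>) *s F1 \<tau> + Y (nome \<tau>) *s F2 \<tau>" if \<tau>: "Im \<tau> > 0" for \<tau>
      proof -
        define q where "q = nome \<tau>"
        have q: "q \<in> ball 0 1" "q \<noteq> 0" using \<tau> by (simp_all add: q_def)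
        note XY = X(2)[OF q(1)] Y(2)[OF q(1)]
        have "delta_q q * (X q * E4 q + Y q * E6 q) =
            (r q * E4 q ^ 2 - v q * E6 q) * E4 q + (v q * E4 q - r q * E6 q) * E6 q"
          unfolding XY by (simp only: ring_distribs mult_ac)
        also have "\<dots> = delta_q q * r q" unfolding delta_q_def by algebra
        finally have 1: "X q * E4 q + Y q * E6 q = r q" using delta_q_nonzero[OF q] by simp
        have "delta_q q * (X q * (t * E6 q) + Y q * (t * E4 q ^ 2)) =
            t * ((r q * E4 q ^ 2 - v q * E6 q) * E6 q + (v q * E4 q - r q * E6 q) * E4 q ^ 2)"
          unfolding XY by (simp only: ring_distribs mult_ac)
        also have "\<dots> = delta_q q * u q" unfolding delta_q_def ut by algebra
        finally have 2: "X q * (t * E6 q) + Y q * (t * E4 q ^ 2) = u q" using delta_q_nonzero[OF q] by simp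
        show ?thesis
          unfolding F1(2)[OF \<tau>] F2(2)[OF \<tau>] lin Fru[OF \<tau>] by (simp only: 1 2 flip: q_def)
      qed
      then show ?thesis
        using X(1) Y(1) by (intro exI[of _ "\<lambda>i. if i = 0 then X else Y"]) (auto simp: less_Suc_eq algebra_simps)
    qed
    show "\<forall>i<length [int b + 4, int b + 6]. c i = 0"
      if \<tau>: "Im \<tau> > 0" and "(\<Sum>i<length [int b + 4, int b + 6]. c i *s ([F1, F2] ! i) \<tau>) = 0" for c \<tau>
    proof -
      define q where "q = nome \<tau>"
      have q: "q \<in> ball 0 1" "q \<noteq> 0" using \<tau> by (simp_all add: q_def)
      have "c 0 *s F1 \<tau> + c 1 *s F2 \<tau> = 0" using that(2) by simp
      then have "?V (c 0 * E4 q + c 1 * E6 q) (c 0 * (t * E6 q) + c 1 * (t * E4 q ^ 2)) \<tau> = V 0 0"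
        unfolding F1(2)[OF \<tau>] F2(2)[OF \<tau>] lin V_0 q_def .
      then have 1: "c 0 * E4 q + c 1 * E6 q = 0"
        and "c 0 * (t * E6 q) + c 1 * (t * E4 q ^ 2) = 0"
        using eta2_nonzero[OF \<tau>] unfolding V_eq_iff by auto
      then have "t * (c 0 * E6 q + c 1 * E4 q ^ 2) = 0" by (simp add: algebra_simps)
      then have 2: "c 0 * E6 q + c 1 * E4 q ^ 2 = 0" using t by simp
      have "delta_q q * c 0 = 0" "delta_q q * c 1 = 0"
        unfolding delta_q_def using 1 2 by algebra+
      then have "c 0 = 0" "c 1 = 0" using delta_q_nonzero[OF q] by simp_all
      then show ?thesis by (auto simp: less_Suc_eq)
    qed
  qed simp
  then show ?thesis by blast
qed

end

lemma generating_weights_extension: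
  "generating_weights \<rho> = (if a = b + 10 then {#int b + 4, int b + 6#} else {#int a, int b#})"
  if cases: "a = b + 2 \<or> b = a + 10 \<or> b = a + 2 \<or> a = b + 10"
proof -
  \<comment> \<open>The exponent 1/6 serves a = b + 2 with n = 0 and b = a + 10 with n = 1; the
    exponent -1/6 serves b = a + 2 and the exceptional a = b + 10.\<close>
  have plus: "\<exists>Fs. homogeneous_basis \<rho> Fs [int a, int b]" if n: "b + 2 = a + 12 * n" for n
  proof -
    obtain H K where H: "H holomorphic_on ball 0 1" "K \<noteq> 0"
      "\<And>\<tau>. Im \<tau> > 0 \<Longrightarrow> nome (1/6 * (-1 / \<tau>)) * H (nome (-1 / \<tau>)) = K - nome (1/6 * \<tau>) * H (nome \<tau>)"
      using primitive_cocycle[of "1/6"] by metis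
    have N: "nome (1/6 * \<tau>) * nome (\<tau> / 12) ^ b = nome (\<tau> / 12) ^ a * nome \<tau> ^ n" for \<tau>
    proof -
      have "nome (1/6 * \<tau>) = nome (\<tau> / 12) ^ 2" using nome_sixth by simp
      then have "nome (1/6 * \<tau>) * nome (\<tau> / 12) ^ b = nome (\<tau> / 12) ^ (b + 2)"
        by (simp only: power_add mult.commute)
      then show ?thesis unfolding n power_add power_mult nome_twelfth .
    qed
    show ?thesis by (rule regular_basis[where \<mu> = "1/6" and n = n, OF H]) (assumption | rule N)+
  qed
  obtain H K where H: "H holomorphic_on ball 0 1" "H 0 \<noteq> 0" "K \<noteq> 0"
    "\<And>\<tau>. Im \<tau> > 0 \<Longrightarrow> nome (-1/6 * (-1 / \<tau>)) * H (nome (-1 / \<tau>)) = K - nome (-1/6 * \<tau>) * H (nome \<tau>)"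
    using primitive_cocycle[of "-1/6"] by metis
  have minus: "\<exists>Fs. homogeneous_basis \<rho> Fs [int a, int b]" if "b = a + 2"
  proof -
    have N: "nome (-1/6 * \<tau>) * nome (\<tau> / 12) ^ b = nome (\<tau> / 12) ^ a * nome \<tau> ^ 0" for \<tau>
      unfolding nome_minus_sixth that power_add by simp
    show ?thesis by (rule regular_basis[where \<mu> = "-1/6" and n = 0, OF H(1,3,4)]) (assumption | rule N)+
  qed
  show ?thesis
  proof (cases "a = b + 10")
    case True
    obtain Fs where "homogeneous_basis \<rho> Fs [int b + 4, int b + 6]"
      using exceptional_basis[OF H(1,3,4) True refl H(2)] by blast
    from generating_weights_eqI[OF hom this] show ?thesis using True by simp
  next
    case False
    then consider "b + 2 = a + 12 * 0" | "b + 2 = a + 12 * 1" | "b = a + 2" using cases by linarith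
    then have "\<exists>Fs. homogeneous_basis \<rho> Fs [int a, int b]" by cases (rule plus minus, assumption)+
    then obtain Fs where "homogeneous_basis \<rho> Fs [int a, int b]" by blast
    from generating_weights_eqI[OF hom this] show ?thesis using False by simp
  qed
qed

end

theorem theorem3p5:
  fixes a b :: nat
    and \<alpha> \<beta> :: "int^2^2 \<Rightarrow> complex"
    and \<rho> :: "int^2^2 \<Rightarrow> complex^2^2"
  assumes "a \<in> {0..11}" and "b \<in> {0..11}"
    and "is_chi a \<alpha>" and "is_chi b \<beta>"
    and "\<rho> \<in> hom SL2Z GL"
    and "indecomposable \<rho>"
    and "is_extension \<alpha> \<rho> \<beta>"
  shows "((a, b) \<noteq> (10, 0) \<and> (a, b) \<noteq> (11, 1) \<longrightarrow>
            generating_weights \<rho> = {#int a, int b#}) \<and>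
         ((a, b) = (10, 0) \<longrightarrow> generating_weights \<rho> = {#4, 6#}) \<and>
         ((a, b) = (11, 1) \<longrightarrow> generating_weights \<rho> = {#5, 7#})"
proof -
  have ab: "a < 12" "b < 12" using assms(1,2) by auto
  obtain P Q x where nf: "P ** Q = mat 1" "Q ** P = mat 1"
    "\<rho> T_mat ** P = P ** mat2 (zeta12 ^ a) 0 0 (zeta12 ^ b)"
    "\<rho> S_mat ** P = P ** mat2 ((- \<i>) ^ a) x 0 ((- \<i>) ^ b)"
    "x \<noteq> 0" "(- \<i>) ^ b = - ((- \<i>) ^ a)" "a = b + 2 \<or> b = a + 10 \<or> b = a + 2 \<or> a = b + 10"
    by (rule extension_normal_form[OF ab assms(3-7)])
  obtain G where G: "G holomorphic_on ball 0 1" "\<And>q. q \<in> ball 0 1 \<Longrightarrow> G q \<noteq> 0"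
    "\<And>\<tau>. Im \<tau> > 0 \<Longrightarrow> nome (-1 / \<tau> / 12) * G (nome (-1 / \<tau>)) = - \<i> * \<tau> * (nome (\<tau> / 12) * G (nome \<tau>))"
    using eta_square by metis
  interpret extension_form \<rho> P Q a b x G
    by unfold_locales (use assms(5) nf ab G in auto)
  \<comment> \<open>As a is at most 11, a = b + 10 leaves only (10, 0) and (11, 1).\<close>
  from generating_weights_extension[OF nf(7)] show ?thesis using ab by auto
qed

end
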